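(* Let $s\in(0,1)$ and $p\in[1,\infty)$. It holds that \[ H^{s,p}(\mathbb{R}^n)=H^{s,p,\delta}(\mathbb{R}^n) \] with equivalent norms, and \[ D^s_\delta u=D^su+\nabla R^s_\delta*u \] for all $u\in H^{s,p}(\mathbb{R}^n)=H^{s,p,\delta}(\mathbb{R}^n)$, where $\nabla R^s_\delta\in C^\infty(\mathbb{R}^n;\mathbb{R}^n)\cap L^1(\mathbb{R}^n;\mathbb{R}^n)$ is given by \[ \nabla R^s_\delta(x)=c_{n,s}(1-w_\delta(x))\frac{x}{|x|^{n+s+1}},\qquad x\in\mathbb{R}^n. \] Moreover, for $\Omega\subset\mathbb{R}^n$ open and bounded with $\Omega_{-\delta}$ Lipschitz, it holds that \[ H^{s,p}_0(\Omega_{-\delta})=H^{s,p,\delta}_0(\Omega) \] with equivalent norms, and $D^s_\delta u=D^su+\nabla R^s_\delta*u$ on $\Omega$ for all $u\in H^{s,p}_0(\Omega_{-\delta})=H^{s,p,\delta}_0(\Omega)$.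
   Context: Fix $n\in\mathbb{N}$, $\delta>0$ and a cut-off function $w_\delta:\mathbb{R}^n\to[0,\infty)$ such that: $w_\delta$ is radial; $w_\delta\in C_c^\infty(B(0,\delta))$; there is $b_0\in(0,1)$ with $w_\delta=1$ on $B(0,b_0\delta)$; $w_\delta(x)\ge w_\delta(y)$ whenever $|x|\le|y|$. Let $c_{n,s}=\frac{\Gamma((n+s+1)/2)}{\pi^{n/2}2^{-s}\Gamma((1-s)/2)}$. For $\psi\in C_c^\infty(\mathbb{R}^n;\mathbb{R}^n)$ define \[ \mathrm{div}^s_\delta\psi(x)=c_{n,s}\int_{\mathbb{R}^n}\frac{\psi(x)-\psi(y)}{|x-y|}\cdot\frac{x-y}{|x-y|}\frac{w_\delta(x-y)}{|x-y|^{n+s-1}}\,dy , \] and let $\mathrm{div}^s\psi$ (Riesz fractional divergence) be given by the same formula with $w_\delta$ replaced by $1$. For $\Omega\subset\mathbb{R}^n$ open, $\Omega_\delta=\{x: d(x,\Omega)<\delta\}$ and $\Omega_{-\delta}=\{x\in\Omega: d(x,\partial\Omega)>\delta\}$, where $\delta$ is assumed small enough that $\Omega_{-\delta}\neq\emptyset$. A function $v\in L^1_{\rm loc}(\Omega;\mathbb{R}^n)$ is the weak nonlocal gradient $D^s_\delta u$ of $u\in L^1_{\rm loc}(\Omega_\delta)$ if $\int_\Omega v\cdot\psi\,dx=-\int_{\Omega_\delta}u\,\mathrm{div}^s_\delta\psi\,dx$ for all $\psi\in C_c^\infty(\Omega;\mathbb{R}^n)$. The space $H^{s,p,\delta}(\Omega)=\{u\in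 L^p(\Omega_\delta): D^s_\delta u\in L^p(\Omega;\mathbb{R}^n)\}$ has norm $(\|u\|_{L^p(\Omega_\delta)}^p+\|D^s_\delta u\|_{L^p(\Omega;\mathbb{R}^n)}^p)^{1/p}$, and $H^{s,p,\delta}_0(\Omega)$ is the closure of $C_c^\infty(\Omega_{-\delta})$ (functions extended by zero) in $H^{s,p,\delta}(\Omega)$. The weak (Riesz) fractional gradient $D^su$ of $u\in L^p(\mathbb{R}^n)$ is the $v\in L^1_{\rm loc}(\mathbb{R}^n;\mathbb{R}^n)$ with $\int_{\mathbb{R}^n}v\cdot\psi\,dx=-\int_{\mathbb{R}^n}u\,\mathrm{div}^s\psi\,dx$ for all $\psi\in C_c^\infty(\mathbb{R}^n;\mathbb{R}^n)$; $H^{s,p}(\mathbb{R}^n)=\{u\in L^p(\mathbb{R}^n): D^su\in L^p(\mathbb{R}^n;\mathbb{R}^n)\}$ with norm $(\|u\|_{L^p}^p+\|D^su\|_{L^p}^p)^{1/p}$; and for an open bounded set $U$, $H^{s,p}_0(U)=\{u\in H^{s,p}(\mathbb{R}^n): u=0\text{ a.e. in }U^c\}$. Functions in $H^{s,p,\delta}_0(\Omega)$, which vanish a.e. in $\Omega_\delta\setminus\Omega_{-\delta}$, are identified with their extension by zero to $\mathbb{R}^n$. *)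

theory Defs
  imports "HOL-Analysis.Analysis"
begin

section \<open>Smooth functions and test functions\<close>

text \<open>\<open>C^k\<close> regularity on the whole space, by recursion on the partial derivatives.\<close>

primrec Ck :: "nat \<Rightarrow> ('a::euclidean_space \<Rightarrow> 'b::real_normed_vector) \<Rightarrow> bool" where
  "Ck 0 f \<longleftrightarrow> continuous_on UNIV f"
| "Ck (Suc k) f \<longleftrightarrow> f differentiable_on UNIV \<and>
     (\<forall>b\<in>Basis. Ck k (\<lambda>x. frechet_derivative f (at x) b))"

definition smooth :: "('a::euclidean_space \<Rightarrow> 'b::real_normed_vector) \<Rightarrow> bool" where
  "smooth f \<longleftrightarrow> (\<forall>k. Ck k f)"

text \<open>Elements of \<open>C_c^\<infinity>(S)\<close> are represented by their extension by zero to the whole space.\<close>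

definition test_functions :: "'a::euclidean_space set \<Rightarrow> ('a \<Rightarrow> 'b::real_normed_vector) set" where
  "test_functions S = {f. smooth f \<and> compact (closure {x. f x \<noteq> 0}) \<and> closure {x. f x \<noteq> 0} \<subseteq> S}"


section \<open>Lebesgue spaces\<close>

text \<open>All function spaces below are sets of functions rather than of equivalence classes modulo
  null sets.  Membership in a space over \<open>S\<close>, and the corresponding norm, depend only on the
  values on \<open>S\<close>.\<close>

definition Lp :: "real \<Rightarrow> 'a::euclidean_space set \<Rightarrow> ('a \<Rightarrow> 'b::euclidean_space) set" where
  "Lp p S = {f. f \<in> borel_measurable (lebesgue_on S) \<and>
               integrable (lebesgue_on S) (\<lambda>x. norm (f x) powr p)}"

definition Lp_norm :: "real \<Rightarrow> 'a::euclidean_space set \<Rightarrow> ('a \<Rightarrow> 'b::euclidean_space) \<Rightarrow> real" where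
  "Lp_norm p S f = (integral\<^sup>L (lebesgue_on S) (\<lambda>x. norm (f x) powr p)) powr (1 / p)"

definition L1_loc :: "'a::euclidean_space set \<Rightarrow> ('a \<Rightarrow> 'b::euclidean_space) set" where
  "L1_loc S = {f. \<forall>K. compact K \<and> K \<subseteq> S \<longrightarrow> integrable (lebesgue_on K) f}"


section \<open>Domains\<close>

text \<open>Since \<open>infdist x {} = 0\<close>, the convention \<open>d(x, \<emptyset>) = \<infinity>\<close> is made explicit.  In particular
  both sets are the whole space if \<open>\<Omega>\<close> is.\<close>

definition outer_nbhd :: "real \<Rightarrow> 'a::euclidean_space set \<Rightarrow> 'a set" where
  "outer_nbhd \<delta> \<Omega> = {x. \<Omega> \<noteq> {} \<and> infdist x \<Omega> < \<delta>}"

definition inner_part :: "real \<Rightarrow> 'a::euclidean_space set \<Rightarrow> 'a set" where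
  "inner_part \<delta> \<Omega> = {x\<in>\<Omega>. frontier \<Omega> = {} \<or> infdist x (frontier \<Omega>) > \<delta>}"

text \<open>Near each boundary point the set is the part above the graph of a Lipschitz function of
  the coordinates orthogonal to some unit vector \<open>e\<close>.\<close>

definition lipschitz_domain :: "'a::euclidean_space set \<Rightarrow> bool" where
  "lipschitz_domain U \<longleftrightarrow> open U \<and>
     (\<forall>z\<in>frontier U. \<exists>r>0. \<exists>e. norm e = 1 \<and>
       (\<exists>\<gamma>::'a \<Rightarrow> real. (\<exists>L. L-lipschitz_on {y. y \<bullet> e = 0} \<gamma>) \<and>
          U \<inter> ball z r = {x \<in> ball z r. x \<bullet> e > \<gamma> (x - (x \<bullet> e) *\<^sub>R e)}))"


section \<open>Nonlocal and fractional gradients\<close>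

definition cutoff :: "real \<Rightarrow> (real^'n \<Rightarrow> real) \<Rightarrow> bool" where
  "cutoff \<delta> w \<longleftrightarrow>
     (\<forall>x. 0 \<le> w x) \<and>
     (\<forall>x y. norm x = norm y \<longrightarrow> w x = w y) \<and>
     w \<in> test_functions (ball 0 \<delta>) \<and>
     (\<exists>b0. 0 < b0 \<and> b0 < 1 \<and> (\<forall>x \<in> ball 0 (b0 * \<delta>). w x = 1)) \<and>
     (\<forall>x y. norm x \<le> norm y \<longrightarrow> w x \<ge> w y)"

definition cns :: "'n::finite itself \<Rightarrow> real \<Rightarrow> real" where
  "cns N s = Gamma ((real CARD('n) + s + 1) / 2) /
     (pi powr (real CARD('n) / 2) * 2 powr (- s) * Gamma ((1 - s) / 2))"

definition nl_div :: "real \<Rightarrow> (real^'n \<Rightarrow> real) \<Rightarrow> (real^'n \<Rightarrow> real^'n) \<Rightarrow> real^'n \<Rightarrow> real" where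
  "nl_div s w \<psi> x = cns TYPE('n) s *
     integral\<^sup>L lebesgue (\<lambda>y. (((\<psi> x - \<psi> y) /\<^sub>R norm (x - y)) \<bullet> ((x - y) /\<^sub>R norm (x - y))) *
       (w (x - y) / norm (x - y) powr (real CARD('n) + s - 1)))"

definition riesz_div :: "real \<Rightarrow> (real^'n \<Rightarrow> real^'n) \<Rightarrow> real^'n \<Rightarrow> real" where
  "riesz_div s = nl_div s (\<lambda>_. 1)"

definition is_nl_grad ::
  "real \<Rightarrow> real \<Rightarrow> (real^'n \<Rightarrow> real) \<Rightarrow> (real^'n) set \<Rightarrow> (real^'n \<Rightarrow> real) \<Rightarrow> (real^'n \<Rightarrow> real^'n) \<Rightarrow> bool"
where
  "is_nl_grad s \<delta> w \<Omega> u v \<longleftrightarrow> u \<in> L1_loc (outer_nbhd \<delta> \<Omega>) \<and> v \<in> L1_loc \<Omega> \<and>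
     (\<forall>\<psi> \<in> test_functions \<Omega>.
        integral\<^sup>L (lebesgue_on \<Omega>) (\<lambda>x. v x \<bullet> \<psi> x) =
        - integral\<^sup>L (lebesgue_on (outer_nbhd \<delta> \<Omega>)) (\<lambda>x. u x * nl_div s w \<psi> x))"

definition is_riesz_grad ::
  "real \<Rightarrow> (real^'n \<Rightarrow> real) \<Rightarrow> (real^'n \<Rightarrow> real^'n) \<Rightarrow> bool"
where
  "is_riesz_grad s u v \<longleftrightarrow> v \<in> L1_loc UNIV \<and>
     (\<forall>\<psi> \<in> test_functions UNIV.
        integral\<^sup>L lebesgue (\<lambda>x. v x \<bullet> \<psi> x) = - integral\<^sup>L lebesgue (\<lambda>x. u x * riesz_div s \<psi> x))"

text \<open>Weak gradients are unique up to null sets; the operators below pick a representative, and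
  are meaningful only for functions that have a weak gradient.\<close>

definition nl_grad ::
  "real \<Rightarrow> real \<Rightarrow> (real^'n \<Rightarrow> real) \<Rightarrow> (real^'n) set \<Rightarrow> (real^'n \<Rightarrow> real) \<Rightarrow> real^'n \<Rightarrow> real^'n"
where
  "nl_grad s \<delta> w \<Omega> u = (SOME v. is_nl_grad s \<delta> w \<Omega> u v)"

definition riesz_grad :: "real \<Rightarrow> (real^'n \<Rightarrow> real) \<Rightarrow> real^'n \<Rightarrow> real^'n" where
  "riesz_grad s u = (SOME v. is_riesz_grad s u v)"


section \<open>The function spaces\<close>

definition H_nl ::
  "real \<Rightarrow> real \<Rightarrow> real \<Rightarrow> (real^'n \<Rightarrow> real) \<Rightarrow> (real^'n) set \<Rightarrow> (real^'n \<Rightarrow> real) set"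
where
  "H_nl s p \<delta> w \<Omega> = {u \<in> Lp p (outer_nbhd \<delta> \<Omega>). \<exists>v \<in> Lp p \<Omega>. is_nl_grad s \<delta> w \<Omega> u v}"

definition H_nl_norm ::
  "real \<Rightarrow> real \<Rightarrow> real \<Rightarrow> (real^'n \<Rightarrow> real) \<Rightarrow> (real^'n) set \<Rightarrow> (real^'n \<Rightarrow> real) \<Rightarrow> real"
where
  "H_nl_norm s p \<delta> w \<Omega> u =
     (Lp_norm p (outer_nbhd \<delta> \<Omega>) u powr p + Lp_norm p \<Omega> (nl_grad s \<delta> w \<Omega> u) powr p) powr (1 / p)"

definition H_nl_0 ::
  "real \<Rightarrow> real \<Rightarrow> real \<Rightarrow> (real^'n \<Rightarrow> real) \<Rightarrow> (real^'n) set \<Rightarrow> (real^'n \<Rightarrow> real) set"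
where
  "H_nl_0 s p \<delta> w \<Omega> = {u \<in> H_nl s p \<delta> w \<Omega>.
     \<forall>\<epsilon>>0. \<exists>\<phi> \<in> test_functions (inner_part \<delta> \<Omega>). H_nl_norm s p \<delta> w \<Omega> (\<lambda>x. u x - \<phi> x) < \<epsilon>}"

text \<open>\<open>H_nl_0\<close> constrains its elements on \<open>\<Omega>\<^sub>\<delta>\<close> only; here they are identified with their extension
  by zero to the whole space (up to null sets).\<close>

definition H_nl_0_ext ::
  "real \<Rightarrow> real \<Rightarrow> real \<Rightarrow> (real^'n \<Rightarrow> real) \<Rightarrow> (real^'n) set \<Rightarrow> (real^'n \<Rightarrow> real) set"
where
  "H_nl_0_ext s p \<delta> w \<Omega> = {u. \<exists>v \<in> H_nl_0 s p \<delta> w \<Omega>.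
     AE x in lebesgue. u x = (if x \<in> outer_nbhd \<delta> \<Omega> then v x else 0)}"

definition H_riesz :: "real \<Rightarrow> real \<Rightarrow> (real^'n \<Rightarrow> real) set" where
  "H_riesz s p = {u \<in> Lp p UNIV. \<exists>v \<in> Lp p UNIV. is_riesz_grad s u v}"

definition H_riesz_norm :: "real \<Rightarrow> real \<Rightarrow> (real^'n \<Rightarrow> real) \<Rightarrow> real" where
  "H_riesz_norm s p u =
     (Lp_norm p UNIV u powr p + Lp_norm p UNIV (riesz_grad s u) powr p) powr (1 / p)"

definition H_riesz_0 :: "real \<Rightarrow> real \<Rightarrow> (real^'n) set \<Rightarrow> (real^'n \<Rightarrow> real) set" where
  "H_riesz_0 s p U = {u \<in> H_riesz s p. AE x in lebesgue. x \<notin> U \<longrightarrow> u x = 0}"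

definition equivalent_norms_on :: "'v set \<Rightarrow> ('v \<Rightarrow> real) \<Rightarrow> ('v \<Rightarrow> real) \<Rightarrow> bool" where
  "equivalent_norms_on V N1 N2 \<longleftrightarrow>
     (\<exists>c>0. \<exists>C>0. \<forall>u\<in>V. c * N1 u \<le> N2 u \<and> N2 u \<le> C * N1 u)"


section \<open>The convolution kernel\<close>

definition grad_R :: "real \<Rightarrow> (real^'n \<Rightarrow> real) \<Rightarrow> real^'n \<Rightarrow> real^'n" where
  "grad_R s w x = (cns TYPE('n) s * (1 - w x)) *\<^sub>R (x /\<^sub>R norm x powr (real CARD('n) + s + 1))"

definition convol :: "(real^'n \<Rightarrow> real^'n) \<Rightarrow> (real^'n \<Rightarrow> real) \<Rightarrow> real^'n \<Rightarrow> real^'n" where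
  "convol k u x = integral\<^sup>L lebesgue (\<lambda>y. u y *\<^sub>R k (x - y))"

end

theory Submission
  imports Defs
begin

text \<open>Put \<open>K(z) = c w(z) z / |z|^(n+s+1)\<close> and \<open>k = grad_R s w\<close>.  Both are odd, \<open>K\<close> has support in
  \<open>ball 0 \<delta>\<close> and \<open>|z| |K(z)|\<close> is integrable, and \<open>k\<close> itself is integrable with vanishing integral.
  As the kernel of the Riesz divergence is \<open>K + k\<close>, the two divergences of \<open>\<psi>\<close> differ by the
  convolution of \<open>\<psi>\<close> with \<open>k\<close>.  By Fubini, \<open>v\<close> is a Riesz gradient of \<open>u\<close> iff \<open>v + k * u\<close> is a
  nonlocal gradient, and Young's inequality makes the norms comparable.

  For the local spaces, a function that vanishes off \<open>\<Omega>\<close> shrunk by \<open>\<delta>\<close> has a nonlocal gradient that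
  vanishes off \<open>\<Omega>\<close>, so that both local norms are norms over the whole space.  It remains to see that test functions are
  dense: a bump function localises to one boundary chart (a Leibniz rule with an error
  term of order zero), where convolution with a mollifier centred at a small multiple of the
  inward direction approximates the function and its gradient and moves the support into the open set.\<close>

section \<open>Smooth functions and test functions\<close>

text \<open>The obstacle is that \<open>|K(z)|\<close> grows like \<open>|z|^(-n-s)\<close> at the
  origin, so the gradient is no convolution with \<open>K\<close>. Integrability of
  \<open>|z| |K(z)|\<close> is exactly \<open>s < 1\<close>, and the Lipschitz bound of a test
  function supplies the factor \<open>|z|\<close>. The difference is therefore always kept on a
  smooth function, and a rough \<open>u\<close> is reached by duality. Integrability of
  \<open>k\<close> at infinity is \<open>s > 0\<close>.

  Every space is translated into \<open>weak_grad\<close>, a relation between Borel functions on the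
  whole space tested by all smooth compactly supported fields. For functions on \<Omega> the tests
  are a priori supported in \<Omega>; the larger class of tests is gained in the limit, since
  approximating test functions have whole-space gradients and the weak gradient is closed.

  The off-centre mollifier translates and smooths in a single convolution, whose gradient is the
  same convolution applied to the gradient.\<close>

primrec Ck_on :: "nat \<Rightarrow> 'a::euclidean_space set \<Rightarrow> ('a \<Rightarrow> 'b::real_normed_vector) \<Rightarrow> bool" where
  "Ck_on 0 S f \<longleftrightarrow> continuous_on S f"
| "Ck_on (Suc k) S f \<longleftrightarrow> (\<forall>x\<in>S. f differentiable (at x)) \<and>
     (\<forall>b\<in>Basis. Ck_on k S (\<lambda>x. frechet_derivative f (at x) b))"

lemma Ck_on_UNIV: "Ck_on k UNIV f = Ck k f"
  by (induction k arbitrary: f) (auto simp: differentiable_on_def)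

lemma Ck_on_cong:
  assumes "open S" "\<And>x. x \<in> S \<Longrightarrow> f x = g x"
  shows "Ck_on k S f = Ck_on k S g"
  using assms(2)
proof (induction k arbitrary: f g)
  case 0
  then show ?case by (simp cong: continuous_on_cong)
next
  case (Suc k)
  have D: "(f has_derivative D) (at x) = (g has_derivative D) (at x)" if "x \<in> S" for x D
    using has_derivative_transform_within_open[OF _ assms(1) that] Suc.prems by metis
  have d: "f differentiable (at x) \<longleftrightarrow> g differentiable (at x)" if "x \<in> S" for x
    using D[OF that] by (simp add: differentiable_def)
  have e: "frechet_derivative f (at x) = frechet_derivative g (at x)" if "x \<in> S" for x
    using D[OF that] by (simp add: frechet_derivative_def)
  show ?case
    unfolding Ck_on.simps by (intro conj_cong ball_cong refl d Suc.IH) (simp_all add: e)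
qed

text \<open>Needed for the kernel \<open>k\<close>, which is smooth for different reasons off the
  origin and near it. This gluing is why \<open>Ck\<close> gets a version on open sets, with
  derivatives still taken \<open>at x\<close> in the full space.\<close>

lemma Ck_on_Un:
  assumes "open S" "open T" "Ck_on k S f" "Ck_on k T f"
  shows "Ck_on k (S \<union> T) f"
  using assms(3,4)
proof (induction k arbitrary: f)
  case 0
  then show ?case using continuous_on_open_Un[OF assms(1,2)] by simp
qed auto

lemma Ck_on_subset: "Ck_on k S f \<Longrightarrow> T \<subseteq> S \<Longrightarrow> Ck_on k T f"
proof (induction k arbitrary: f)
  case 0
  then show ?case using continuous_on_subset[of S f T] by simp
qed auto

text \<open>Derivatives in the full space are unique, so the choice operator behind
  \<open>frechet_derivative\<close> may be replaced by any explicit formula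
  \<open>D\<close>.\<close>

lemma Ck_on_SucI:
  assumes "\<And>x. x \<in> S \<Longrightarrow> (f has_derivative D x) (at x)" "open S"
    and "\<And>b. b \<in> Basis \<Longrightarrow> Ck_on k S (\<lambda>x. D x b)"
  shows "Ck_on (Suc k) S f"
proof -
  have "frechet_derivative f (at x) = D x" if "x \<in> S" for x
    using assms(1)[OF that] frechet_derivative_at by metis
  then have "Ck_on k S (\<lambda>x. frechet_derivative f (at x) b) = Ck_on k S (\<lambda>x. D x b)" for b
    by (intro Ck_on_cong assms(2)) auto
  then show ?thesis
    using assms by (auto simp: differentiable_def)
qed

lemma Ck_on_SucD:
  assumes "Ck_on (Suc k) S f"
  shows "Ck_on k S f"
  using assms
proof (induction k arbitrary: f)
  case 0
  then show ?case
    by (auto intro!: continuous_at_imp_continuous_on differentiable_imp_continuous_within)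
qed auto

lemma Ck_on_has_derivative:
  "Ck_on (Suc k) S f \<Longrightarrow> x \<in> S \<Longrightarrow> (f has_derivative frechet_derivative f (at x)) (at x)"
  by (simp add: frechet_derivative_works)

lemma Ck_on_const: "open S \<Longrightarrow> Ck_on k S (\<lambda>x. c)"
proof (induction k arbitrary: c)
  case (Suc k)
  then show ?case
    by (intro Ck_on_SucI[where D="\<lambda>_ _. 0"]) auto
qed auto

lemma Ck_on_add:
  assumes "open S" "Ck_on k S f" "Ck_on k S g"
  shows "Ck_on k S (\<lambda>x. f x + g x)"
  using assms(2,3)
proof (induction k arbitrary: f g)
  case 0
  then show ?case by (auto intro: continuous_intros)
next
  case (Suc k)
  show ?case
  proof (rule Ck_on_SucI)
    fix x assume "x \<in> S"
    then show "((\<lambda>x. f x + g x) has_derivative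
        (\<lambda>h. frechet_derivative f (at x) h + frechet_derivative g (at x) h)) (at x)"
      by (intro has_derivative_add Ck_on_has_derivative[OF Suc.prems(1)] Ck_on_has_derivative[OF Suc.prems(2)])
  qed (use Suc assms(1) in auto)
qed

lemma Ck_on_linear:
  assumes "open S" "bounded_linear h" "Ck_on k S f"
  shows "Ck_on k S (\<lambda>x. h (f x))"
  using assms(3)
proof (induction k arbitrary: f)
  case 0
  then show ?case using assms(2) bounded_linear.continuous_on by auto
next
  case (Suc k)
  show ?case
    by (rule Ck_on_SucI[where D="\<lambda>x v. h (frechet_derivative f (at x) v)"])
      (use Suc assms Ck_on_has_derivative[OF Suc.prems] in
        \<open>auto intro: bounded_linear.has_derivative\<close>)
qed

text \<open>In the product rule each factor also occurs undifferentiated, hence the drop by one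
  order through \<open>Ck_on_SucD\<close> before the induction hypothesis applies.\<close>

lemma Ck_on_bilinear:
  assumes "open S" "bounded_bilinear h" "Ck_on k S f" "Ck_on k S g"
  shows "Ck_on k S (\<lambda>x. h (f x) (g x))"
  using assms(3,4)
proof (induction k arbitrary: f g)
  case 0
  then show ?case using assms(2) bounded_bilinear.continuous_on by auto
next
  case (Suc k)
  note D = bounded_bilinear.FDERIV[OF assms(2)
      Ck_on_has_derivative[OF Suc.prems(1)] Ck_on_has_derivative[OF Suc.prems(2)]]
  show ?case
  proof (rule Ck_on_SucI[OF D])
    fix b :: 'a assume "b \<in> Basis"
    then have "Ck_on k S (\<lambda>x. frechet_derivative f (at x) b)" "Ck_on k S (\<lambda>x. frechet_derivative g (at x) b)"
      using Suc.prems by auto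
    then show "Ck_on k S (\<lambda>x. h (f x) (frechet_derivative g (at x) b) + h (frechet_derivative f (at x) b) (g x))"
      using Suc.IH Suc.prems[THEN Ck_on_SucD] by (intro Ck_on_add assms(1)) auto
  qed (use assms in auto)
qed

lemma Ck_on_ident: "open S \<Longrightarrow> Ck_on k S (\<lambda>x. x)"
  by (cases k) (auto intro!: Ck_on_SucI[where D="\<lambda>_ h. h"] Ck_on_const simp del: Ck_on.simps(2))

text \<open>The derivative \<open>a |x|^(a-2) (x \<bullet> h)\<close> contains a power with another
  exponent, so the induction must leave \<open>a\<close> free.\<close>

lemma Ck_on_norm_powr: "Ck_on k (- {0}) (\<lambda>x::'a::euclidean_space. norm x powr a)"
proof (induction k arbitrary: a)
  case 0
  then show ?case by (auto intro!: continuous_intros)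
next
  case (Suc k)
  show ?case
  proof (rule Ck_on_SucI[where D="\<lambda>x h. (a * norm x powr (a - 2)) * (x \<bullet> h)"])
    fix x :: 'a assume "x \<in> - {0}"
    then show "((\<lambda>x. norm x powr a) has_derivative (\<lambda>h. (a * norm x powr (a - 2)) * (x \<bullet> h))) (at x)"
      by (auto intro!: derivative_eq_intros has_derivative_norm
          simp: sgn_div_norm fun_eq_iff powr_diff powr_minus field_simps inner_commute power2_eq_square)
  next
    fix b :: 'a assume "b \<in> Basis"
    have 1: "Ck_on k (-{0}) (\<lambda>x::'a. a * norm x powr (a - 2))"
      using Ck_on_bilinear[OF _ bounded_bilinear_mult Ck_on_const Suc.IH[of "a-2"], of a] by auto
    have "Ck_on k (-{0}) (\<lambda>x::'a. x)" by (rule Ck_on_ident) auto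
    then have 2: "Ck_on k (-{0}) (\<lambda>x::'a. x \<bullet> b)"
      by (intro Ck_on_linear[OF _ bounded_linear_inner_left]) auto
    show "Ck_on k (-{0}) (\<lambda>x::'a. (a * norm x powr (a - 2)) * (x \<bullet> b))"
      using Ck_on_bilinear[OF _ bounded_bilinear_mult 1 2] by auto
  qed auto
qed

lemma Ck_affine:
  assumes "Ck k f"
  shows "Ck k (\<lambda>x. f (a *\<^sub>R x + c))"
  using assms
proof (induction k arbitrary: f)
  case 0
  then show ?case
    by (auto intro!: continuous_on_compose2[of UNIV f] continuous_intros)
next
  case (Suc k)
  have D: "((\<lambda>x. f (a *\<^sub>R x + c)) has_derivative
      (\<lambda>h. frechet_derivative f (at (a *\<^sub>R x + c)) (a *\<^sub>R h))) (at x)" for x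
    by (rule has_derivative_compose[of "\<lambda>x. a *\<^sub>R x + c" "\<lambda>h. a *\<^sub>R h" x UNIV f
          "frechet_derivative f (at (a *\<^sub>R x + c))"])
      (use Suc.prems in \<open>auto intro!: derivative_eq_intros simp: frechet_derivative_works[symmetric]
         differentiable_on_def\<close>)
  have "linear (frechet_derivative f (at x))" for x
    using Suc.prems by (intro linear_frechet_derivative) (auto simp: differentiable_on_def)
  then have *: "frechet_derivative f (at x) (a *\<^sub>R h) = a *\<^sub>R frechet_derivative f (at x) h" for x h
    by (simp add: linear_scale)
  have "Ck_on k UNIV (\<lambda>x. a *\<^sub>R frechet_derivative f (at (a *\<^sub>R x + c)) b)" if "b \<in> Basis" for b
    using Suc.IH[of "\<lambda>x. frechet_derivative f (at x) b"] Suc.prems that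
    by (intro Ck_on_linear[OF open_UNIV bounded_linear_scaleR_right]) (simp add: Ck_on_UNIV)
  then have "Ck_on (Suc k) UNIV (\<lambda>x. f (a *\<^sub>R x + c))"
    by (intro Ck_on_SucI[OF D]) (auto simp: *)
  then show ?case by (simp only: Ck_on_UNIV)
qed

lemma smooth_add:
  assumes "smooth f" "smooth g" shows "smooth (\<lambda>x. f x + g x)"
  using assms Ck_on_add[OF open_UNIV, of _ f g] by (simp add: smooth_def Ck_on_UNIV)

lemma smooth_const: "smooth (\<lambda>x. c)"
  using Ck_on_const[OF open_UNIV, of _ c] by (auto simp: smooth_def Ck_on_UNIV)

lemma smooth_linear:
  assumes "bounded_linear h" "smooth f" shows "smooth (\<lambda>x. h (f x))"
  using assms(2) Ck_on_linear[OF open_UNIV assms(1), of _ f] by (simp add: smooth_def Ck_on_UNIV)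

lemma smooth_bilinear:
  assumes "bounded_bilinear h" "smooth f" "smooth g" shows "smooth (\<lambda>x. h (f x) (g x))"
  using assms(2,3) Ck_on_bilinear[OF open_UNIV assms(1), of _ f g]
  by (simp add: smooth_def Ck_on_UNIV)

lemma smooth_affine:
  assumes "smooth f" shows "smooth (\<lambda>x. f (a *\<^sub>R x + c))"
  using assms Ck_affine[of _ f a c] by (simp add: smooth_def)

lemma smooth_has_derivative:
  assumes "smooth f"
  shows "(f has_derivative frechet_derivative f (at x)) (at x)"
proof -
  have "Ck (Suc 0) f" using assms unfolding smooth_def by blast
  then have "f differentiable (at x)" by (simp add: differentiable_on_def)
  then show ?thesis by (simp only: frechet_derivative_works)
qed

lemma smooth_frechet_derivative:
  assumes "smooth f" "b \<in> Basis"
  shows "smooth (\<lambda>x. frechet_derivative f (at x) b)"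
proof -
  have "Ck (Suc k) f" for k using assms unfolding smooth_def by blast
  then show ?thesis using assms(2) by (simp add: smooth_def)
qed

lemma smooth_continuous: "smooth f \<Longrightarrow> continuous_on S f"
proof -
  assume "smooth f"
  then have "Ck 0 f" unfolding smooth_def ..
  then have "continuous_on UNIV f" by simp
  then show ?thesis by (rule continuous_on_subset) simp
qed

section \<open>Test functions: closure properties and bounds\<close>

lemma test_functions_iff:
  "f \<in> test_functions S \<longleftrightarrow> smooth f \<and> (\<exists>C. compact C \<and> C \<subseteq> S \<and> (\<forall>x. x \<notin> C \<longrightarrow> f x = 0))"
proof -
  have "compact (closure {x. f x \<noteq> 0}) \<and> closure {x. f x \<noteq> 0} \<subseteq> S
      \<longleftrightarrow> (\<exists>C. compact C \<and> C \<subseteq> S \<and> (\<forall>x. x \<notin> C \<longrightarrow> f x = 0))" (is "?l = ?r")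
  proof
    assume ?l
    then show ?r
      using closure_subset[of "{x. f x \<noteq> 0}"] by (intro exI[of _ "closure {x. f x \<noteq> 0}"]) auto
  next
    assume ?r
    then obtain C where C: "compact C" "C \<subseteq> S" "\<forall>x. x \<notin> C \<longrightarrow> f x = 0" by blast
    then have "closure {x. f x \<noteq> 0} \<subseteq> C"
      by (intro closure_minimal) (auto simp: compact_imp_closed)
    with C show ?l
      by (meson bounded_subset closed_closure compact_eq_bounded_closed order_trans)
  qed
  then show ?thesis by (simp add: test_functions_def)
qed

lemma test_functions_mono: "S \<subseteq> T \<Longrightarrow> test_functions S \<subseteq> test_functions T"
  by (auto simp: test_functions_def)

lemma test_functions_smooth: "f \<in> test_functions S \<Longrightarrow> smooth f"
  by (simp add: test_functions_def)

lemma test_functions_bilinear_right: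
  assumes "bounded_bilinear h" "smooth f" "g \<in> test_functions S"
  shows "(\<lambda>x. h (f x) (g x)) \<in> test_functions S"
  using assms smooth_bilinear[OF assms(1,2), of g]
  by (auto simp: test_functions_iff bounded_bilinear.zero_right)

lemma test_functions_linear:
  assumes "bounded_linear h" "f \<in> test_functions S"
  shows "(\<lambda>x. h (f x)) \<in> test_functions S"
  using assms linear_0[OF bounded_linear.linear[OF assms(1)]]
    smooth_linear[OF assms(1), of f]
  by (auto simp: test_functions_iff)

lemma test_functions_affine:
  fixes f :: "'a::euclidean_space \<Rightarrow> 'b::real_normed_vector"
  assumes "f \<in> test_functions S" "a \<noteq> 0"
  shows "(\<lambda>x. f (a *\<^sub>R x + c)) \<in> test_functions ((\<lambda>x. a *\<^sub>R x + c) -` S)"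
proof -
  obtain C where C: "compact C" "C \<subseteq> S" "\<forall>x. x \<notin> C \<longrightarrow> f x = 0" "smooth f"
    using assms(1) by (auto simp: test_functions_iff)
  have "compact ((\<lambda>y. (1/a) *\<^sub>R (y - c)) ` C)"
    by (intro compact_continuous_image continuous_intros C)
  moreover have "(\<lambda>y. (1/a) *\<^sub>R (y - c)) ` C = (\<lambda>x. a *\<^sub>R x + c) -` C"
    using assms(2) by (auto simp: image_iff intro!: bexI[of _ "a *\<^sub>R _ + c"])
  ultimately show ?thesis
    unfolding test_functions_iff using C smooth_affine[OF C(4), of a c]
    by (intro conjI exI[of _ "(\<lambda>x. a *\<^sub>R x + c) -` C"]) auto
qed

lemma test_functions_frechet_derivative:
  assumes "f \<in> test_functions S" "b \<in> Basis"
  shows "(\<lambda>x. frechet_derivative f (at x) b) \<in> test_functions S"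
proof -
  obtain C where C: "compact C" "C \<subseteq> S" "\<forall>x. x \<notin> C \<longrightarrow> f x = 0" "smooth f"
    using assms(1) by (auto simp: test_functions_iff)
  have "frechet_derivative f (at x) b = 0" if "x \<notin> C" for x
  proof -
    have "(f has_derivative (\<lambda>_. 0)) (at x)"
      by (rule has_derivative_transform_within_open[of "\<lambda>_. 0" _ _ _ "-C"])
        (use C that in \<open>auto simp: compact_imp_closed open_Compl\<close>)
    then show ?thesis by (simp flip: frechet_derivative_at)
  qed
  then show ?thesis
    using C assms(2) by (auto simp: test_functions_iff smooth_frechet_derivative)
qed

lemma test_functions_bounded:
  assumes "f \<in> test_functions S"
  obtains B where "B \<ge> 0" "\<And>x. norm (f x) \<le> B"
proof -
  obtain C where C: "compact C" "\<forall>x. x \<notin> C \<longrightarrow> f x = 0" "smooth f"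
    using assms(1) by (auto simp: test_functions_iff)
  have "bounded (f ` C)"
    using C by (intro compact_imp_bounded compact_continuous_image smooth_continuous)
  then obtain B where B: "\<And>x. x \<in> C \<Longrightarrow> norm (f x) \<le> B" "B > 0"
    unfolding bounded_pos by auto
  then show thesis using C(2) that[of B] by (metis less_imp_le norm_zero)
qed

lemma linear_norm_le_Basis:
  fixes L :: "'a::euclidean_space \<Rightarrow> 'b::real_normed_vector"
  assumes "linear L"
  shows "norm (L h) \<le> (\<Sum>b\<in>Basis. norm (L b)) * norm h"
proof -
  have "norm (L h) = norm (L (\<Sum>b\<in>Basis. (h \<bullet> b) *\<^sub>R b))"
    by (simp add: euclidean_representation)
  also have "\<dots> = norm (\<Sum>b\<in>Basis. (h \<bullet> b) *\<^sub>R L b)"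
    by (simp add: linear_sum[OF assms] linear_scale[OF assms])
  also have "\<dots> \<le> (\<Sum>b\<in>Basis. norm h * norm (L b))"
    unfolding norm_scaleR by (intro sum_norm_le) (auto intro!: mult_right_mono Basis_le_norm)
  finally show ?thesis by (simp add: sum_distrib_left mult.commute)
qed

lemma test_functions_lipschitz:
  fixes f :: "'a::euclidean_space \<Rightarrow> 'b::real_normed_vector"
  assumes "f \<in> test_functions S"
  obtains L where "L \<ge> 0" "\<And>x y. norm (f x - f y) \<le> L * norm (x - y)"
proof -
  have "\<exists>B. \<forall>x. norm (frechet_derivative f (at x) b) \<le> B" if "b \<in> Basis" for b
    using test_functions_bounded[OF test_functions_frechet_derivative[OF assms that]] by blast
  then have "\<exists>B. \<forall>b\<in>Basis. \<forall>x. norm (frechet_derivative f (at x) b) \<le> B b"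
    by (intro bchoice) blast
  then obtain B where B: "\<And>b x. b \<in> Basis \<Longrightarrow> norm (frechet_derivative f (at x) b) \<le> B b" by blast
  define L where "L = (\<Sum>b\<in>Basis. B b)"
  have D: "(f has_derivative frechet_derivative f (at x)) (at x)" for x
    using assms by (intro smooth_has_derivative test_functions_smooth)
  have L: "norm (frechet_derivative f (at x) h) \<le> L * norm h" for x h
  proof -
    have "norm (frechet_derivative f (at x) h) \<le> (\<Sum>b\<in>Basis. norm (frechet_derivative f (at x) b)) * norm h"
      by (intro linear_norm_le_Basis has_derivative_linear[OF D])
    also have "\<dots> \<le> L * norm h" unfolding L_def by (intro mult_right_mono sum_mono B) auto
    finally show ?thesis .
  qed
  have "L \<ge> 0" unfolding L_def by (intro sum_nonneg) (use B norm_ge_zero order_trans in blast)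
  moreover have "norm (f x - f y) \<le> L * norm (x - y)" for x y
    by (rule differentiable_bound[of UNIV f "\<lambda>x. frechet_derivative f (at x)"])
      (use D L in \<open>auto intro!: onorm_bound[OF \<open>L \<ge> 0\<close>]\<close>)
  ultimately show thesis by (rule that)
qed

lemma test_functions_borel:
  "f \<in> test_functions S \<Longrightarrow> f \<in> borel_measurable borel"
  using smooth_continuous[of f UNIV] test_functions_smooth[of f S]
  by (auto intro: borel_measurable_continuous_onI)

lemma test_functions_uniformly_continuous:
  fixes f :: "'a::euclidean_space \<Rightarrow> 'b::real_normed_vector"
  assumes "f \<in> test_functions S" "e > 0"
  obtains d where "d > 0" "\<And>x y. norm (x - y) < d \<Longrightarrow> norm (f x - f y) < e"
proof -
  obtain L where L: "L \<ge> 0" "\<And>x y. norm (f x - f y) \<le> L * norm (x - y)"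
    using test_functions_lipschitz[OF assms(1)] by metis
  show thesis
  proof
    show "e / (L + 1) > 0" using L assms by auto
    fix x y :: 'a assume *: "norm (x - y) < e / (L + 1)"
    have "norm (f x - f y) \<le> L * norm (x - y)" by (rule L)
    also have "\<dots> \<le> L * (e / (L + 1))" using * L by (intro mult_left_mono) auto
    also have "\<dots> < e" using L assms by (simp add: field_simps)
    finally show "norm (f x - f y) < e" .
  qed
qed

lemma test_functions_add:
  assumes "f \<in> test_functions S" "g \<in> test_functions S"
  shows "(\<lambda>x. f x + g x) \<in> test_functions S"
proof -
  obtain C D where "compact C" "C \<subseteq> S" "\<forall>x. x \<notin> C \<longrightarrow> f x = 0" "compact D" "D \<subseteq> S" "\<forall>x. x \<notin> D \<longrightarrow> g x = 0"
    using assms by (auto simp: test_functions_iff)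
  then show ?thesis
    unfolding test_functions_iff
    by (intro conjI smooth_add test_functions_smooth[OF assms(1)] test_functions_smooth[OF assms(2)]
        exI[of _ "C \<union> D"]) auto
qed

section \<open>Convolution inequalities\<close>

text \<open>\<open>a = 1\<close> gives translations and \<open>a = -1\<close> reflections; for both
  the Jacobian factor is 1.\<close>

lemma distr_lborel_isometry:
  fixes t :: "'a::euclidean_space"
  assumes "\<bar>a\<bar> = (1::real)"
  shows "distr lborel borel (\<lambda>x. t + a *\<^sub>R x) = lborel"
proof -
  have "a \<noteq> 0" using assms by auto
  from lborel_affine[OF this, of t] show ?thesis
    using assms by (simp add: density_1)
qed

lemma nn_integral_lborel_minus:
  fixes t :: "'a::euclidean_space"
  shows "f \<in> borel_measurable borel \<Longrightarrow> (\<integral>\<^sup>+x. f (x - t) \<partial>lborel) = (\<integral>\<^sup>+x. f x \<partial>lborel)"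
  using distr_lborel_isometry[of 1 "-t"] nn_integral_distr[of "\<lambda>x. -t + 1 *\<^sub>R x" lborel borel f]
  by (auto simp: algebra_simps)

lemma integral_lborel_isometry:
  fixes t :: "'a::euclidean_space" and f :: "'a \<Rightarrow> 'b::{banach,second_countable_topology}"
  assumes "\<bar>a\<bar> = (1::real)" "f \<in> borel_measurable borel"
  shows "(LBINT x. f (t + a *\<^sub>R x)) = (LBINT x. f x)"
    "integrable lborel (\<lambda>x. f (t + a *\<^sub>R x)) \<longleftrightarrow> integrable lborel f"
  using integral_distr[of "\<lambda>x. t + a *\<^sub>R x" lborel borel f]
    integrable_distr_eq[of "\<lambda>x. t + a *\<^sub>R x" lborel borel f]
    distr_lborel_isometry[OF assms(1), of t] assms(2)
  by auto

lemma
  fixes t :: "'a::euclidean_space" and f :: "'a \<Rightarrow> 'b::{banach,second_countable_topology}"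
  assumes "f \<in> borel_measurable borel"
  shows integral_lborel_minus: "(LBINT x. f (x - t)) = (LBINT x. f x)"
    and integral_lborel_plus: "(LBINT x. f (x + t)) = (LBINT x. f x)"
    and integral_lborel_reflect: "(LBINT x. f (t - x)) = (LBINT x. f x)"
    and integral_lborel_uminus: "(LBINT x. f (- x)) = (LBINT x. f x)"
    and integrable_lborel_minus: "integrable lborel (\<lambda>x. f (x - t)) \<longleftrightarrow> integrable lborel f"
    and integrable_lborel_plus: "integrable lborel (\<lambda>x. f (x + t)) \<longleftrightarrow> integrable lborel f"
  using integral_lborel_isometry[of 1 f "-t"] integral_lborel_isometry[of "-1" f t]
    integral_lborel_isometry[of 1 f t] integral_lborel_isometry[of "-1" f 0] assms
  by (auto simp: algebra_simps)

section \<open>Inequalities for powers; Jensen, Minkowski and Young\<close>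

lemma powr_tangent:
  fixes a t p :: real
  assumes "0 \<le> a" "0 \<le> t" "1 \<le> p"
  shows "a powr p + p * a powr (p - 1) * (t - a) \<le> t powr p"
\<comment> \<open>Boundary cases apart: the tangent argument needs \<open>a\<close> and
  \<open>t\<close> inside the open half-line.\<close>
proof (cases "a = 0 \<or> t = 0")
  case True
  moreover have "a powr p \<le> p * (a powr (p - 1) * a)" if "a > 0"
  proof -
    have "a powr (p - 1) * a = a powr p"
      using that by (simp add: powr_diff)
    then show ?thesis using assms(3) mult_right_mono[of 1 p "a powr p"] by simp
  qed
  ultimately show ?thesis using assms by (cases "a = 0") auto
next
  case False
  then have "a > 0" "t > 0" using assms by auto
  have "t powr p - a powr p \<ge> (p * a powr (p - 1)) * (t - a)"
    by (rule convex_on_imp_above_tangent[OF powr_convex[OF assms(3)]])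
      (use \<open>a > 0\<close> \<open>t > 0\<close> in \<open>auto simp: interior_open intro!: derivative_eq_intros\<close>)
  then show ?thesis by simp
qed

lemma le_one_plus_powr:
  fixes t p :: real
  assumes "0 \<le> t" "1 \<le> p"
  shows "t \<le> 1 + t powr p"
proof (cases "t \<le> 1")
  case False
  then have "t powr 1 \<le> t powr p" using assms by (intro powr_mono) auto
  then show ?thesis using False assms by simp
qed (simp add: add_increasing2)

text \<open>Rescaling by \<open>\<eta>\<close> makes the constant term small at the price of a large
  factor before \<open>t powr p\<close>. Pairings are estimated by it without a dual exponent, which
  would be infinite for \<open>p = 1\<close>.\<close>

lemma le_scaled_powr:
  fixes t p \<eta> :: real
  assumes "0 \<le> t" "1 \<le> p" "0 < \<eta>"
  shows "t \<le> \<eta> + \<eta> powr (1 - p) * t powr p"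
proof -
  have "t / \<eta> \<le> 1 + (t / \<eta>) powr p" using assms by (intro le_one_plus_powr) auto
  then have "t \<le> \<eta> * (1 + (t / \<eta>) powr p)" using assms by (simp add: field_simps)
  also have "\<dots> = \<eta> + \<eta> powr (1 - p) * t powr p"
    using assms by (simp add: powr_divide powr_diff field_simps)
  finally show ?thesis .
qed

lemma powr_add_le:
  fixes a b p :: real
  assumes "0 \<le> a" "0 \<le> b" "0 \<le> p"
  shows "(a + b) powr p \<le> 2 powr p * (a powr p + b powr p)"
proof -
  have "(a + b) powr p \<le> (2 * max a b) powr p" using assms by (intro powr_mono2) auto
  also have "\<dots> = 2 powr p * max a b powr p" using assms by (simp add: powr_mult)
  also have "\<dots> \<le> 2 powr p * (a powr p + b powr p)"
    by (intro mult_left_mono) (auto simp: max_def)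
  finally show ?thesis .
qed

text \<open>Jensen for the weight \<open>k\<close>, whose total mass \<open>K\<close> may differ
  from 1: the tangent inequality for the \<open>p\<close>-th power is taken at the weighted mean of
  \<open>g\<close> and integrated. The missing normalisation accounts for the factor
  \<open>K powr (p - 1)\<close>.\<close>

lemma jensen_powr:
  fixes k g :: "'a \<Rightarrow> real"
  assumes k: "integrable M k" "\<And>y. 0 \<le> k y" and g: "\<And>y. 0 \<le> g y" "g \<in> borel_measurable M"
    and kg: "integrable M (\<lambda>y. k y * g y powr p)" and p: "1 \<le> p"
  shows "integrable M (\<lambda>y. k y * g y)"
    and "(\<integral>y. k y * g y \<partial>M) powr p \<le> (\<integral>y. k y \<partial>M) powr (p - 1) * (\<integral>y. k y * g y powr p \<partial>M)"
proof -
  note [measurable] = borel_measurable_integrable[OF k(1)] g(2)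
  show i: "integrable M (\<lambda>y. k y * g y)"
  proof (rule Bochner_Integration.integrable_bound[OF Bochner_Integration.integrable_add[OF k(1) kg]])
    show "AE y in M. norm (k y * g y) \<le> norm (k y + k y * g y powr p)"
    proof (rule AE_I2)
      fix y
      have "k y * g y \<le> k y * (1 + g y powr p)"
        using k(2) g(1) p by (intro mult_left_mono le_one_plus_powr) auto
      then show "norm (k y * g y) \<le> norm (k y + k y * g y powr p)"
        using k(2)[of y] g(1)[of y] by (simp add: algebra_simps)
    qed
  qed measurable
  define K where "K = (\<integral>y. k y \<partial>M)"
  define G where "G = (\<integral>y. k y * g y \<partial>M)"
  have K: "K \<ge> 0" unfolding K_def using k by (intro integral_nonneg_AE) auto
  have G: "G \<ge> 0" unfolding G_def using k g by (intro integral_nonneg_AE) auto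
  show "G powr p \<le> K powr (p - 1) * (\<integral>y. k y * g y powr p \<partial>M)"
  proof (cases "K = 0")
    case True
    then have "AE y in M. k y = 0"
      using integral_nonneg_eq_0_iff_AE[OF k(1)] k(2) by (simp add: K_def)
    then have "AE y in M. k y * g y = 0" by eventually_elim auto
    then have "G = 0" unfolding G_def by (rule integral_eq_zero_AE)
    then show ?thesis using k g by simp
  next
    case False
    with K have K: "K > 0" by simp
    \<comment> \<open>The weighted mean. With this tangent point the first-order term
      \<open>G - a * K\<close> is zero.\<close>
    define a where "a = G / K"
    have a: "a \<ge> 0" using G K by (simp add: a_def)
    have "(\<integral>y. a powr p * k y + p * a powr (p - 1) * (k y * g y - a * k y) \<partial>M) \<le> (\<integral>y. k y * g y powr p \<partial>M)"
    proof (rule integral_mono)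
      fix y
      have "k y * (a powr p + p * a powr (p - 1) * (g y - a)) \<le> k y * g y powr p"
        using powr_tangent[OF a g(1) p] k(2) by (intro mult_left_mono) auto
      then show "a powr p * k y + p * a powr (p - 1) * (k y * g y - a * k y) \<le> k y * g y powr p"
        by (simp add: algebra_simps)
    qed (use i k kg in auto)
    also have "(\<integral>y. a powr p * k y + p * a powr (p - 1) * (k y * g y - a * k y) \<partial>M)
        = a powr p * K + p * a powr (p - 1) * (G - a * K)"
      using i k by (simp add: K_def G_def)
    also have "\<dots> = a powr p * K" using K by (simp add: a_def)
    finally have "K powr (p - 1) * (a powr p * K) \<le> K powr (p - 1) * (\<integral>y. k y * g y powr p \<partial>M)"
      by (intro mult_left_mono) auto
    moreover have "K powr (p - 1) * (a powr p * K) = G powr p"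
      using K G by (simp add: a_def powr_diff powr_divide)
    ultimately show ?thesis by simp
  qed
qed

text \<open>Jensen for fixed \<open>x\<close>, followed by Tonelli, so that only a bound for the
  \<open>p\<close>-th powers of the slices is required. The bound is asked for where
  \<open>k\<close> is nonzero only, since for a mollifier it is known on the support alone.
  \<open>H\<close> is \<open>|f(x - y)|\<close> for Young's inequality and
  \<open>|f(x - y) - f x|\<close> for mollification.\<close>

lemma minkowski_integral:
  fixes H :: "'a::euclidean_space \<times> 'a \<Rightarrow> real" and k :: "'a \<Rightarrow> real"
  assumes H[measurable]: "H \<in> borel_measurable (lborel \<Otimes>\<^sub>M lborel)" and H0: "\<And>z. 0 \<le> H z"
    and k: "integrable lborel k" "\<And>y. 0 \<le> k y" and p: "1 \<le> p" and C: "0 \<le> C"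
    and le: "\<And>y. k y \<noteq> 0 \<Longrightarrow> (\<integral>\<^sup>+x. H (x, y) powr p \<partial>lborel) \<le> ennreal C"
  shows "AE x in lborel. integrable lborel (\<lambda>y. k y * H (x, y))"
    and "integrable lborel (\<lambda>x. (LBINT y. k y * H (x, y)) powr p)"
    and "(LBINT x. (LBINT y. k y * H (x, y)) powr p) \<le> (LBINT y. k y) powr p * C"
proof -
  note [measurable] = borel_measurable_integrable[OF k(1)]
  define K where "K = (LBINT y. k y)"
  have K: "K \<ge> 0" unfolding K_def using k by (intro integral_nonneg_AE) auto
  define J where "J x = (\<integral>\<^sup>+y. ennreal (k y * H (x, y) powr p) \<partial>lborel)" for x
  have J[measurable]: "J \<in> borel_measurable lborel" unfolding J_def by measurable
  have "(\<integral>\<^sup>+x. J x \<partial>lborel) = (\<integral>\<^sup>+y. (\<integral>\<^sup>+x. ennreal (k y * H (x, y) powr p) \<partial>lborel) \<partial>lborel)"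
    unfolding J_def by (rule lborel_pair.Fubini') measurable
  also have "\<dots> = (\<integral>\<^sup>+y. ennreal (k y) * (\<integral>\<^sup>+x. H (x, y) powr p \<partial>lborel) \<partial>lborel)"
    using k(2) by (intro nn_integral_cong) (simp add: ennreal_mult' nn_integral_cmult)
  also have "\<dots> \<le> (\<integral>\<^sup>+y. ennreal (k y) * ennreal C \<partial>lborel)"
  proof (intro nn_integral_mono)
    fix y show "ennreal (k y) * (\<integral>\<^sup>+x. H (x, y) powr p \<partial>lborel) \<le> ennreal (k y) * ennreal C"
      using le[of y] by (cases "k y = 0") (auto intro!: mult_left_mono)
  qed
  also have "\<dots> = ennreal (K * C)"
    using k K C by (simp add: nn_integral_multc nn_integral_eq_integral K_def ennreal_mult)
  finally have Jle: "(\<integral>\<^sup>+x. J x \<partial>lborel) \<le> ennreal (K * C)" .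
  then have "(\<integral>\<^sup>+x. J x \<partial>lborel) \<noteq> \<infinity>" by (auto simp: top_unique)
  then have ae: "AE x in lborel. J x \<noteq> \<infinity>" by (intro nn_integral_PInf_AE) auto
  have ik: "integrable lborel (\<lambda>y. k y * H (x, y) powr p)" if "J x \<noteq> \<infinity>" for x
    using that k(2) by (intro integrableI_nonneg) (auto simp: J_def top.not_eq_extremum)
  show "AE x in lborel. integrable lborel (\<lambda>y. k y * H (x, y))"
    using ae
  proof eventually_elim
    case (elim x)
    show ?case
      by (rule jensen_powr(1)[where p=p, OF k(1) k(2) _ _ ik[OF elim] p]) (auto simp: H0)
  qed
  define G where "G x = (LBINT y. k y * H (x, y))" for x
  have G[measurable]: "G \<in> borel_measurable lborel" unfolding G_def by measurable
  have G0: "G x \<ge> 0" for x unfolding G_def using k H0 by (intro integral_nonneg_AE) auto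
  have "AE x in lborel. ennreal (G x powr p) \<le> ennreal (K powr (p - 1)) * J x"
    using ae
  proof eventually_elim
    case (elim x)
    have "G x powr p \<le> K powr (p - 1) * (LBINT y. k y * H (x, y) powr p)"
      unfolding G_def K_def
      by (rule jensen_powr(2)[where p=p, OF k(1) k(2) _ _ ik[OF elim] p]) (auto simp: H0)
    then have "ennreal (G x powr p) \<le> ennreal (K powr (p - 1) * (LBINT y. k y * H (x, y) powr p))"
      by (rule ennreal_leI)
    also have "\<dots> = ennreal (K powr (p - 1)) * ennreal (LBINT y. k y * H (x, y) powr p)"
      by (rule ennreal_mult') simp
    also have "ennreal (LBINT y. k y * H (x, y) powr p) = J x"
      unfolding J_def using k(2) by (intro nn_integral_eq_integral[OF ik[OF elim], symmetric]) auto
    finally show ?case .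
  qed
  then have "(\<integral>\<^sup>+x. ennreal (G x powr p) \<partial>lborel) \<le> (\<integral>\<^sup>+x. ennreal (K powr (p - 1)) * J x \<partial>lborel)"
    by (rule nn_integral_mono_AE)
  also have "\<dots> \<le> ennreal (K powr (p - 1)) * ennreal (K * C)"
    using Jle by (simp add: nn_integral_cmult mult_left_mono)
  also have "\<dots> = ennreal (K powr p * C)"
    using K C by (cases "K = 0") (auto simp: ennreal_mult[symmetric] powr_diff)
  finally have le: "(\<integral>\<^sup>+x. ennreal (G x powr p) \<partial>lborel) \<le> ennreal (K powr p * C)" .
  then show i: "integrable lborel (\<lambda>x. G x powr p)"
    by (intro integrableI_nonneg) (auto intro: le_less_trans)
  then have "ennreal (LBINT x. G x powr p) \<le> ennreal (K powr p * C)"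
    using le by (simp add: nn_integral_eq_integral)
  then show "(LBINT x. G x powr p) \<le> K powr p * C"
    using C K by (simp add: ennreal_le_iff)
qed

text \<open>Product measurability is available for Borel functions only, so everything is proved for Borel
  representatives over \<open>lborel\<close>.  The \<open>p\<close>-th power of the norm satisfies the triangle inequality up
  to the factor \<open>2 powr p\<close>, which is harmless for equivalence of norms and for density.\<close>

definition Lp_borel :: "real \<Rightarrow> ('a::euclidean_space \<Rightarrow> 'b::euclidean_space) \<Rightarrow> bool" where
  "Lp_borel p f \<longleftrightarrow> f \<in> borel_measurable borel \<and> integrable lborel (\<lambda>x. norm (f x) powr p)"

definition Lp_pow :: "real \<Rightarrow> ('a::euclidean_space \<Rightarrow> 'b::euclidean_space) \<Rightarrow> real" where
  "Lp_pow p f = (LBINT x. norm (f x) powr p)"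

lemma Lp_pow_nonneg: "0 \<le> Lp_pow p f"
  unfolding Lp_pow_def by (intro integral_nonneg_AE) auto

lemma Lp_borel_measurable: "Lp_borel p f \<Longrightarrow> f \<in> borel_measurable borel"
  by (simp add: Lp_borel_def)

text \<open>The bound is allowed to fail on a null set because convolution integrals converge almost
  everywhere only.\<close>

lemma Lp_borel_dominated:
  assumes f: "f \<in> borel_measurable borel" and g: "integrable lborel (\<lambda>x. g x powr p)"
    and le: "AE x in lborel. norm (f x) \<le> c * g x" and nn: "\<And>x. 0 \<le> g x" "0 \<le> c" "0 \<le> p"
  shows "Lp_borel p f" "Lp_pow p f \<le> c powr p * (LBINT x. g x powr p)"
proof -
  have ae: "AE x in lborel. norm (f x) powr p \<le> c powr p * g x powr p"
    using le
  proof eventually_elim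
    case (elim x)
    then have "norm (f x) powr p \<le> (c * g x) powr p" using nn by (intro powr_mono2) auto
    then show ?case using nn by (simp add: powr_mult)
  qed
  have i: "integrable lborel (\<lambda>x. norm (f x) powr p)"
    by (rule Bochner_Integration.integrable_bound[of _ "\<lambda>x. c powr p * g x powr p"])
      (use f g ae in auto)
  then show "Lp_borel p f" using f by (simp add: Lp_borel_def)
  show "Lp_pow p f \<le> c powr p * (LBINT x. g x powr p)"
    unfolding Lp_pow_def using integral_mono_AE[OF i _ ae] g by simp
qed

lemma Lp_borel_add:
  assumes "Lp_borel p f" "Lp_borel p g" "0 \<le> p"
  shows "Lp_borel p (\<lambda>x. f x + g x)" "Lp_pow p (\<lambda>x. f x + g x) \<le> 2 powr p * (Lp_pow p f + Lp_pow p g)"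
proof -
  note [measurable] = Lp_borel_measurable[OF assms(1)] Lp_borel_measurable[OF assms(2)]
  have le: "norm (f x + g x) powr p \<le> 2 powr p * (norm (f x) powr p + norm (g x) powr p)" for x
    using powr_add_le[of "norm (f x)" "norm (g x)" p] powr_mono2[OF assms(3) _ norm_triangle_ineq[of "f x" "g x"]]
      assms(3) by simp
  have i': "integrable lborel (\<lambda>x. 2 powr p * (norm (f x) powr p + norm (g x) powr p))"
    using assms by (auto simp: Lp_borel_def)
  have i: "integrable lborel (\<lambda>x. norm (f x + g x) powr p)"
    by (rule Bochner_Integration.integrable_bound[OF i']) (use le in auto)
  then show "Lp_borel p (\<lambda>x. f x + g x)" by (simp add: Lp_borel_def)
  show "Lp_pow p (\<lambda>x. f x + g x) \<le> 2 powr p * (Lp_pow p f + Lp_pow p g)"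
    using integral_mono[OF i i' le] assms by (simp add: Lp_borel_def Lp_pow_def)
qed

lemma Lp_borel_uminus: "Lp_borel p (\<lambda>x. - f x) \<longleftrightarrow> Lp_borel p f" "Lp_pow p (\<lambda>x. - f x) = Lp_pow p f"
  by (auto simp: Lp_borel_def Lp_pow_def)

lemma Lp_borel_diff:
  assumes "Lp_borel p f" "Lp_borel p g" "0 \<le> p"
  shows "Lp_borel p (\<lambda>x. f x - g x)" "Lp_pow p (\<lambda>x. f x - g x) \<le> 2 powr p * (Lp_pow p f + Lp_pow p g)"
  using Lp_borel_add[of p f "\<lambda>x. - g x"] assms by (auto simp: Lp_borel_uminus)

lemma Lp_borel_translate:
  assumes "Lp_borel p f"
  shows "Lp_borel p (\<lambda>x. f (x - t))" "Lp_pow p (\<lambda>x. f (x - t)) = Lp_pow p f"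
  using assms integrable_lborel_minus[of "\<lambda>x. norm (f x) powr p" t]
    integral_lborel_minus[of "\<lambda>x. norm (f x) powr p" t]
  by (auto simp: Lp_borel_def Lp_pow_def)

lemma young:
  fixes f :: "'a::euclidean_space \<Rightarrow> 'b::euclidean_space"
  assumes f: "Lp_borel p f" and k: "integrable lborel k" "\<And>y. 0 \<le> k y" and p: "1 \<le> p"
  shows "AE x in lborel. integrable lborel (\<lambda>y. k y * norm (f (x - y)))"
    and "integrable lborel (\<lambda>x. (LBINT y. k y * norm (f (x - y))) powr p)"
    and "(LBINT x. (LBINT y. k y * norm (f (x - y))) powr p) \<le> (LBINT y. k y) powr p * Lp_pow p f"
proof -
  note [measurable] = Lp_borel_measurable[OF f]
  have "(\<integral>\<^sup>+x. (\<lambda>(x, y). norm (f (x - y))) (x, y) powr p \<partial>lborel) \<le> ennreal (Lp_pow p f)" for y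
    using Lp_borel_translate[OF f, of y] by (simp add: nn_integral_eq_integral Lp_borel_def Lp_pow_def)
  from minkowski_integral[of "\<lambda>(x, y). norm (f (x - y))", OF _ _ k p Lp_pow_nonneg this]
  show "AE x in lborel. integrable lborel (\<lambda>y. k y * norm (f (x - y)))"
    and "integrable lborel (\<lambda>x. (LBINT y. k y * norm (f (x - y))) powr p)"
    and "(LBINT x. (LBINT y. k y * norm (f (x - y))) powr p) \<le> (LBINT y. k y) powr p * Lp_pow p f"
    by auto
qed

section \<open>Translation and mollification in Lebesgue spaces\<close>

text \<open>Three-term estimate: by translation invariance the error \<open>f - g\<close> has the
  same integral before and after the shift, so each of the three terms is below
  \<open>r / 3\<close>.\<close>

lemma translation_L1_approx:
  fixes f :: "'a::euclidean_space \<Rightarrow> 'b::euclidean_space"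
  assumes f: "integrable lborel f"
    and g: "\<And>e. e > 0 \<Longrightarrow> \<exists>g. integrable lborel g \<and>
      (\<lambda>n. LBINT x. norm (g (x - Y n) - g x)) \<longlonglongrightarrow> 0 \<and> (LBINT x. norm (f x - g x)) < e"
  shows "(\<lambda>n. LBINT x. norm (f (x - Y n) - f x)) \<longlonglongrightarrow> (0::real)"
proof (rule LIMSEQ_I)
  fix r :: real assume r: "r > 0"
  obtain g where g: "integrable lborel g" "(\<lambda>n. LBINT x. norm (g (x - Y n) - g x)) \<longlonglongrightarrow> 0"
    "(LBINT x. norm (f x - g x)) < r / 3"
    using g[of "r / 3"] r by auto
  obtain N where N: "\<And>n. n \<ge> N \<Longrightarrow> norm ((LBINT x. norm (g (x - Y n) - g x)) - 0) < r / 3"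
    using LIMSEQ_D[OF g(2), of "r/3"] r by auto
  have [measurable]: "f \<in> borel_measurable borel" "g \<in> borel_measurable borel"
    using f g by auto
  have "norm ((LBINT x. norm (f (x - Y n) - f x)) - 0) < r" if "n \<ge> N" for n
  proof -
    have [simp]: "integrable lborel (\<lambda>x. f (x - Y n))" "integrable lborel (\<lambda>x. g (x - Y n))"
      using f g by (auto simp: integrable_lborel_minus)
    have t: "norm (f (x - Y n) - f x) \<le> norm (g (x - Y n) - g x) +
          (norm (f (x - Y n) - g (x - Y n)) + norm (f x - g x))" for x
      by norm
    have "(LBINT x. norm (f (x - Y n) - f x)) \<le> (LBINT x. norm (g (x - Y n) - g x) +
          (norm (f (x - Y n) - g (x - Y n)) + norm (f x - g x)))"
      using f g t by (intro integral_mono) auto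
    also have "\<dots> = (LBINT x. norm (g (x - Y n) - g x)) +
          ((LBINT x. norm (f (x - Y n) - g (x - Y n))) + (LBINT x. norm (f x - g x)))"
      using f g by simp
    also have "(LBINT x. norm (f (x - Y n) - g (x - Y n))) = (LBINT x. norm (f x - g x))"
      by (rule integral_lborel_minus[of "\<lambda>x. norm (f x - g x)"]) measurable
    finally show ?thesis
      using N[OF that] g(3) by simp
  qed
  then show "\<exists>N. \<forall>n\<ge>N. norm ((LBINT x. norm (f (x - Y n) - f x)) - 0) < r" by blast
qed

text \<open>As \<open>indicator U\<close> is lower semicontinuous, the positive part of \<open>indicator U x - indicator U (x - Y n)\<close>
  tends to zero pointwise; by translation invariance the negative part has the same integral.\<close>

lemma translation_L1_open:
  fixes U :: "'a::euclidean_space set"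
  assumes U: "open U" "emeasure lborel U < \<infinity>" and Y: "Y \<longlonglongrightarrow> 0"
  shows "(\<lambda>n. LBINT x. \<bar>indicator U (x - Y n) - indicator U x\<bar>) \<longlonglongrightarrow> (0::real)"
proof -
  define I :: "'a \<Rightarrow> real" where "I = indicator U"
  have [measurable]: "U \<in> sets borel" using U by simp
  have I: "integrable lborel I" "I \<in> borel_measurable borel" using U unfolding I_def by auto
  note [measurable] = I(2)
  have I': "integrable lborel (\<lambda>x. I (x - Y n))" for n
    using I by (simp add: integrable_lborel_minus)
  have lim: "(\<lambda>n. LBINT x. max 0 (I x - I (x - Y n))) \<longlonglongrightarrow> (\<integral>x. 0 \<partial>(lborel :: 'a measure))"
  proof (rule integral_dominated_convergence[where w=I])
    show "AE x in lborel. (\<lambda>n. max 0 (I x - I (x - Y n))) \<longlonglongrightarrow> 0"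
    proof (rule AE_I2)
      fix x
      have "\<forall>\<^sub>F n in sequentially. max 0 (I x - I (x - Y n)) = 0"
      proof (cases "x \<in> U")
        case True
        have "(\<lambda>n. x - Y n) \<longlonglongrightarrow> x - 0" by (intro tendsto_intros Y)
        then have "\<forall>\<^sub>F n in sequentially. x - Y n \<in> U"
          using U True by (auto intro: topological_tendstoD)
        then show ?thesis by eventually_elim (simp add: I_def True)
      qed (simp add: I_def)
      then show "(\<lambda>n. max 0 (I x - I (x - Y n))) \<longlonglongrightarrow> 0" by (rule tendsto_eventually)
    qed
    show "AE x in lborel. norm (max 0 (I x - I (x - Y n))) \<le> I x" for n
      by (auto simp: I_def indicator_def)
  qed (use I in auto)
  have "(LBINT x. \<bar>I (x - Y n) - I x\<bar>) = 2 * (LBINT x. max 0 (I x - I (x - Y n)))" for n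
  proof -
    \<comment> \<open>Uses \<open>|b - a| = 2 max(0, a - b) + (b - a)\<close>.\<close>
    have "(LBINT x. \<bar>I (x - Y n) - I x\<bar>) = (LBINT x. 2 * max 0 (I x - I (x - Y n)) + (I (x - Y n) - I x))"
      by (intro Bochner_Integration.integral_cong) (auto simp: max_def)
    also have "\<dots> = 2 * (LBINT x. max 0 (I x - I (x - Y n))) + ((LBINT x. I (x - Y n)) - (LBINT x. I x))"
      using I I' by simp
    also have "(LBINT x. I (x - Y n)) = (LBINT x. I x)"
      by (rule integral_lborel_minus) measurable
    finally show ?thesis by simp
  qed
  then show ?thesis
    using tendsto_mult_left[OF lim, of 2] by (simp add: I_def)
qed

text \<open>Induction over integrable functions. Outer regularity leads from a measurable set to an
  open one, which the preceding lemma handles; limits of simple functions use dominated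
  convergence.\<close>

lemma translation_L1:
  fixes f :: "'a::euclidean_space \<Rightarrow> 'b::euclidean_space"
  assumes f: "integrable lborel f" and Y: "Y \<longlonglongrightarrow> 0"
  shows "(\<lambda>n. LBINT x. norm (f (x - Y n) - f x)) \<longlonglongrightarrow> (0::real)"
  using f
proof induction
  case (base A c)
  then have A[measurable]: "A \<in> sets borel" "emeasure lborel A < \<infinity>" by auto
  show ?case
  proof (rule translation_L1_approx)
    show "integrable lborel (\<lambda>x. indicat_real A x *\<^sub>R c)" using A by auto
    fix e :: real assume e: "e > 0"
    \<comment> \<open>The added 1 covers \<open>c = 0\<close>.\<close>
    define e' where "e' = e / (norm c + 1)"
    have e': "e' > 0" using e by (simp add: e'_def add_nonneg_pos)
    obtain U where U: "open U" "A \<subseteq> U" "emeasure lborel (U - A) < ennreal e'"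
      using outer_regular_lborel[OF A(1) e'] by auto
    have [measurable]: "U \<in> sets borel" using U by simp
    have "emeasure lborel U = emeasure lborel A + emeasure lborel (U - A)"
      using U by (subst plus_emeasure) (auto intro!: arg_cong[where f="emeasure lborel"])
    also have "\<dots> < \<infinity>" using A U by (auto simp: ennreal_add_less_top intro: less_trans)
    finally have Uf: "emeasure lborel U < \<infinity>" .
    have m: "measure lborel (U - A) < e'"
      using U(3) e' by (simp add: measure_def enn2real_less_iff less_trans[OF U(3)])
    have "(\<lambda>n. norm c * (LBINT x. \<bar>indicator U (x - Y n) - indicator U x\<bar>)) \<longlonglongrightarrow> norm c * 0"
      by (intro tendsto_intros translation_L1_open U Uf Y)
    moreover have "(LBINT x. norm (indicat_real U (x - Y n) *\<^sub>R c - indicat_real U x *\<^sub>R c))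
        = norm c * (LBINT x. \<bar>indicator U (x - Y n) - indicator U x\<bar>)" for n
      unfolding scaleR_left_diff_distrib[symmetric] norm_scaleR by (simp add: mult.commute)
    moreover have "(LBINT x. norm (indicat_real A x *\<^sub>R c - indicat_real U x *\<^sub>R c)) < e"
    proof -
      have "(LBINT x. norm (indicat_real A x *\<^sub>R c - indicat_real U x *\<^sub>R c))
          = (LBINT x. norm c * indicat_real (U - A) x)"
        using U(2) by (intro Bochner_Integration.integral_cong) (auto simp: indicator_def)
      also have "\<dots> = norm c * measure lborel (U - A)" by simp
      also have "\<dots> \<le> norm c * e'" using m by (intro mult_left_mono) auto
      also have "\<dots> < (norm c + 1) * e'" using e' by simp
      also have "\<dots> = e" using add_nonneg_pos[OF norm_ge_zero[of c] zero_less_one] by (simp add: e'_def)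
      finally show ?thesis .
    qed
    ultimately show "\<exists>g. integrable lborel g \<and> (\<lambda>n. LBINT x. norm (g (x - Y n) - g x)) \<longlonglongrightarrow> 0 \<and>
        (LBINT x. norm (indicat_real A x *\<^sub>R c - g x)) < e"
      using Uf by (intro exI[of _ "\<lambda>x. indicat_real U x *\<^sub>R c"]) auto
  qed
next
  case (add f g)
  note [simp] = add.hyps integrable_lborel_minus borel_measurable_integrable[OF add.hyps(1), simplified]
    borel_measurable_integrable[OF add.hyps(2), simplified]
  show ?case
  proof (rule tendsto_sandwich[OF _ _ tendsto_const])
    show "(\<lambda>n. (LBINT x. norm (f (x - Y n) - f x)) + (LBINT x. norm (g (x - Y n) - g x))) \<longlonglongrightarrow> 0"
      using tendsto_add[OF add.IH] by simp
    show "\<forall>\<^sub>F n in sequentially. (LBINT x. norm (f (x - Y n) + g (x - Y n) - (f x + g x)))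
        \<le> (LBINT x. norm (f (x - Y n) - f x)) + (LBINT x. norm (g (x - Y n) - g x))"
    proof (rule always_eventually, rule allI)
      fix n
      have "(LBINT x. norm (f (x - Y n) + g (x - Y n) - (f x + g x)))
        \<le> (LBINT x. norm (f (x - Y n) - f x) + norm (g (x - Y n) - g x))"
        by (intro integral_mono) (simp_all, norm)
      then show "(LBINT x. norm (f (x - Y n) + g (x - Y n) - (f x + g x)))
        \<le> (LBINT x. norm (f (x - Y n) - f x)) + (LBINT x. norm (g (x - Y n) - g x))"
        by simp
    qed
  qed auto
next
  case (lim f s)
  show ?case
  proof (rule translation_L1_approx[OF lim.hyps(4)])
    fix e :: real assume "e > 0"
    \<comment> \<open>The approximants obey \<open>|s i x| <= 2 |f x|\<close>, so the difference is
      at most \<open>3 |f x|\<close>.\<close>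
    have "(\<lambda>i. LBINT x. norm (f x - s i x)) \<longlonglongrightarrow> (\<integral>x. 0 \<partial>(lborel :: 'a measure))"
    proof (rule integral_dominated_convergence[where w="\<lambda>x. 3 * norm (f x)"])
      show "AE x in lborel. (\<lambda>i. norm (f x - s i x)) \<longlonglongrightarrow> 0"
        using lim.hyps(2) tendsto_norm_zero[OF LIM_zero] 
        by (intro AE_I2) (auto simp: tendsto_norm_zero_iff norm_minus_commute intro!: LIM_zero)
      show "AE x in lborel. norm (norm (f x - s i x)) \<le> 3 * norm (f x)" for i
      proof (rule AE_I2)
        fix x
        show "norm (norm (f x - s i x)) \<le> 3 * norm (f x)"
          using lim.hyps(3)[of x i] norm_triangle_ineq4[of "f x" "s i x"] by simp
      qed
    qed (use lim.hyps in auto)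
    then have "\<forall>\<^sub>F i in sequentially. (LBINT x. norm (f x - s i x)) < e"
      using \<open>e > 0\<close> by (auto intro: order_tendstoD)
    then obtain i where "(LBINT x. norm (f x - s i x)) < e"
      by (auto simp: eventually_sequentially)
    then show "\<exists>g. integrable lborel g \<and> (\<lambda>n. LBINT x. norm (g (x - Y n) - g x)) \<longlonglongrightarrow> 0 \<and>
        (LBINT x. norm (f x - g x)) < e"
      using lim.hyps lim.IH by blast
  qed
qed

text \<open>The case of \<open>L\<^sup>1\<close> applies to the truncation of \<open>f\<close> to \<open>1 / N \<le> norm (f x) \<le> N\<close>, which is
  integrable and bounded.\<close>

lemma translation_Lp_seq:
  fixes f :: "'a::euclidean_space \<Rightarrow> 'b::euclidean_space"
  assumes f: "Lp_borel p f" and p: "1 \<le> p" and Y: "Y \<longlonglongrightarrow> 0"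
  shows "(\<lambda>n. Lp_pow p (\<lambda>x. f (x - Y n) - f x)) \<longlonglongrightarrow> 0"
proof (rule LIMSEQ_I)
  fix r :: real assume r: "r > 0"
  note [measurable] = Lp_borel_measurable[OF f]
  define T where "T N x = (if 1 / Suc N \<le> norm (f x) \<and> norm (f x) \<le> Suc N then f x else 0)" for N x
  have [measurable]: "T N \<in> borel_measurable borel" for N unfolding T_def by measurable
  have fi: "integrable lborel (\<lambda>x. norm (f x) powr p)" using f by (simp add: Lp_borel_def)
  have "(\<lambda>N. Lp_pow p (\<lambda>x. f x - T N x)) \<longlonglongrightarrow> (\<integral>x. 0 \<partial>(lborel :: 'a measure))"
    unfolding Lp_pow_def
  proof (rule integral_dominated_convergence[OF _ _ fi])
    show "AE x in lborel. (\<lambda>N. norm (f x - T N x) powr p) \<longlonglongrightarrow> 0"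
    proof (rule AE_I2)
      fix x
      have "\<forall>\<^sub>F N in sequentially. T N x = f x"
      proof (cases "f x = 0")
        case False
        obtain n1 :: nat where n1: "norm (f x) \<le> n1" using real_arch_simple by blast
        obtain n2 :: nat where n2: "1 / norm (f x) \<le> n2" using real_arch_simple by blast
        have "T N x = f x" if N: "N \<ge> max n1 n2" for N
        proof -
          have "1 / norm (f x) \<le> Suc N" using n2 N by linarith
          then have "1 / Suc N \<le> norm (f x)" using False by (simp add: field_simps)
          moreover have "norm (f x) \<le> Suc N" using n1 N by linarith
          ultimately show ?thesis by (simp add: T_def)
        qed
        then show ?thesis by (rule eventually_sequentiallyI)
      qed (simp add: T_def)
      then have "\<forall>\<^sub>F N in sequentially. norm (f x - T N x) powr p = 0"
        by eventually_elim simp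
      then show "(\<lambda>N. norm (f x - T N x) powr p) \<longlonglongrightarrow> 0" by (rule tendsto_eventually)
    qed
  qed (auto simp: T_def)
  \<comment> \<open>Chosen so that twice the truncation error, multiplied by the two factors
    \<open>2 powr p\<close> from two uses of the triangle inequality, stays below
    \<open>r / 2\<close>.\<close>
  moreover have "r / (2 * 2 powr p * 2 powr p * 2) > 0" using r by simp
  ultimately have "\<forall>\<^sub>F N in sequentially. Lp_pow p (\<lambda>x. f x - T N x) < r / (2 * 2 powr p * 2 powr p * 2)"
    by (auto intro: order_tendstoD)
  then obtain N where N: "Lp_pow p (\<lambda>x. f x - T N x) < r / (2 * 2 powr p * 2 powr p * 2)"
    by (auto simp: eventually_sequentially)
  define g where "g = T N"
  define M where "M = real (Suc N)"
  have M: "M \<ge> 1" by (simp add: M_def)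
  have [measurable]: "g \<in> borel_measurable borel" unfolding g_def by simp
  have gM: "norm (g x) \<le> M" for x by (auto simp: g_def T_def M_def)
  have gf: "norm (g x) \<le> norm (f x)" for x by (auto simp: g_def T_def)
  have gf': "norm (f x - g x) \<le> norm (f x)" for x by (auto simp: g_def T_def)
  have gi: "integrable lborel g"
  proof (rule Bochner_Integration.integrable_bound)
    \<comment> \<open>Where \<open>g\<close> is nonzero, \<open>M |f| >= 1\<close>, hence
      \<open>|g| <= M <= M (M |f|)^p\<close>.\<close>
    show "integrable lborel (\<lambda>x. M * M powr p * norm (f x) powr p)" using fi by simp
    show "AE x in lborel. norm (g x) \<le> norm (M * M powr p * norm (f x) powr p)"
    proof (rule AE_I2)
      fix x
      show "norm (g x) \<le> norm (M * M powr p * norm (f x) powr p)"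
      proof (cases "1 / M \<le> norm (f x)")
        case True
        then have "1 \<le> M * norm (f x)" using M by (simp add: field_simps)
        then have "1 \<le> (M * norm (f x)) powr p" using p by (intro ge_one_powr_ge_zero) auto
        then have "M * 1 \<le> M * (M powr p * norm (f x) powr p)"
          using M by (intro mult_left_mono) (auto simp: powr_mult)
        also have "\<dots> = norm (M * M powr p * norm (f x) powr p)" using M by (simp add: abs_mult)
        finally show ?thesis using gM[of x] by linarith
      qed (simp add: g_def T_def M_def)
    qed
  qed measurable
  have g': "Lp_borel p g" "Lp_borel p (\<lambda>x. f x - g x)"
    using Lp_borel_dominated(1)[of g "\<lambda>x. norm (f x)" p 1] Lp_borel_dominated(1)[of "\<lambda>x. f x - g x" "\<lambda>x. norm (f x)" p 1]
      fi gf gf' p by auto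
  \<comment> \<open>Differences of values of \<open>g\<close> are at most \<open>2 * M\<close>, so
    \<open>|a|^p <= (2 * M) powr (p - 1) |a|\<close> carries the convergence from
    \<open>p = 1\<close> to general \<open>p\<close>.\<close>
  define c where "c = (2 * M) powr (p - 1)"
  have c: "c \<ge> 0" by (simp add: c_def)
  have "(\<lambda>n. 2 powr p * (c * (LBINT x. norm (g (x - Y n) - g x)))) \<longlonglongrightarrow> 2 powr p * (c * 0)"
    by (intro tendsto_intros translation_L1 gi Y)
  then have "\<forall>\<^sub>F n in sequentially. 2 powr p * (c * (LBINT x. norm (g (x - Y n) - g x))) < r / 2"
    by (rule order_tendstoD(2)) (use r in simp)
  then obtain n0 where n0: "\<And>n. n \<ge> n0 \<Longrightarrow> 2 powr p * (c * (LBINT x. norm (g (x - Y n) - g x))) < r / 2"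
    by (auto simp: eventually_sequentially)
  have "Lp_pow p (\<lambda>x. f (x - Y n) - f x) < r" if n: "n \<ge> n0" for n
  proof -
    note t = Lp_borel_translate[OF g'(2), of "Y n"]
    note d = Lp_borel_diff[OF t(1) g'(2)]
    note d' = Lp_borel_diff(1)[OF Lp_borel_translate(1)[OF g'(1), of "Y n"] g'(1)]
    have p0: "0 \<le> p" using p by simp
    have 1: "Lp_pow p (\<lambda>x. g (x - Y n) - g x) \<le> c * (LBINT x. norm (g (x - Y n) - g x))"
    proof -
      have "norm (g (x - Y n) - g x) powr p \<le> c * norm (g (x - Y n) - g x)" for x
      proof -
        let ?a = "norm (g (x - Y n) - g x)"
        have "?a \<le> 2 * M" using gM[of x] gM[of "x - Y n"] norm_triangle_ineq4[of "g (x - Y n)" "g x"] by simp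
        then have "?a powr (p - 1) \<le> c" unfolding c_def using p by (intro powr_mono2) auto
        then have "?a powr (p - 1) * ?a \<le> c * ?a" by (intro mult_right_mono) auto
        then show ?thesis by (cases "?a = 0") (auto simp: powr_diff)
      qed
      then have "Lp_pow p (\<lambda>x. g (x - Y n) - g x) \<le> (LBINT x. c * norm (g (x - Y n) - g x))"
        unfolding Lp_pow_def using d'[OF p0] gi
        by (intro integral_mono) (auto simp: Lp_borel_def integrable_lborel_minus)
      then show ?thesis by simp
    qed
    have "Lp_pow p (\<lambda>x. f (x - Y n) - f x)
       = Lp_pow p (\<lambda>x. (g (x - Y n) - g x) + ((f (x - Y n) - g (x - Y n)) - (f x - g x)))"
      by (simp add: algebra_simps)
    also have "\<dots> \<le> 2 powr p * (Lp_pow p (\<lambda>x. g (x - Y n) - g x) +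
         Lp_pow p (\<lambda>x. (f (x - Y n) - g (x - Y n)) - (f x - g x)))"
      by (rule Lp_borel_add(2)[OF d'[OF p0] d(1)[OF p0] p0])
    also have "\<dots> \<le> 2 powr p * (c * (LBINT x. norm (g (x - Y n) - g x)) +
         2 powr p * (Lp_pow p (\<lambda>x. f x - g x) + Lp_pow p (\<lambda>x. f x - g x)))"
      using d(2)[OF p0] 1 t(2) by (intro mult_left_mono add_mono) auto
    also have "\<dots> = 2 powr p * (c * (LBINT x. norm (g (x - Y n) - g x))) +
         2 * 2 powr p * 2 powr p * Lp_pow p (\<lambda>x. f x - g x)"
      by (simp add: algebra_simps)
    also have "\<dots> < r / 2 + 2 * 2 powr p * 2 powr p * (r / (2 * 2 powr p * 2 powr p * 2))"
      using n0[OF n] N unfolding g_def by (intro add_strict_mono mult_strict_left_mono) auto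
    also have "\<dots> = r" by simp
    finally show ?thesis .
  qed
  then show "\<exists>n0. \<forall>n\<ge>n0. norm (Lp_pow p (\<lambda>x. f (x - Y n) - f x) - 0) < r"
    by (auto simp: Lp_pow_nonneg)
qed

text \<open>From sequences to a uniform radius: shifts of length below \<open>1 / (n + 1)\<close>
  that violate the bound would form a null sequence.\<close>

lemma translation_Lp:
  fixes f :: "'a::euclidean_space \<Rightarrow> 'b::euclidean_space"
  assumes f: "Lp_borel p f" and p: "1 \<le> p" and e: "e > 0"
  obtains d where "d > 0" "\<And>y. norm y < d \<Longrightarrow> Lp_pow p (\<lambda>x. f (x - y) - f x) < e"
proof (rule ccontr)
  assume "\<not> thesis"
  then have "\<exists>y. norm y < d \<and> \<not> Lp_pow p (\<lambda>x. f (x - y) - f x) < e" if "d > 0" for d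
    using that \<open>\<And>d. \<lbrakk>0 < d; \<And>y. norm y < d \<Longrightarrow> Lp_pow p (\<lambda>x. f (x - y) - f x) < e\<rbrakk> \<Longrightarrow> thesis\<close> by metis
  then have "\<forall>n. \<exists>y. norm y < inverse (real (Suc n)) \<and> \<not> Lp_pow p (\<lambda>x. f (x - y) - f x) < e"
    by simp
  then obtain Y where Y: "\<And>n. norm (Y n) < inverse (real (Suc n))"
      "\<And>n. \<not> Lp_pow p (\<lambda>x. f (x - Y n) - f x) < e" by metis
  have "Y \<longlonglongrightarrow> 0"
    by (rule Lim_null_comparison[OF _ LIMSEQ_inverse_real_of_nat]) (use Y in \<open>auto intro!: always_eventually less_imp_le simp del: of_nat_Suc\<close>)
  then have "(\<lambda>n. Lp_pow p (\<lambda>x. f (x - Y n) - f x)) \<longlonglongrightarrow> 0" by (rule translation_Lp_seq[OF f p])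
  then have "\<forall>\<^sub>F n in sequentially. Lp_pow p (\<lambda>x. f (x - Y n) - f x) < e"
    using e by (rule order_tendstoD)
  then show False using Y(2) by (auto simp: eventually_sequentially)
qed

text \<open>Because \<open>m\<close> has mass 1, the error is the mean of
  \<open>f (x - y) - f x\<close> with weight \<open>m\<close>, and Minkowski's inequality applies.
  No centre is prescribed for \<open>m\<close>: what counts is that translations by points of its
  support change \<open>f\<close> little, which later allows an off-centre mollifier.\<close>

lemma mollify_Lp:
  fixes f :: "'a::euclidean_space \<Rightarrow> 'b::euclidean_space"
  assumes f: "Lp_borel p f" and p: "1 \<le> p" and e: "e \<ge> 0"
    and m: "integrable lborel m" "\<And>y. 0 \<le> m y" "(LBINT y. m y) = 1"
    and small: "\<And>y. m y \<noteq> 0 \<Longrightarrow> Lp_pow p (\<lambda>x. f (x - y) - f x) \<le> e"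
  shows "Lp_borel p (\<lambda>x. (LBINT y. m y *\<^sub>R f (x - y)) - f x)"
    "Lp_pow p (\<lambda>x. (LBINT y. m y *\<^sub>R f (x - y)) - f x) \<le> e"
proof -
  note [measurable] = Lp_borel_measurable[OF f] borel_measurable_integrable[OF m(1)]
  define H where "H = (\<lambda>(x, y). norm (f (x - y) - f x))"
  have H: "H \<in> borel_measurable (lborel \<Otimes>\<^sub>M lborel)" unfolding H_def by measurable
  have H0: "0 \<le> H z" for z by (auto simp: H_def split: prod.splits)
  have le: "(\<integral>\<^sup>+x. H (x, y) powr p \<partial>lborel) \<le> ennreal e" if "m y \<noteq> 0" for y
    using Lp_borel_diff(1)[OF Lp_borel_translate(1)[OF f, of y] f] small[OF that] p
    by (simp add: H_def Lp_borel_def nn_integral_eq_integral Lp_pow_def ennreal_leI)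
  note mk = minkowski_integral[OF H H0 m(1,2) p e le, simplified]
  have "AE x in lborel. norm ((LBINT y. m y *\<^sub>R f (x - y)) - f x) \<le> 1 * (LBINT y. m y * H (x, y))"
    using mk(1) young(1)[OF f m(1,2) p]
  proof eventually_elim
    case (elim x)
    have i: "integrable lborel (\<lambda>y. m y *\<^sub>R f (x - y))"
      by (rule Bochner_Integration.integrable_bound[OF elim(2)]) (use m in auto)
    have "(LBINT y. m y *\<^sub>R f (x - y)) - f x = (LBINT y. m y *\<^sub>R f (x - y)) - (LBINT y. m y *\<^sub>R f x)"
      using m by simp
    also have "\<dots> = (LBINT y. m y *\<^sub>R (f (x - y) - f x))"
      using i m by (simp add: scaleR_diff_right)
    also have "norm \<dots> \<le> (LBINT y. norm (m y *\<^sub>R (f (x - y) - f x)))"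
      by (rule integral_norm_bound)
    also have "\<dots> = (LBINT y. m y * H (x, y))"
      using m by (simp add: H_def)
    finally show ?case by simp
  qed
  note d = Lp_borel_dominated[OF _ mk(2) this]
  show "Lp_borel p (\<lambda>x. (LBINT y. m y *\<^sub>R f (x - y)) - f x)"
    by (rule d(1)) (use m H0 p in \<open>auto intro!: integral_nonneg_AE\<close>)
  have "Lp_pow p (\<lambda>x. (LBINT y. m y *\<^sub>R f (x - y)) - f x) \<le> 1 powr p * (LBINT x. (LBINT y. m y * H (x, y)) powr p)"
    by (rule d(2)) (use m H0 p in \<open>auto intro!: integral_nonneg_AE\<close>)
  then show "Lp_pow p (\<lambda>x. (LBINT y. m y *\<^sub>R f (x - y)) - f x) \<le> e"
    using mk(3) m by simp
qed

section \<open>Smoothness of convolutions and integrability of radial powers\<close>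

lemma integrable_bounded_support:
  fixes g :: "'a::euclidean_space \<Rightarrow> 'b::euclidean_space"
  assumes "g \<in> borel_measurable borel" "\<And>x. norm (g x) \<le> B" "bounded S" "\<And>x. x \<notin> S \<Longrightarrow> g x = 0"
  shows "integrable lborel g"
proof -
  obtain R where R: "\<And>x. x \<in> S \<Longrightarrow> norm x \<le> R" using assms(3) by (auto simp: bounded_iff)
  have "integrable lborel (\<lambda>x. B * indicat_real (cball (0::'a) R) x)"
    by (intro integrable_mult_right integrable_real_indicator) (use emeasure_bounded_finite[OF bounded_cball] in auto)
  then show ?thesis
  proof (rule Bochner_Integration.integrable_bound)
    show "AE x in lborel. norm (g x) \<le> norm (B * indicat_real (cball (0::'a) R) x)"
    proof (rule AE_I2)
      fix x
      show "norm (g x) \<le> norm (B * indicat_real (cball (0::'a) R) x)"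
        using assms(2)[of x] assms(4)[of x] R[of x] by (cases "x \<in> cball 0 R") (auto simp: abs_mult)
    qed
  qed (use assms in auto)
qed

lemma test_functions_integrable:
  fixes f :: "'a::euclidean_space \<Rightarrow> 'b::euclidean_space"
  assumes "f \<in> test_functions S"
  shows "integrable lborel f"
proof -
  obtain C where "compact C" "\<forall>x. x \<notin> C \<longrightarrow> f x = 0"
    using assms by (auto simp: test_functions_iff)
  moreover obtain B where "\<And>x. norm (f x) \<le> B" using test_functions_bounded[OF assms] by metis
  ultimately show ?thesis
    using test_functions_borel[OF assms] by (intro integrable_bounded_support[of f B C]) (auto simp: compact_imp_bounded)
qed

lemma integrable_mult_bounded:
  fixes u :: "'a::euclidean_space \<Rightarrow> real" and g :: "'a \<Rightarrow> 'b::euclidean_space"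
  assumes "integrable lborel u" "g \<in> borel_measurable borel" "\<And>x. norm (g x) \<le> B"
  shows "integrable lborel (\<lambda>x. u x *\<^sub>R g x)"
proof (rule Bochner_Integration.integrable_bound)
  show "integrable lborel (\<lambda>x. B * u x)" using assms by simp
  have "norm (u x *\<^sub>R g x) \<le> norm (B * u x)" for x
    using mult_left_mono[OF assms(3)[of x], of "\<bar>u x\<bar>"] order_trans[OF norm_ge_zero assms(3)[of x]]
    by (simp add: abs_mult mult.commute)
  then show "AE x in lborel. norm (u x *\<^sub>R g x) \<le> norm (B * u x)" by simp
qed (use assms in auto)

text \<open>The mean value inequality for \<open>f\<close> minus its derivative at \<open>x\<close>,
  on a ball where each partial derivative moves by less than \<open>e / DIM('a)\<close>; the
  \<open>DIM('a)\<close> directions add up to \<open>e\<close>. The radius is independent of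
  \<open>x\<close>, so the remainder can be integrated.\<close>

lemma test_functions_uniformly_differentiable:
  fixes f :: "'a::euclidean_space \<Rightarrow> 'b::real_normed_vector"
  assumes f: "f \<in> test_functions S" and e: "e > 0"
  obtains d where "d > 0"
    "\<And>x h. norm h < d \<Longrightarrow> norm (f (x + h) - f x - frechet_derivative f (at x) h) \<le> e * norm h"
proof -
  let ?D = "\<lambda>x. frechet_derivative f (at x)"
  define e' where "e' = e / DIM('a)"
  have e': "e' > 0" using e by (simp add: e'_def)
  have "\<exists>d>0. \<forall>x y. norm (x - y) < d \<longrightarrow> norm (?D x b - ?D y b) < e'" if "b \<in> Basis" for b
    using test_functions_uniformly_continuous[OF test_functions_frechet_derivative[OF f that] e'] by metis
  then obtain d where d: "\<And>b. b \<in> Basis \<Longrightarrow> d b > 0"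
    "\<And>b x y. b \<in> Basis \<Longrightarrow> norm (x - y) < d b \<Longrightarrow> norm (?D x b - ?D y b) < e'"
    by metis
  define d0 where "d0 = Min (d ` Basis)"
  have d0: "d0 > 0" "\<And>b. b \<in> Basis \<Longrightarrow> d0 \<le> d b" using d(1) by (auto simp: d0_def)
  have D: "(f has_derivative ?D x) (at x)" for x
    using f by (intro smooth_has_derivative test_functions_smooth)
  have lin: "linear (?D x)" for x using D has_derivative_linear by blast
  have bl: "bounded_linear (?D x)" for x using D has_derivative_bounded_linear by blast
  show thesis
  proof (rule that[OF d0(1)])
    fix x h :: 'a assume h: "norm h < d0"
    have op: "norm (?D z k - ?D x k) \<le> e * norm k" if "z \<in> ball x d0" for z k
    proof -
      have "linear (\<lambda>k. ?D z k - ?D x k)" using lin by (intro linear_compose_sub)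
      then have "norm (?D z k - ?D x k) \<le> (\<Sum>b\<in>Basis. norm (?D z b - ?D x b)) * norm k"
        by (rule linear_norm_le_Basis)
      also have "(\<Sum>b\<in>Basis. norm (?D z b - ?D x b)) \<le> (\<Sum>b\<in>(Basis::'a set). e')"
      proof (rule sum_mono)
        fix b :: 'a assume b: "b \<in> Basis"
        show "norm (?D z b - ?D x b) \<le> e'"
          using d(2)[OF b, of z x] d0(2)[OF b] that by (auto simp: dist_norm norm_minus_commute)
      qed
      also have "\<dots> = e" by (simp add: e'_def)
      finally show ?thesis by (simp add: mult_right_mono)
    qed
    have "norm ((f (x + h) - ?D x (x + h)) - (f x - ?D x x)) \<le> e * norm ((x + h) - x)"
    proof (rule differentiable_bound[of "ball x d0" "\<lambda>z. f z - ?D x z" "\<lambda>z k. ?D z k - ?D x k"])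
      fix z assume z: "z \<in> ball x d0"
      show "((\<lambda>z. f z - ?D x z) has_derivative (\<lambda>k. ?D z k - ?D x k)) (at z within ball x d0)"
        by (intro has_derivative_diff has_derivative_at_withinI[OF D] bounded_linear_imp_has_derivative bl)
      show "onorm (\<lambda>k. ?D z k - ?D x k) \<le> e"
        using e op[OF z] by (intro onorm_bound) auto
    qed (use h d0 in \<open>auto simp: dist_norm\<close>)
    then show "norm (f (x + h) - f x - ?D x h) \<le> e * norm h"
      by (simp add: linear_add[OF lin] algebra_simps)
  qed
qed

text \<open>All derivatives fall on \<open>f\<close>. A partial derivative of the convolution is the
  convolution with a partial derivative of \<open>f\<close>, again a test function, so the induction
  on the order goes through.\<close>

lemma smooth_convolution:
  fixes u :: "'a::euclidean_space \<Rightarrow> real" and f :: "'a \<Rightarrow> 'b::euclidean_space"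
  assumes u: "integrable lborel u" and f: "f \<in> test_functions S"
  shows "smooth (\<lambda>x. LBINT y. u y *\<^sub>R f (x - y))"
proof -
  note [measurable] = borel_measurable_integrable[OF u]
  define F where "F f x = (LBINT y. u y *\<^sub>R f (x - y))" for f :: "'a \<Rightarrow> 'b" and x
  define D where "D f x h = (\<Sum>b\<in>Basis. (h \<bullet> b) *\<^sub>R F (\<lambda>z. frechet_derivative f (at z) b) x)" for f x h
  have i: "integrable lborel (\<lambda>y. u y *\<^sub>R f (x - y))" if f: "f \<in> test_functions S" for f :: "'a \<Rightarrow> 'b" and x
  proof -
    obtain B where "\<And>x. norm (f x) \<le> B" using test_functions_bounded[OF f] by metis
    then show ?thesis using test_functions_borel[OF f] by (intro integrable_mult_bounded[OF u, of _ B]) auto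
  qed
  have der: "(F f has_derivative D f x) (at x)" if f: "f \<in> test_functions S" for f x
    unfolding has_derivative_at_alt
  proof (intro conjI allI impI)
    show "bounded_linear (D f x)" unfolding D_def
      by (intro bounded_linear_sum bounded_linear_scaleR_const bounded_linear_inner_left)
    fix e :: real assume e: "e > 0"
    define U where "U = (LBINT y. \<bar>u y\<bar>)"
    have U: "U \<ge> 0" unfolding U_def by (intro integral_nonneg_AE) auto
    \<comment> \<open>\<open>U + 1\<close> instead of \<open>U\<close>, since \<open>u\<close> may
      be zero almost everywhere.\<close>
    have e': "e / (U + 1) > 0" using e U by simp
    obtain d where d: "d > 0"
      "\<And>x h. norm h < d \<Longrightarrow> norm (f (x + h) - f x - frechet_derivative f (at x) h) \<le> e / (U + 1) * norm h"
      using test_functions_uniformly_differentiable[OF f e'] by metis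
    have "norm (F f y - F f x - D f x (y - x)) \<le> e * norm (y - x)" if y: "norm (y - x) < d" for y
    proof -
      have ib: "integrable lborel (\<lambda>z. u z *\<^sub>R frechet_derivative f (at (x - z)) b)" if "b \<in> Basis" for b
        using i[OF test_functions_frechet_derivative[OF f that]] .
      have lin: "linear (frechet_derivative f (at z))" for z
        using smooth_has_derivative[OF test_functions_smooth[OF f]] has_derivative_linear by blast
      have Dx: "D f x h = (LBINT z. u z *\<^sub>R frechet_derivative f (at (x - z)) h)" 
        and Di: "integrable lborel (\<lambda>z. u z *\<^sub>R frechet_derivative f (at (x - z)) h)" for h
      proof -
        have *: "frechet_derivative f (at z) h = (\<Sum>b\<in>Basis. (h \<bullet> b) *\<^sub>R frechet_derivative f (at z) b)" for z
        proof -
          have "frechet_derivative f (at z) h = frechet_derivative f (at z) (\<Sum>b\<in>Basis. (h \<bullet> b) *\<^sub>R b)"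
            by (simp add: euclidean_representation)
          then show ?thesis by (simp add: linear_sum[OF lin] linear_scale[OF lin])
        qed
        have **: "u z *\<^sub>R frechet_derivative f (at (x - z)) h =
            (\<Sum>b\<in>Basis. (h \<bullet> b) *\<^sub>R (u z *\<^sub>R frechet_derivative f (at (x - z)) b))" for z
          unfolding *[of "x - z"] by (simp add: scaleR_sum_right mult.commute)
        show "integrable lborel (\<lambda>z. u z *\<^sub>R frechet_derivative f (at (x - z)) h)"
          unfolding ** using ib by (intro Bochner_Integration.integrable_sum integrable_scaleR_right) auto
        have "(LBINT z. u z *\<^sub>R frechet_derivative f (at (x - z)) h) =
           (\<Sum>b\<in>Basis. LBINT z. (h \<bullet> b) *\<^sub>R (u z *\<^sub>R frechet_derivative f (at (x - z)) b))"
          unfolding ** using ib by (intro Bochner_Integration.integral_sum integrable_scaleR_right) auto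
        also have "\<dots> = D f x h"
          unfolding D_def F_def by (intro sum.cong refl integral_scaleR_right)
        finally show "D f x h = (LBINT z. u z *\<^sub>R frechet_derivative f (at (x - z)) h)" ..
      qed
      let ?E = "\<lambda>z. f (y - z) - f (x - z) - frechet_derivative f (at (x - z)) (y - x)"
      have eq: "F f y - F f x - D f x (y - x) = (LBINT z. u z *\<^sub>R ?E z)"
        unfolding Dx F_def using i[OF f] Di by (simp add: scaleR_diff_right)
      have "norm (F f y - F f x - D f x (y - x)) \<le> (LBINT z. norm (u z *\<^sub>R ?E z))"
        unfolding eq by (rule integral_norm_bound)
      also have "\<dots> \<le> (LBINT z. \<bar>u z\<bar> * (e / (U + 1) * norm (y - x)))"
      proof (rule integral_mono)
        have "integrable lborel (\<lambda>z. u z *\<^sub>R f (y - z) - u z *\<^sub>R f (x - z)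
            - u z *\<^sub>R frechet_derivative f (at (x - z)) (y - x))"
          by (intro Bochner_Integration.integrable_diff i[OF f] Di)
        then show "integrable lborel (\<lambda>z. norm (u z *\<^sub>R ?E z))"
          unfolding scaleR_diff_right by (rule integrable_norm)
        show "norm (u z *\<^sub>R ?E z) \<le> \<bar>u z\<bar> * (e / (U + 1) * norm (y - x))" for z
        proof -
          have "x - z + (y - x) = y - z" by simp
          then have "norm (?E z) \<le> e / (U + 1) * norm (y - x)" using d(2)[OF y, of "x - z"] by metis
          then show ?thesis unfolding norm_scaleR by (rule mult_left_mono) simp
        qed
      qed (use u in auto)
      also have "\<dots> = U / (U + 1) * (e * norm (y - x))" by (simp add: U_def)
      also have "\<dots> \<le> 1 * (e * norm (y - x))" using U e by (intro mult_right_mono) auto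
      finally show ?thesis by simp
    qed
    then show "\<exists>d>0. \<forall>y. norm (y - x) < d \<longrightarrow> norm (F f y - F f x - D f x (y - x)) \<le> e * norm (y - x)"
      using d(1) by blast
  qed
  have "Ck_on k UNIV (F f)" if "f \<in> test_functions S" for k f
    using that
  proof (induction k arbitrary: f)
    case 0
    have "continuous (at x) (F f)" for x
      using der[OF 0] has_derivative_continuous by blast
    then show ?case by (simp add: continuous_at_imp_continuous_on)
  next
    case (Suc k)
    show ?case
    proof (rule Ck_on_SucI)
      show "(F f has_derivative D f x) (at x)" for x using der[OF Suc.prems] .
      fix b :: 'a assume b: "b \<in> Basis"
      have "D f x b = F (\<lambda>z. frechet_derivative f (at z) b) x" for x
      proof -
        have "D f x b = (\<Sum>c\<in>Basis. if c = b then F (\<lambda>z. frechet_derivative f (at z) c) x else 0)"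
          unfolding D_def by (intro sum.cong refl) (use b in \<open>auto simp: inner_Basis\<close>)
        then show ?thesis using b by simp
      qed
      then show "Ck_on k UNIV (\<lambda>x. D f x b)"
        using Suc.IH[OF test_functions_frechet_derivative[OF Suc.prems b]] by simp
    qed simp
  qed
  from this[OF f] show ?thesis by (simp add: smooth_def Ck_on_UNIV F_def[abs_def])
qed

section \<open>Integrability of powers of the norm\<close>

lemma integrable_dyadic:
  fixes g :: "'a::euclidean_space \<Rightarrow> real"
  assumes g: "g \<in> borel_measurable borel" "\<And>z. 0 \<le> g z"
    and c: "\<And>k. 0 \<le> c k" "\<And>k. 0 \<le> \<rho> k" "summable (\<lambda>k. c k * \<rho> k ^ DIM('a))"
    and le: "\<And>z. g z \<noteq> 0 \<Longrightarrow> \<exists>k. z \<in> ball 0 (\<rho> k) \<and> g z \<le> c k"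
  shows "integrable lborel g"
proof (rule integrableI_nonneg)
  \<comment> \<open>Concentric balls replace dyadic shells: every \<open>z\<close> needs a single
    ball that bounds \<open>g z\<close>, and only volumes of balls enter.\<close>
  have "(\<integral>\<^sup>+z. ennreal (g z) \<partial>lborel) \<le> (\<integral>\<^sup>+z. (\<Sum>k. ennreal (c k) * indicator (ball (0::'a) (\<rho> k)) z) \<partial>lborel)"
  proof (rule nn_integral_mono)
    fix z
    show "ennreal (g z) \<le> (\<Sum>k. ennreal (c k) * indicator (ball 0 (\<rho> k)) z)"
    proof (cases "g z = 0")
      case False
      then obtain k where k: "z \<in> ball 0 (\<rho> k)" "g z \<le> c k" using le by blast
      then have "ennreal (g z) \<le> (\<Sum>i\<in>{k}. ennreal (c i) * indicator (ball 0 (\<rho> i)) z)"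
        by (simp add: ennreal_leI)
      also have "\<dots> \<le> (\<Sum>k. ennreal (c k) * indicator (ball 0 (\<rho> k)) z)"
        by (rule sum_le_suminf) auto
      finally show ?thesis .
    qed simp
  qed
  also have "\<dots> = (\<Sum>k. ennreal (c k) * emeasure lborel (ball (0::'a) (\<rho> k)))"
    by (subst nn_integral_suminf)
      (auto simp: nn_integral_cmult_indicator intro!: borel_measurable_times_ennreal borel_measurable_indicator)
  also have "\<dots> = (\<Sum>k. ennreal (unit_ball_vol DIM('a) * (c k * \<rho> k ^ DIM('a))))"
    using c by (intro suminf_cong) (simp add: emeasure_ball ennreal_mult[symmetric] mult_ac)
  also have "\<dots> = ennreal (\<Sum>k. unit_ball_vol DIM('a) * (c k * \<rho> k ^ DIM('a)))"
    using c by (intro suminf_ennreal2 summable_mult) auto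
  also have "\<dots> < \<infinity>" by simp
  finally show "(\<integral>\<^sup>+z. ennreal (g z) \<partial>lborel) < \<infinity>" .
qed (use g in auto)

lemma power_powr: "0 < (x::real) \<Longrightarrow> (x ^ k) powr b = (x powr b) ^ k"
  by (induction k) (auto simp: powr_mult)

lemma integrable_norm_powr_inner:
  fixes a R :: real
  assumes "0 \<le> a" "a < DIM('a::euclidean_space)" "0 < R"
  shows "integrable lborel (\<lambda>z::'a. indicat_real (ball 0 R) z * norm z powr (- a))"
proof -
  \<comment> \<open>Shell \<open>k\<close> lies between \<open>R / 2^(k+1)\<close> and
    \<open>R / 2^k\<close>. The nonincreasing power is bounded by its value \<open>?c k\<close> at
    the inner radius; the series is geometric with ratio \<open>2 powr (a - DIM('a))\<close>, below
    1 because \<open>a < DIM('a)\<close>.\<close>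
  let ?c = "\<lambda>k::nat. (R * (1/2) ^ Suc k) powr (- a)" and ?\<rho> = "\<lambda>k::nat. R * (1/2) ^ k"
  have "summable (\<lambda>k. (R powr (-a) * 2 powr a * R ^ DIM('a)) * (2 powr (a - DIM('a))) ^ k)"
    using assms by (intro summable_mult summable_geometric) (auto simp: powr_less_one)
  moreover have "?c k * ?\<rho> k ^ DIM('a) = (R powr (-a) * 2 powr a * R ^ DIM('a)) * (2 powr (a - DIM('a))) ^ k" for k
  proof -
    have "?c k = R powr (-a) * ((1/2) powr (- a)) ^ Suc k"
      using assms power_powr[of "1/2" "Suc k" "-a"] by (simp only: powr_mult)
    moreover have "(1/2::real) powr (-a) = 2 powr a" by (simp add: powr_minus powr_divide field_simps)
    moreover have "(2 powr (a - DIM('a))) ^ k = ((1/2::real) ^ k) ^ DIM('a) * (2 powr a) ^ k"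
      by (simp add: powr_diff powr_realpow power_divide power_mult[symmetric] mult.commute)
    ultimately show ?thesis by (simp add: power_mult_distrib)
  qed
  ultimately have sm: "summable (\<lambda>k. ?c k * ?\<rho> k ^ DIM('a))" by simp
  show ?thesis
  proof (rule integrable_dyadic[OF _ _ _ _ sm])
    have [measurable]: "ball (0::'a) R \<in> sets borel" by simp
    show "(\<lambda>z::'a. indicat_real (ball 0 R) z * norm z powr (- a)) \<in> borel_measurable borel" by measurable
    fix z :: 'a assume "indicat_real (ball 0 R) z * norm z powr (- a) \<noteq> 0"
    then have z: "norm z < R" "z \<noteq> 0" by (auto simp: indicator_def split: if_splits)
    then obtain n where "(1/2) ^ n < norm z / R"
      using real_arch_pow_inv[of "norm z / R" "1/2"] assms by auto
    then have "?\<rho> n \<le> norm z" using assms by (simp add: field_simps)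
    moreover have "?\<rho> (Suc n) \<le> ?\<rho> n" using assms by simp
    ultimately have ex: "\<exists>n. ?\<rho> (Suc n) \<le> norm z" by (intro exI[of _ n]) linarith
    \<comment> \<open>The first shell whose inner radius does not exceed \<open>norm z\<close>.
      Minimality supplies the outer bound; for \<open>k = 0\<close> it is
      \<open>norm z < R\<close>.\<close>
    define k where "k = (LEAST n. ?\<rho> (Suc n) \<le> norm z)"
    have k1: "?\<rho> (Suc k) \<le> norm z" unfolding k_def using ex by (rule LeastI_ex)
    have k2: "norm z < ?\<rho> k"
    proof (cases k)
      case (Suc j)
      then have "\<not> ?\<rho> (Suc j) \<le> norm z"
        using not_less_Least[of j "\<lambda>n. ?\<rho> (Suc n) \<le> norm z"] by (simp add: k_def)
      then show ?thesis using Suc by simp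
    qed (use z in simp)
    have "norm z powr (- a) \<le> ?c k"
      by (rule powr_mono2') (use k1 assms in auto)
    then show "\<exists>k. z \<in> ball 0 (?\<rho> k) \<and> indicat_real (ball 0 R) z * norm z powr (- a) \<le> ?c k"
      using k2 z by (intro exI[of _ k]) auto
  qed (use assms in auto)
qed

lemma integrable_norm_powr_outer:
  fixes b R :: real
  assumes "DIM('a::euclidean_space) < b" "0 < R"
  shows "integrable lborel (\<lambda>z::'a. indicat_real (- ball 0 R) z * norm z powr (- b))"
proof -
  \<comment> \<open>Shells between \<open>R 2^k\<close> and \<open>R 2^(k+1)\<close>, with ratio
    \<open>2 powr (DIM('a) - b)\<close>. Now the first outer radius beyond \<open>norm z\<close>
    selects \<open>k\<close>.\<close>
  let ?c = "\<lambda>k::nat. (R * 2 ^ k) powr (- b)" and ?\<rho> = "\<lambda>k::nat. R * 2 ^ Suc k"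
  have "summable (\<lambda>k. (R powr (-b) * (2 * R) ^ DIM('a)) * (2 powr (DIM('a) - b)) ^ k)"
    using assms by (intro summable_mult summable_geometric) (auto simp: powr_less_one)
  moreover have "?c k * ?\<rho> k ^ DIM('a) = (R powr (-b) * (2 * R) ^ DIM('a)) * (2 powr (DIM('a) - b)) ^ k" for k
  proof -
    have "?c k = R powr (-b) * (2 powr (- b)) ^ k"
      using assms by (simp add: powr_mult power_powr)
    moreover have "(2 powr (real DIM('a) - b)) ^ k = (2 ^ k) ^ DIM('a) * (2 powr (-b)) ^ k"
      by (simp add: powr_diff powr_minus powr_realpow power_divide power_mult[symmetric] mult.commute power_inverse divide_inverse power_mult_distrib)
    ultimately show ?thesis by (simp add: power_mult_distrib)
  qed
  ultimately have sm: "summable (\<lambda>k. ?c k * ?\<rho> k ^ DIM('a))" by simp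
  show ?thesis
  proof (rule integrable_dyadic[OF _ _ _ _ sm])
    have [measurable]: "- ball (0::'a) R \<in> sets borel" by simp
    show "(\<lambda>z::'a. indicat_real (- ball 0 R) z * norm z powr (- b)) \<in> borel_measurable borel" by measurable
    fix z :: 'a assume "indicat_real (- ball 0 R) z * norm z powr (- b) \<noteq> 0"
    then have z: "norm z \<ge> R" by (auto simp: indicator_def split: if_splits)
    obtain n where "norm z / R < 2 ^ n"
      using real_arch_pow[of 2 "norm z / R"] by auto
    then have "norm z < R * 2 ^ n" using assms by (simp add: field_simps)
    also have "\<dots> \<le> ?\<rho> n" using assms by simp
    finally have ex: "\<exists>n. norm z < ?\<rho> n" by blast
    define k where "k = (LEAST n. norm z < ?\<rho> n)"
    have k1: "norm z < ?\<rho> k" unfolding k_def using ex by (rule LeastI_ex)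
    have k2: "R * 2 ^ k \<le> norm z"
    proof (cases k)
      case (Suc j)
      then have "\<not> norm z < ?\<rho> j"
        using not_less_Least[of j "\<lambda>n. norm z < ?\<rho> n"] by (simp add: k_def)
      then show ?thesis using Suc by simp
    qed (use z in simp)
    have "norm z powr (- b) \<le> ?c k"
      by (rule powr_mono2') (use k2 assms in auto)
    then show "\<exists>k. z \<in> ball 0 (?\<rho> k) \<and> indicat_real (- ball 0 R) z * norm z powr (- b) \<le> ?c k"
      using k1 z by (intro exI[of _ k]) auto
  qed (use assms in auto)
qed

section \<open>Mollifiers and the fundamental lemma of the calculus of variations\<close>

lemma ex_borel_version:
  fixes f :: "'a::euclidean_space \<Rightarrow> 'b::euclidean_space"
  assumes "f \<in> borel_measurable lebesgue"
  obtains g where "g \<in> borel_measurable borel" "AE x in lebesgue. f x = g x"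
proof -
  have "\<exists>g\<in>borel_measurable lborel. AE x in lborel. f x \<bullet> b = g x" for b
    using assms by (intro completion_ex_borel_measurable_real) (auto intro: borel_measurable_inner)
  then obtain g where g: "\<And>b. g b \<in> borel_measurable lborel" "\<And>b. AE x in lborel. f x \<bullet> b = g b x"
    by metis
  show thesis
  proof
    show "(\<lambda>x. \<Sum>b\<in>Basis. g b x *\<^sub>R b) \<in> borel_measurable borel" using g(1) by simp
    have "AE x in lborel. \<forall>b\<in>Basis. f x \<bullet> b = g b x"
      using g(2) by (intro eventually_ball_finite) auto
    then have "AE x in lborel. f x = (\<Sum>b\<in>Basis. g b x *\<^sub>R b)"
    proof eventually_elim
      case (elim x)
      then have "(\<Sum>b\<in>Basis. g b x *\<^sub>R b) = (\<Sum>b\<in>Basis. (f x \<bullet> b) *\<^sub>R b)" by simp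
      then show ?case by (simp add: euclidean_representation)
    qed
    then show "AE x in lebesgue. f x = (\<Sum>b\<in>Basis. g b x *\<^sub>R b)" by (rule AE_completion)
  qed
qed

lemma
  fixes f g :: "'a::euclidean_space \<Rightarrow> 'b::euclidean_space"
  assumes "g \<in> borel_measurable borel" "AE x in lebesgue. f x = g x"
  shows lebesgue_integral_borel_version: "integral\<^sup>L lebesgue f = integral\<^sup>L lborel g"
    and lebesgue_integrable_borel_version: "integrable lebesgue f \<longleftrightarrow> integrable lborel g"
    and lebesgue_measurable_borel_version: "f \<in> borel_measurable lebesgue"
proof -
  have g: "g \<in> borel_measurable lborel" using assms by simp
  have g': "g \<in> borel_measurable lebesgue" using g by (rule measurable_completion)
  show f: "f \<in> borel_measurable lebesgue"
  proof (rule measurableI)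
    fix A :: "'b set" assume "A \<in> sets borel"
    then have A: "g -` A \<in> sets lebesgue" using measurable_sets[OF g'] by simp
    obtain N where N: "{x. f x \<noteq> g x} \<subseteq> N" "N \<in> null_sets lebesgue"
      using assms(2) unfolding eventually_ae_filter by auto
    have "f -` A \<inter> N \<in> null_sets lebesgue"
      by (rule completion.complete2[OF _ N(2)]) auto
    moreover have "f -` A = (g -` A - N) \<union> (f -` A \<inter> N)" using N(1) by auto
    ultimately have "f -` A \<in> sets lebesgue" using A N(2) by (metis null_setsD2 sets.Diff sets.Un)
    then show "f -` A \<inter> space lebesgue \<in> sets lebesgue" by simp
  qed simp
  show "integral\<^sup>L lebesgue f = integral\<^sup>L lborel g"
    by (rule trans[OF integral_cong_AE[OF f g' assms(2)] integral_completion[OF g]])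
  show "integrable lebesgue f \<longleftrightarrow> integrable lborel g"
    by (rule trans[OF integrable_cong_AE[OF f g' assms(2)] integrable_completion[OF g]])
qed

locale nonlocal_setup =
  fixes s p \<delta> :: real and w :: "real^'n \<Rightarrow> real"
  assumes \<delta>: "0 < \<delta>" and cutoff: "cutoff \<delta> w" and s: "0 < s" "s < 1" and p: "1 \<le> p"
begin

lemma w_test: "w \<in> test_functions (ball 0 \<delta>)"
  and w_nonneg: "0 \<le> w x"
  and w_radial: "norm x = norm y \<Longrightarrow> w x = w y"
  and w_antimono: "norm x \<le> norm y \<Longrightarrow> w y \<le> w x"
  using cutoff unfolding cutoff_def by blast+

lemma w_one: "\<exists>b>0. b < 1 \<and> (\<forall>x. norm x < b * \<delta> \<longrightarrow> w x = 1)"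
  using cutoff unfolding cutoff_def by (metis mem_ball_0)

lemma w_le_1: "w x \<le> 1"
proof -
  obtain b where b: "0 < b" "b < 1" "\<And>x. norm x < b * \<delta> \<Longrightarrow> w x = 1" using w_one by blast
  then have "w 0 = 1" using \<delta> by simp
  moreover have "w x \<le> w 0" by (rule w_antimono) simp
  ultimately show ?thesis by simp
qed

text \<open>The cut-off \<open>w\<close> itself, rescaled and recentred, is the bump. Its plateau
  fraction \<open>b\<close> depends neither on the centre nor on the radius, so the plateaus
  \<open>ball c (b * r)\<close> can be used for covering.\<close>

lemma ex_bump:
  "\<exists>b>0. b < 1 \<and> (\<forall>(c::real^'n) r. 0 < r \<longrightarrow> (\<exists>\<eta>\<in>test_functions (ball c r).
    (\<forall>x. 0 \<le> \<eta> x \<and> \<eta> x \<le> 1) \<and> (\<forall>x\<in>ball c (b * r). \<eta> x = (1::real))))"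
proof -
  obtain b where b: "0 < b" "b < 1" "\<And>x. norm x < b * \<delta> \<Longrightarrow> w x = 1" using w_one by blast
  have "\<exists>\<eta>\<in>test_functions (ball c r). (\<forall>x. 0 \<le> \<eta> x \<and> \<eta> x \<le> 1) \<and> (\<forall>x\<in>ball c (b * r). \<eta> x = (1::real))"
    if r: "0 < r" for c :: "real^'n" and r
  proof (intro bexI conjI allI ballI)
    let ?\<eta> = "\<lambda>x. w ((\<delta> / r) *\<^sub>R x + (- ((\<delta> / r) *\<^sub>R c)))"
    have n: "norm ((\<delta> / r) *\<^sub>R x + (- ((\<delta> / r) *\<^sub>R c))) = \<delta> / r * norm (x - c)" for x
    proof -
      have "(\<delta> / r) *\<^sub>R x + (- ((\<delta> / r) *\<^sub>R c)) = (\<delta> / r) *\<^sub>R (x - c)" by (simp add: scaleR_diff_right)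
      then show ?thesis using \<delta> r by simp
    qed
    have "?\<eta> \<in> test_functions ((\<lambda>x. (\<delta> / r) *\<^sub>R x + (- ((\<delta> / r) *\<^sub>R c))) -` ball 0 \<delta>)"
      using \<delta> r by (intro test_functions_affine w_test) auto
    moreover have "(\<lambda>x. (\<delta> / r) *\<^sub>R x + (- ((\<delta> / r) *\<^sub>R c))) -` ball 0 \<delta> \<subseteq> ball c r"
    proof
      fix x assume "x \<in> (\<lambda>x. (\<delta> / r) *\<^sub>R x + (- ((\<delta> / r) *\<^sub>R c))) -` ball 0 \<delta>"
      then have "\<delta> / r * norm (x - c) < \<delta>" using n[of x] by simp
      then show "x \<in> ball c r" using \<delta> r by (simp add: dist_norm norm_minus_commute field_simps)
    qed
    ultimately show "?\<eta> \<in> test_functions (ball c r)" using test_functions_mono by blast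
    show "0 \<le> ?\<eta> x" "?\<eta> x \<le> 1" for x by (auto simp: w_nonneg w_le_1)
    fix x assume "x \<in> ball c (b * r)"
    then have "\<delta> / r * norm (x - c) < b * \<delta>"
      using \<delta> r by (simp add: dist_norm norm_minus_commute field_simps)
    then show "?\<eta> x = 1" using n[of x] by (intro b(3)) simp
  qed
  then show ?thesis using b(1,2) by blast
qed

text \<open>A bump divided by its integral, which is positive because of the plateau. The centre
  \<open>c\<close> is free on account of the translated mollifiers used at the boundary.\<close>

lemma ex_mollifier:
  assumes r: "0 < r"
  obtains \<mu> :: "real^'n \<Rightarrow> real" where "\<mu> \<in> test_functions (ball c r)" "\<And>x. 0 \<le> \<mu> x" "(LBINT x. \<mu> x) = 1"
proof -
  obtain b where b: "0 < b" "b < 1" "\<And>c::real^'n. \<And>r. 0 < r \<Longrightarrow> \<exists>\<eta>\<in>test_functions (ball c r).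
    (\<forall>x. 0 \<le> \<eta> x \<and> \<eta> x \<le> 1) \<and> (\<forall>x\<in>ball c (b * r). \<eta> x = (1::real))" using ex_bump by blast
  obtain \<eta> where \<eta>: "\<eta> \<in> test_functions (ball c r)" "\<And>x. 0 \<le> \<eta> x" "\<And>x. x \<in> ball c (b * r) \<Longrightarrow> \<eta> x = (1::real)"
    using b(3)[OF r, of c] by blast
  define I where "I = (LBINT x. \<eta> x)"
  have i: "integrable lborel \<eta>" using \<eta>(1) by (rule test_functions_integrable)
  have "0 < measure lborel (ball c (b * r))"
    using b(1) r content_ball_pos[of "b * r" c] by simp
  also have "\<dots> = (LBINT x. indicat_real (ball c (b * r)) x)" by simp
  also have "\<dots> \<le> I"
    unfolding I_def
  proof (rule integral_mono)
    show "integrable lborel (indicat_real (ball c (b * r)))"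
      using emeasure_bounded_finite[of "ball c (b*r)"] by (intro integrable_real_indicator) auto
    show "indicat_real (ball c (b * r)) x \<le> \<eta> x" for x
      using \<eta>(2,3)[of x] by (auto simp: indicator_def)
  qed (rule i)
  finally have I: "I > 0" .
  have "(\<lambda>x. (1 / I) *\<^sub>R \<eta> x) \<in> test_functions (ball c r)"
    by (rule test_functions_linear[OF bounded_linear_scaleR_right \<eta>(1)])
  then show thesis
    using I \<eta>(2) i that[of "\<lambda>x. (1 / I) *\<^sub>R \<eta> x"] by (simp add: I_def)
qed

text \<open>On small balls, convolving \<open>v\<close> with a mollifier tests it against a
  translate of the reflected mollifier and so gives zero. Mollification converges in
  \<open>L^1\<close>, hence \<open>v\<close> vanishes there, and countably many such balls cover
  \<open>S\<close>.\<close>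

lemma fundamental_lemma_real:
  fixes v :: "real^'n \<Rightarrow> real"
  assumes S: "open S" and v: "v \<in> L1_loc S"
    and 0: "\<And>\<phi>. \<phi> \<in> test_functions S \<Longrightarrow> (\<integral>x. v x * \<phi> x \<partial>lebesgue_on S) = 0"
  shows "AE x in lebesgue. x \<in> S \<longrightarrow> v x = 0"
proof -
  have loc: "AE x in lebesgue. x \<in> ball z r \<longrightarrow> v x = 0" if r: "0 < r" "cball z (2 * r) \<subseteq> S" for z r
  proof -
    \<comment> \<open>The doubled radius leaves room for the mollifier: \<open>ball x r\<close>
      stays inside \<open>B\<close> for all \<open>x\<close> in \<open>ball z r\<close>.\<close>
    define B where "B = cball z (2 * r)"
    have vB: "integrable (lebesgue_on B) v" using v that unfolding L1_loc_def B_def by auto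
    have B[measurable]: "B \<in> sets lebesgue" "B \<in> sets borel" by (simp_all add: B_def)
    define u0 where "u0 x = indicat_real B x *\<^sub>R v x" for x
    have u0: "integrable lebesgue u0"
      using vB B unfolding u0_def by (subst (asm) integrable_restrict_space) auto
    obtain u where u: "u \<in> borel_measurable borel" "AE x in lebesgue. u0 x = u x"
      using ex_borel_version[OF borel_measurable_integrable[OF u0]] by blast
    note [measurable] = u(1)
    have ui: "integrable lborel u" using u0 u lebesgue_integrable_borel_version by blast
    have LBu: "Lp_borel 1 u" using ui by (simp add: Lp_borel_def)
    have conv0: "(LBINT y. \<mu> y *\<^sub>R u (x - y)) = 0"
      if \<mu>: "\<mu> \<in> test_functions (ball 0 r)" and x: "x \<in> ball z r" for \<mu> and x :: "real^'n"
    proof -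
      define \<phi> where "\<phi> y = \<mu> (x - y)" for y
      have "(\<lambda>y. \<mu> ((-1) *\<^sub>R y + x)) \<in> test_functions ((\<lambda>y. (-1) *\<^sub>R y + x) -` ball 0 r)"
        by (intro test_functions_affine \<mu>) auto
      moreover have "(\<lambda>y. (-1) *\<^sub>R y + x) -` ball 0 r = ball x r"
        by (auto simp: dist_norm norm_minus_commute algebra_simps)
      ultimately have \<phi>: "\<phi> \<in> test_functions (ball x r)" by (simp add: \<phi>_def[abs_def] algebra_simps)
      have sub: "ball x r \<subseteq> B" 
      proof
        fix y assume "y \<in> ball x r"
        then show "y \<in> B" using x dist_triangle[of z y x] by (simp add: B_def)
      qed
      have \<phi>0: "\<phi> y = 0" if "y \<notin> B" for y
        using \<phi> sub that by (auto simp: test_functions_iff)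
      have "(LBINT y. \<mu> y *\<^sub>R u (x - y)) = (LBINT y. \<mu> (x - y) *\<^sub>R u (x - (x - y)))"
        by (rule integral_lborel_reflect[symmetric]) (use test_functions_borel[OF \<mu>] in simp)
      also have "\<dots> = (LBINT y. u y * \<phi> y)" by (simp add: \<phi>_def mult.commute)
      also have "\<dots> = (\<integral>y. v y * (indicat_real B y * \<phi> y) \<partial>lebesgue)"
      proof (rule lebesgue_integral_borel_version[symmetric])
        show "(\<lambda>y. u y * \<phi> y) \<in> borel_measurable borel" using test_functions_borel[OF \<phi>] by simp
        show "AE y in lebesgue. v y * (indicat_real B y * \<phi> y) = u y * \<phi> y"
          using u(2)
        proof eventually_elim
          case (elim y)
          then have "u y = indicat_real B y * v y" by (simp add: u0_def)
          then show ?case by simp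
        qed
      qed
      also have "\<dots> = (\<integral>y. indicat_real S y *\<^sub>R (v y * \<phi> y) \<partial>lebesgue)"
        using \<phi>0 that r by (intro Bochner_Integration.integral_cong) (auto simp: indicator_def B_def)
      also have "\<dots> = (\<integral>y. v y * \<phi> y \<partial>lebesgue_on S)"
        using S by (subst integral_restrict_space) auto
      also have "\<dots> = 0"
        using \<phi> sub r test_functions_mono[of "ball x r" S] by (intro 0) (auto simp: B_def)
      finally show ?thesis .
    qed
    define J where "J = (LBINT x. indicat_real (ball z r) x * \<bar>u x\<bar>)"
    have "J \<le> e" if e: "e > 0" for e
    proof -
      obtain d where d: "d > 0" "\<And>y. norm y < d \<Longrightarrow> Lp_pow 1 (\<lambda>x. u (x - y) - u x) < e"
        using translation_Lp[OF LBu _ e] by auto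
      have "0 < min d r" using d r by simp
      then obtain \<mu> :: "real^'n \<Rightarrow> real" where \<mu>: "\<mu> \<in> test_functions (ball 0 (min d r))" "\<And>x. 0 \<le> \<mu> x" "(LBINT x. \<mu> x) = 1"
        using ex_mollifier[of _ 0] by metis
      have \<mu>r: "\<mu> \<in> test_functions (ball 0 r)" 
        by (rule subsetD[OF test_functions_mono \<mu>(1)]) auto
      have \<mu>s: "norm y < d" if "\<mu> y \<noteq> 0" for y
        using \<mu>(1) that unfolding test_functions_iff by force
      note m = mollify_Lp[OF LBu _ _ test_functions_integrable[OF \<mu>(1)] \<mu>(2,3), of e]
      have m1: "Lp_borel 1 (\<lambda>x. (LBINT y. \<mu> y *\<^sub>R u (x - y)) - u x)"
        by (rule m(1)) (use d \<mu>s e in \<open>auto intro: less_imp_le\<close>)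
      have m2: "Lp_pow 1 (\<lambda>x. (LBINT y. \<mu> y *\<^sub>R u (x - y)) - u x) \<le> e"
        by (rule m(2)) (use d \<mu>s e in \<open>auto intro: less_imp_le\<close>)
      have [measurable]: "ball z r \<in> sets borel" by simp
      have "J \<le> Lp_pow 1 (\<lambda>x. (LBINT y. \<mu> y *\<^sub>R u (x - y)) - u x)"
        unfolding J_def Lp_pow_def
      proof (rule integral_mono)
        show "integrable lborel (\<lambda>x. indicat_real (ball z r) x * \<bar>u x\<bar>)"
          using ui by (intro Bochner_Integration.integrable_bound[OF ui]) (auto simp: indicator_def)
        show "integrable lborel (\<lambda>x. norm ((LBINT y. \<mu> y *\<^sub>R u (x - y)) - u x) powr 1)"
          using m1 by (simp add: Lp_borel_def)
        show "indicat_real (ball z r) x * \<bar>u x\<bar> \<le> norm ((LBINT y. \<mu> y *\<^sub>R u (x - y)) - u x) powr 1" for x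
          using conv0[OF \<mu>r, of x] by (cases "x \<in> ball z r") (simp_all only: indicator_simps, auto)
      qed
      with m2 show ?thesis by simp
    qed
    then have "J \<le> 0" by (rule field_le_epsilon[of J 0, simplified]) 
    moreover have [measurable]: "ball z r \<in> sets borel" by simp
    have iJ: "integrable lborel (\<lambda>x. indicat_real (ball z r) x * \<bar>u x\<bar>)"
      using ui by (intro Bochner_Integration.integrable_bound[OF ui]) (auto simp: indicator_def)
    have "J \<ge> 0" unfolding J_def by (intro integral_nonneg_AE) auto
    ultimately have "J = 0" by simp
    then have "AE x in lborel. indicat_real (ball z r) x * \<bar>u x\<bar> = 0"
      using integral_nonneg_eq_0_iff_AE[OF iJ] by (simp add: J_def)
    then have "AE x in lebesgue. indicat_real (ball z r) x * \<bar>u x\<bar> = 0" by (rule AE_completion)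
    with u(2) show ?thesis
    proof eventually_elim
      case (elim x)
      have "ball z r \<subseteq> B" using r by (auto simp: B_def)
      then show ?case using elim by (auto simp: u0_def indicator_def split: if_splits)
    qed
  qed
  define F where "F = {ball z r |z r. 0 < r \<and> cball z (2 * r) \<subseteq> S}"
  obtain F' where F': "F' \<subseteq> F" "countable F'" "\<Union>F' = \<Union>F"
    by (rule Lindelof[of F]) (auto simp: F_def)
  have "S \<subseteq> \<Union>F"
  proof
    fix z assume "z \<in> S"
    then obtain e where e: "e > 0" "cball z e \<subseteq> S" using S open_contains_cball by blast
    then have "ball z (e/2) \<in> F" unfolding F_def by (intro CollectI exI[of _ z] exI[of _ "e/2"]) auto
    then show "z \<in> \<Union>F" using e by (intro UnionI) auto
  qed
  moreover have "AE x in lebesgue. \<forall>U\<in>F'. x \<in> U \<longrightarrow> v x = 0"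
    using F' loc by (subst AE_ball_countable) (auto simp: F_def)
  ultimately show ?thesis using F'(3) by (auto elim!: eventually_mono)
qed

lemma fundamental_lemma:
  fixes v :: "real^'n \<Rightarrow> real^'n"
  assumes S: "open S" and v: "v \<in> L1_loc S"
    and 0: "\<And>\<psi>. \<psi> \<in> test_functions S \<Longrightarrow> (\<integral>x. v x \<bullet> \<psi> x \<partial>lebesgue_on S) = 0"
  shows "AE x in lebesgue. x \<in> S \<longrightarrow> v x = 0"
proof -
  have "AE x in lebesgue. x \<in> S \<longrightarrow> v x \<bullet> b = 0" for b
  proof (rule fundamental_lemma_real[OF S])
    show "(\<lambda>x. v x \<bullet> b) \<in> L1_loc S" using v by (auto simp: L1_loc_def)
    fix \<phi> :: "real^'n \<Rightarrow> real" assume "\<phi> \<in> test_functions S"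
    then have "(\<lambda>x. \<phi> x *\<^sub>R b) \<in> test_functions S"
      by (rule test_functions_linear[OF bounded_linear_scaleR_left])
    from 0[OF this] show "(\<integral>x. (v x \<bullet> b) * \<phi> x \<partial>lebesgue_on S) = 0"
      by (simp add: mult.commute)
  qed
  then have "AE x in lebesgue. \<forall>b\<in>Basis. x \<in> S \<longrightarrow> v x \<bullet> b = 0"
    by (intro eventually_ball_finite) auto
  then show ?thesis by eventually_elim (auto intro: euclidean_eqI)
qed

end

section \<open>Pairings of Lebesgue functions with test functions\<close>

lemma integrable_pairI:
  fixes h :: "'a::euclidean_space \<times> 'a \<Rightarrow> 'b::euclidean_space"
  assumes h[measurable]: "h \<in> borel_measurable (lborel \<Otimes>\<^sub>M lborel)" and q: "integrable lborel q"
    and le: "\<And>z. (\<integral>\<^sup>+x. ennreal (norm (h (z, x))) \<partial>lborel) \<le> ennreal (q z)"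
  shows "integrable (lborel \<Otimes>\<^sub>M lborel) h"
proof (rule integrableI_bounded)
  have "(\<integral>\<^sup>+y. ennreal (norm (h y)) \<partial>(lborel \<Otimes>\<^sub>M lborel)) = (\<integral>\<^sup>+z. (\<integral>\<^sup>+x. ennreal (norm (h (z, x))) \<partial>lborel) \<partial>lborel)"
    by (rule lborel.nn_integral_fst[symmetric]) measurable
  also have "\<dots> \<le> (\<integral>\<^sup>+z. ennreal (q z) \<partial>lborel)"
    by (intro nn_integral_mono le)
  also have "\<dots> \<le> (\<integral>\<^sup>+z. ennreal (norm (q z)) \<partial>lborel)"
    by (intro nn_integral_mono ennreal_leI) simp
  also have "\<dots> < \<infinity>" using q by (simp add: integrable_iff_bounded)
  finally show "(\<integral>\<^sup>+y. ennreal (norm (h y)) \<partial>(lborel \<Otimes>\<^sub>M lborel)) < \<infinity>" .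
qed (rule h)

lemma nn_integral_norm_le_integral:
  assumes "integrable M g" "\<And>x. norm (f x) \<le> g x" 
  shows "(\<integral>\<^sup>+x. ennreal (norm (f x)) \<partial>M) \<le> ennreal (\<integral>x. g x \<partial>M)"
proof -
  have "(\<integral>\<^sup>+x. ennreal (norm (f x)) \<partial>M) \<le> (\<integral>\<^sup>+x. ennreal (g x) \<partial>M)"
    by (intro nn_integral_mono ennreal_leI assms)
  also have "\<dots> = ennreal (\<integral>x. g x \<partial>M)"
    using assms order_trans[OF norm_ge_zero assms(2)] by (intro nn_integral_eq_integral) auto
  finally show ?thesis .
qed

lemma Lp_borel_bounded_support:
  fixes g :: "'a::euclidean_space \<Rightarrow> 'b::euclidean_space"
  assumes "g \<in> borel_measurable borel" "\<And>x. norm (g x) \<le> B" "bounded S" "\<And>x. x \<notin> S \<Longrightarrow> g x = 0" "1 \<le> p"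
  shows "Lp_borel p g"
  unfolding Lp_borel_def
proof (intro conjI assms(1) integrable_bounded_support[OF _ _ assms(3)])
  show "(\<lambda>x. norm (g x) powr p) \<in> borel_measurable borel" using assms(1) by simp
  show "norm (norm (g x) powr p) \<le> B powr p" for x
    using assms by (auto intro!: powr_mono2)
  show "norm (g x) powr p = 0" if "x \<notin> S" for x using assms(4)[OF that] by simp
qed

lemma Lp_borel_test_functions: "1 \<le> p \<Longrightarrow> f \<in> test_functions S \<Longrightarrow> Lp_borel p f"
  for f :: "'a::euclidean_space \<Rightarrow> 'b::euclidean_space"
proof -
  assume p: "1 \<le> p" and f: "f \<in> test_functions S"
  obtain C where "compact C" "\<forall>x. x \<notin> C \<longrightarrow> f x = 0" using f by (auto simp: test_functions_iff)
  moreover obtain B where "\<And>x. norm (f x) \<le> B" using test_functions_bounded[OF f] by metis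
  ultimately show "Lp_borel p f" using test_functions_borel[OF f] p
    by (intro Lp_borel_bounded_support[of f B C]) (auto simp: compact_imp_bounded)
qed

lemma Lp_borel_mult_le:
  fixes f :: "'a::euclidean_space \<Rightarrow> 'b::euclidean_space" and g :: "'a \<Rightarrow> 'c::euclidean_space"
  assumes "norm (g x) \<le> B" "1 \<le> p" "0 < \<eta>"
  shows "norm (f x) * norm (g x) \<le> \<eta> * norm (g x) + \<eta> powr (1 - p) * B * norm (f x) powr p"
proof -
  have "norm (f x) * norm (g x) \<le> (\<eta> + \<eta> powr (1 - p) * norm (f x) powr p) * norm (g x)"
    using assms by (intro mult_right_mono le_scaled_powr) auto
  also have "\<dots> = \<eta> * norm (g x) + \<eta> powr (1 - p) * norm (f x) powr p * norm (g x)"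
    by (simp add: algebra_simps)
  also have "\<dots> \<le> \<eta> * norm (g x) + \<eta> powr (1 - p) * norm (f x) powr p * B"
    using assms by (intro add_left_mono mult_left_mono) auto
  finally show ?thesis by (simp add: mult_ac)
qed

lemma Lp_borel_integrable_mult:
  fixes f :: "'a::euclidean_space \<Rightarrow> 'b::euclidean_space" and g :: "'a \<Rightarrow> 'c::euclidean_space"
  assumes f: "Lp_borel p f" and g: "integrable lborel g" "\<And>x. norm (g x) \<le> B" and p: "1 \<le> p"
  shows "integrable lborel (\<lambda>x. norm (f x) * norm (g x))"
    and "0 < \<eta> \<Longrightarrow> (LBINT x. norm (f x) * norm (g x)) \<le> \<eta> * (LBINT x. norm (g x)) + \<eta> powr (1 - p) * B * Lp_pow p f"
proof -
  note [measurable] = Lp_borel_measurable[OF f] borel_measurable_integrable[OF g(1)]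
  have i: "integrable lborel (\<lambda>x. \<eta> * norm (g x) + \<eta> powr (1 - p) * B * norm (f x) powr p)" for \<eta>
    using f g by (auto simp: Lp_borel_def)
  have le: "norm (f x) * norm (g x) \<le> \<eta> * norm (g x) + \<eta> powr (1 - p) * B * norm (f x) powr p" if "\<eta> > 0" for x \<eta>
    by (rule Lp_borel_mult_le[of g x B p \<eta> f, OF g(2) p that])
  show i': "integrable lborel (\<lambda>x. norm (f x) * norm (g x))"
  proof (rule Bochner_Integration.integrable_bound[OF i[of 1]])
    show "AE x in lborel. norm (norm (f x) * norm (g x)) \<le> norm (1 * norm (g x) + 1 powr (1 - p) * B * norm (f x) powr p)"
    proof (rule AE_I2)
      fix x
      show "norm (norm (f x) * norm (g x)) \<le> norm (1 * norm (g x) + 1 powr (1 - p) * B * norm (f x) powr p)"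
        using le[of 1 x] by (simp add: abs_mult)
    qed
  qed measurable
  assume \<eta>: "0 < \<eta>"
  show "(LBINT x. norm (f x) * norm (g x)) \<le> \<eta> * (LBINT x. norm (g x)) + \<eta> powr (1 - p) * B * Lp_pow p f"
    using integral_mono[OF i' i le[OF \<eta>]] f g by (simp add: Lp_borel_def Lp_pow_def)
qed

lemma Lp_borel_integrable_inner:
  fixes f g :: "'a::euclidean_space \<Rightarrow> 'b::euclidean_space"
  assumes f: "Lp_borel p f" and g: "integrable lborel g" "\<And>x. norm (g x) \<le> B" and p: "1 \<le> p"
  shows "integrable lborel (\<lambda>x. f x \<bullet> g x)"
proof (rule Bochner_Integration.integrable_bound[OF Lp_borel_integrable_mult(1)[OF assms]])
  show "AE x in lborel. norm (f x \<bullet> g x) \<le> norm (norm (f x) * norm (g x))"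
    by (auto intro!: AE_I2 simp: Cauchy_Schwarz_ineq2 abs_mult)
qed (use Lp_borel_measurable[OF f] g in auto)

text \<open>The pointwise inequality with a free parameter \<open>\<eta>\<close> above stands in for Hoelder's inequality.\<close>

lemma Lp_borel_pairing_small:
  fixes g :: "'a::euclidean_space \<Rightarrow> 'b::euclidean_space"
  assumes g: "integrable lborel g" "\<And>x. norm (g x) \<le> B" and p: "1 \<le> p" and e: "0 < e"
  shows "\<exists>d>0. \<forall>f. Lp_borel p f \<longrightarrow> Lp_pow p f < d \<longrightarrow> \<bar>LBINT x. f x \<bullet> g x\<bar> < e"
proof -
  define I where "I = (LBINT x. norm (g x))"
  have I: "I \<ge> 0" unfolding I_def by (intro integral_nonneg_AE) auto
  have B: "B \<ge> 0" using order_trans[OF norm_ge_zero g(2)] .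
  \<comment> \<open>\<open>\<eta>\<close> bounds the term without \<open>f\<close> by
    \<open>e / 2\<close>; \<open>d\<close> below does the same for the term with
    \<open>Lp_pow p f\<close>. The added 1 guards against a zero denominator.\<close>
  define \<eta> where "\<eta> = e / (2 * (I + 1))"
  have \<eta>: "\<eta> > 0" using e I by (simp add: \<eta>_def)
  have "\<eta> * I \<le> \<eta> * (I + 1)" using \<eta> by simp
  also have "\<dots> = e / 2" using I by (simp add: \<eta>_def field_simps)
  finally have 1: "\<eta> * I \<le> e / 2" .
  define d where "d = e / (2 * (\<eta> powr (1 - p) * B + 1))"
  have c0: "\<eta> powr (1 - p) * B + 1 > 0" using B by (simp add: add_nonneg_pos)
  have d: "d > 0" using e c0 by (simp add: d_def)
  show ?thesis
  proof (intro exI[of _ d] conjI d allI impI)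
    fix f :: "'a \<Rightarrow> 'b" assume f: "Lp_borel p f" "Lp_pow p f < d"
    have "\<bar>LBINT x. f x \<bullet> g x\<bar> \<le> (LBINT x. norm (f x \<bullet> g x))"
      using integral_norm_bound[of lborel "\<lambda>x. f x \<bullet> g x"] by simp
    also have "\<dots> \<le> (LBINT x. norm (f x) * norm (g x))"
      by (intro integral_mono integrable_norm Lp_borel_integrable_inner[OF f(1) g p] Lp_borel_integrable_mult(1)[OF f(1) g p])
        (simp add: Cauchy_Schwarz_ineq2)
    also have "\<dots> \<le> \<eta> * I + \<eta> powr (1 - p) * B * Lp_pow p f"
      unfolding I_def by (rule Lp_borel_integrable_mult(2)[OF f(1) g p \<eta>])
    also have "\<dots> \<le> e / 2 + \<eta> powr (1 - p) * B * d"
      using 1 f B by (intro add_mono mult_left_mono) auto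
    also have "\<dots> < e / 2 + (\<eta> powr (1 - p) * B + 1) * d"
      using d by (simp add: algebra_simps)
    also have "(\<eta> powr (1 - p) * B + 1) * d = e / 2"
    proof -
      have "D * (e / (2 * D)) = e / 2" if "D > 0" for D using that by simp
      from this[OF c0] show ?thesis by (simp only: d_def)
    qed
    also have "e / 2 + e / 2 = e" by simp
    finally show "\<bar>LBINT x. f x \<bullet> g x\<bar> < e" .
  qed
qed

text \<open>Fubini, then \<open>z\<close> to \<open>- z\<close> and \<open>x\<close> to
  \<open>x - z\<close>, moves the kernel from \<open>\<psi>\<close> to \<open>u\<close>. The kernel
  may depend on \<open>x\<close> as well, for the sake of the Leibniz error term; \<open>q\<close>
  is even so that it dominates the integrand after the reflection too.\<close>

lemma fubini_swap:
  fixes u :: "'a::euclidean_space \<Rightarrow> real" and \<psi> :: "'a \<Rightarrow> 'a" and \<kappa> :: "'a \<times> 'a \<Rightarrow> 'a"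
  assumes p: "1 \<le> p" and u: "Lp_borel p u" and \<psi>: "\<psi> \<in> test_functions S"
    and \<kappa>: "\<kappa> \<in> borel_measurable borel" and q: "integrable lborel q" "\<And>z. q (- z) = q z"
    and le: "\<And>x z. norm (\<kappa> (x, z)) \<le> q z"
  shows "(LBINT x. u x * (LBINT z. \<psi> (x - z) \<bullet> \<kappa> (x, z))) =
         (LBINT x. (LBINT z. u (x - z) *\<^sub>R \<kappa> (x - z, - z)) \<bullet> \<psi> x)" (is ?eq)
    and "integrable lborel (\<lambda>x. u x * (LBINT z. \<psi> (x - z) \<bullet> \<kappa> (x, z)))" (is ?int)
proof -
  note \<psi>b = test_functions_borel[OF \<psi>]
  have [measurable]: "\<kappa> \<in> borel_measurable (borel \<Otimes>\<^sub>M borel)" using \<kappa> by (simp add: borel_prod)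
  note [measurable] = Lp_borel_measurable[OF u] \<psi>b borel_measurable_integrable[OF q(1)]
  obtain B where B: "\<And>x. norm (\<psi> x) \<le> B" using test_functions_bounded[OF \<psi>] by metis
  have \<psi>i: "integrable lborel \<psi>" using \<psi> by (rule test_functions_integrable)
  have q0: "q z \<ge> 0" for z using order_trans[OF norm_ge_zero le] .
  \<comment> \<open>\<open>A z\<close> is bounded uniformly in \<open>z\<close>, by translation
    invariance and the case \<open>\<eta> = 1\<close> of the pairing estimate, so integrability in
    \<open>z\<close> comes from \<open>q\<close>.\<close>
  define A where "A z = (LBINT x. norm (u x) * norm (\<psi> (x - z)))" for z
  define A0 where "A0 = (LBINT x. norm (\<psi> x)) + B * Lp_pow p u"
  have ii: "integrable lborel (\<lambda>x. \<bar>u x\<bar> * norm (\<psi> (x - z)))" for z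
    using Lp_borel_integrable_mult(1)[OF u _ B p, of "\<lambda>x. x - z"] Lp_borel_integrable_mult(1)[of p u "\<lambda>x. \<psi> (x - z)" B] u \<psi>i B p
    by (simp add: integrable_lborel_minus)
  have A: "A z \<le> A0" for z
    using Lp_borel_integrable_mult(2)[of p u "\<lambda>x. \<psi> (x - z)" B 1] u \<psi>i B p
      integral_lborel_minus[of "\<lambda>x. norm (\<psi> x)" z]
    by (simp add: integrable_lborel_minus A_def A0_def)
  define f where "f z x = u x * (\<psi> (x - z) \<bullet> \<kappa> (x, z))" for z x
  define g where "g z x = u (x - z) * (\<psi> x \<bullet> \<kappa> (x - z, - z))" for z x
  have fm: "case_prod f \<in> borel_measurable (lborel \<Otimes>\<^sub>M lborel)" unfolding f_def by measurable
  have gm: "case_prod g \<in> borel_measurable (lborel \<Otimes>\<^sub>M lborel)" unfolding g_def by measurable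
  have gf: "g z x = f (- z) (x - z)" for z x by (simp add: f_def g_def)
  have nf: "norm (f z x) \<le> q z * (\<bar>u x\<bar> * norm (\<psi> (x - z)))" for z x
  proof -
    have "\<bar>\<psi> (x - z) \<bullet> \<kappa> (x, z)\<bar> \<le> norm (\<psi> (x - z)) * q z"
      using Cauchy_Schwarz_ineq2[of "\<psi> (x - z)" "\<kappa> (x, z)"] mult_left_mono[OF le[of x z], of "norm (\<psi> (x - z))"] by simp
    then have "\<bar>u x\<bar> * \<bar>\<psi> (x - z) \<bullet> \<kappa> (x, z)\<bar> \<le> \<bar>u x\<bar> * (norm (\<psi> (x - z)) * q z)"
      by (rule mult_left_mono) simp
    then show ?thesis by (simp add: f_def abs_mult mult_ac)
  qed
  have nf': "(\<integral>\<^sup>+x. ennreal (norm (f z x)) \<partial>lborel) \<le> ennreal (A0 * q z)" for z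
  proof -
    have "(\<integral>\<^sup>+x. ennreal (norm (f z x)) \<partial>lborel) \<le> ennreal (LBINT x. q z * (\<bar>u x\<bar> * norm (\<psi> (x - z))))"
      by (intro nn_integral_norm_le_integral integrable_mult_right ii nf)
    also have "\<dots> = ennreal (q z * A z)" by (simp add: A_def)
    also have "\<dots> \<le> ennreal (A0 * q z)"
      using A q0 by (intro ennreal_leI) (simp add: mult.commute mult_right_mono)
    finally show ?thesis .
  qed
  have ng': "(\<integral>\<^sup>+x. ennreal (norm (g z x)) \<partial>lborel) \<le> ennreal (A0 * q z)" for z
  proof -
    have "(\<integral>\<^sup>+x. ennreal (norm (g z x)) \<partial>lborel) = (\<integral>\<^sup>+x. ennreal (norm (f (- z) x)) \<partial>lborel)"
      unfolding gf using measurable_compose[OF measurable_Pair1' fm, of "- z"]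
      by (intro nn_integral_lborel_minus[of "\<lambda>x. ennreal (norm (f (- z) x))"]) auto
    also have "\<dots> \<le> ennreal (A0 * q z)" using nf'[of "- z"] q(2) by simp
    finally show ?thesis .
  qed
  have fi: "integrable (lborel \<Otimes>\<^sub>M lborel) (case_prod f)"
    by (rule integrable_pairI[OF fm, where q="\<lambda>z. A0 * q z"]) (use q nf' in auto)
  have gi: "integrable (lborel \<Otimes>\<^sub>M lborel) (case_prod g)"
    by (rule integrable_pairI[OF gm, where q="\<lambda>z. A0 * q z"]) (use q ng' in auto)
  have "(LBINT x. u x * (LBINT z. \<psi> (x - z) \<bullet> \<kappa> (x, z))) = (LBINT x. (LBINT z. f z x))"
    by (simp add: f_def)
  also have "\<dots> = (LBINT z. (LBINT x. f z x))"
    by (rule lborel_pair.Fubini_integral[OF fi])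
  also have "\<dots> = (LBINT z. (LBINT x. f (- z) x))"
    using fm by (intro integral_lborel_uminus[symmetric]) simp
  also have "\<dots> = (LBINT z. (LBINT x. g z x))"
    unfolding gf using measurable_compose[OF measurable_Pair1' fm]
    by (intro Bochner_Integration.integral_cong refl integral_lborel_minus[symmetric]) auto
  also have "\<dots> = (LBINT x. (LBINT z. g z x))"
    by (rule lborel_pair.Fubini_integral[OF gi, symmetric])
  also have "\<dots> = (LBINT x. (LBINT z. u (x - z) *\<^sub>R \<kappa> (x - z, - z)) \<bullet> \<psi> x)"
  proof (rule integral_cong_AE)
    show "AE x in lborel. (LBINT z. g z x) = (LBINT z. u (x - z) *\<^sub>R \<kappa> (x - z, - z)) \<bullet> \<psi> x"
      using young(1)[OF u q(1) q0 p]
    proof eventually_elim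
      case (elim x)
      have "norm (u (x - z) *\<^sub>R \<kappa> (x - z, - z)) \<le> q z * norm (u (x - z))" for z
        using mult_left_mono[OF le[of "x - z" "- z"], of "\<bar>u (x - z)\<bar>"] q(2)[of z] by (simp add: mult.commute)
      then have "integrable lborel (\<lambda>z. u (x - z) *\<^sub>R \<kappa> (x - z, - z))"
        by (intro Bochner_Integration.integrable_bound[OF elim]) (auto intro!: AE_I2 order_trans[OF _ abs_ge_self])
      then show ?case unfolding g_def
        by (subst integral_inner_left[symmetric]) (auto simp: inner_commute)
    qed
  qed (use gm in measurable)
  finally show ?eq .
  show ?int using lborel_pair.integrable_snd[OF fi] by (simp add: f_def)
qed

section \<open>The singular kernel and weak gradients\<close>

lemma mult_divide_powr: "0 < (t::real) \<Longrightarrow> t * (t / t powr b) = t powr (2 - b)"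
  by (simp add: powr_diff power2_eq_square)

context nonlocal_setup
begin

definition K :: "real^'n \<Rightarrow> real^'n" where
  "K z = (cns TYPE('n) s * w z) *\<^sub>R (z /\<^sub>R norm z powr (real CARD('n) + s + 1))"

abbreviation k :: "real^'n \<Rightarrow> real^'n" where "k \<equiv> grad_R s w"

lemma w_borel: "w \<in> borel_measurable borel"
  by (rule test_functions_borel[OF w_test])

lemma K_borel: "K \<in> borel_measurable borel"
proof -
  note [measurable] = w_borel
  show ?thesis unfolding K_def[abs_def] by measurable
qed

lemma k_borel: "k \<in> borel_measurable borel"
proof -
  note [measurable] = w_borel
  show ?thesis unfolding grad_R_def[abs_def] by measurable
qed

lemma w_minus: "w (- z) = w z" by (rule w_radial) simp

lemma K_minus: "K (- z) = - K z"
  by (simp add: K_def w_minus)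

lemma k_minus: "k (- z) = - k z"
  by (simp add: grad_R_def w_minus)

text \<open>The support is compact in the open ball, which leaves a gap below \<delta>. The strict
  inequality is what makes gradients of functions on the shrunken domain vanish on an open set
  containing the complement of \<Omega>.\<close>

lemma w_support: obtains \<rho> where "0 < \<rho>" "\<rho> < \<delta>" "\<And>z. \<rho> \<le> norm z \<Longrightarrow> w z = 0"
proof -
  obtain C where C: "compact C" "C \<subseteq> ball 0 \<delta>" "\<And>x. x \<notin> C \<Longrightarrow> w x = 0"
    using w_test by (auto simp: test_functions_iff)
  have "\<exists>r<\<delta>. \<forall>x\<in>C. norm x \<le> r"
  proof (cases "C = {}")
    case True then show ?thesis using \<delta> by (intro exI[of _ 0]) auto
  next
    case False
    obtain x where "x \<in> C" "\<And>y. y \<in> C \<Longrightarrow> norm y \<le> norm x"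
      using continuous_attains_sup[OF C(1) False, of norm] by (auto intro: continuous_intros)
    then show ?thesis using C(2) by (intro exI[of _ "norm x"]) auto
  qed
  then obtain r where r: "r < \<delta>" "\<And>x. x \<in> C \<Longrightarrow> norm x \<le> r" by blast
  define \<rho> where "\<rho> = (max 0 r + \<delta>) / 2"
  have "0 < \<rho>" "\<rho> < \<delta>" and "r < \<rho>" using r \<delta> by (auto simp: \<rho>_def max_def)
  moreover have "w z = 0" if "\<rho> \<le> norm z" for z
    using r(2)[of z] C(3)[of z] that \<open>r < \<rho>\<close> by force
  ultimately show thesis using that by blast
qed

definition zK :: "real^'n \<Rightarrow> real" where "zK z = norm z * norm (K z)"

lemma zK_nonneg: "0 \<le> zK z" by (simp add: zK_def)
lemma zK_minus: "zK (- z) = zK z" by (simp add: zK_def K_minus)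

lemma zK_integrable: "integrable lborel zK"
proof (rule Bochner_Integration.integrable_bound)
  \<comment> \<open>\<open>|z| |K(z)|\<close> is of order \<open>|z| powr (- ?a)\<close>. This
    exponent \<open>?a\<close> is nonnegative because the dimension is at least 1, and below the
    dimension because \<open>s < 1\<close>.\<close>
  let ?a = "real CARD('n) + s - 1"
  have "1 \<le> CARD('n)" by simp
  then have n: "1 \<le> real CARD('n)" by linarith
  have "0 \<le> ?a" using n s(1) by linarith
  moreover have "?a < DIM(real^'n)" using s by simp
  ultimately show "integrable lborel (\<lambda>z::real^'n. \<bar>cns TYPE('n) s\<bar> * (indicat_real (ball 0 \<delta>) z * norm z powr (- ?a)))"
    by (intro integrable_mult_right integrable_norm_powr_inner \<delta>)
  show "zK \<in> borel_measurable lborel" using K_borel unfolding zK_def[abs_def] by simp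
  have "zK z \<le> \<bar>cns TYPE('n) s\<bar> * (indicat_real (ball 0 \<delta>) z * norm z powr (- ?a))" for z
  proof (cases "z = 0 \<or> \<delta> \<le> norm z")
    case True
    moreover have "w z = 0" if "\<delta> \<le> norm z"
      using w_test that unfolding test_functions_iff by force
    ultimately show ?thesis by (auto simp: zK_def K_def)
  next
    case False
    then have "norm z > 0" by simp
    then have 1: "norm z * (norm z / norm z powr (real CARD('n) + s + 1)) = norm z powr (- ?a)"
      using mult_divide_powr[of "norm z" "real CARD('n) + s + 1"] by (simp add: algebra_simps)
    have "zK z = \<bar>cns TYPE('n) s\<bar> * w z * (norm z * (norm z / norm z powr (real CARD('n) + s + 1)))"
      by (simp add: zK_def K_def abs_mult w_nonneg divide_inverse)
    also have "\<dots> \<le> \<bar>cns TYPE('n) s\<bar> * 1 * norm z powr (- ?a)"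
      unfolding 1 by (intro mult_right_mono mult_left_mono w_le_1) auto
    finally show ?thesis using False by simp
  qed
  then show "AE z in lborel. norm (zK z) \<le> norm (\<bar>cns TYPE('n) s\<bar> * (indicat_real (ball 0 \<delta>) z * norm z powr (- ?a)))"
    using zK_nonneg by (intro AE_I2) (auto simp: abs_of_nonneg)
qed

text \<open>\<open>1 - w\<close> removes a ball around the origin, and at infinity the decay
  \<open>|z|^(-n-s)\<close> is integrable because \<open>s > 0\<close>.\<close>

lemma k_integrable: "integrable lborel k"
proof -
  obtain b where b: "0 < b" "b < 1" "\<And>x. norm x < b * \<delta> \<Longrightarrow> w x = 1" using w_one by blast
  let ?a = "real CARD('n) + s"
  show ?thesis
  proof (rule Bochner_Integration.integrable_bound)
    show "integrable lborel (\<lambda>z::real^'n. \<bar>cns TYPE('n) s\<bar> * (indicat_real (- ball 0 (b * \<delta>)) z * norm z powr (- ?a)))"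
      using s \<delta> b by (intro integrable_mult_right integrable_norm_powr_outer) auto
    show "k \<in> borel_measurable lborel" using k_borel by simp
    have "norm (k z) \<le> \<bar>cns TYPE('n) s\<bar> * (indicat_real (- ball 0 (b * \<delta>)) z * norm z powr (- ?a))" for z
    proof (cases "norm z < b * \<delta>")
      case True then show ?thesis using b(3)[of z] by (simp add: grad_R_def)
    next
      case False
      moreover have "0 < b * \<delta>" using b \<delta> by simp
      ultimately have "norm z > 0" by linarith
      then have 1: "norm z / norm z powr (real CARD('n) + s + 1) = norm z powr (- ?a)"
        using powr_diff[of "norm z" 1 "real CARD('n) + s + 1"] by simp
      have "norm (k z) = \<bar>cns TYPE('n) s\<bar> * (1 - w z) * (norm z / norm z powr (real CARD('n) + s + 1))"
        using w_le_1[of z] by (simp add: grad_R_def abs_mult divide_inverse)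
      also have "\<dots> \<le> \<bar>cns TYPE('n) s\<bar> * 1 * norm z powr (- ?a)"
        unfolding 1 using w_nonneg[of z] by (intro mult_right_mono mult_left_mono) auto
      finally show ?thesis using False by simp
    qed
    then show "AE z in lborel. norm (k z) \<le> norm (\<bar>cns TYPE('n) s\<bar> * (indicat_real (- ball 0 (b * \<delta>)) z * norm z powr (- ?a)))"
      by (intro AE_I2) (metis abs_ge_self order_trans real_norm_def)
  qed
qed

lemma k_integral: "(LBINT z. k z) = 0"
proof -
  have "(LBINT z. k z) = (LBINT z. k (- z))"
    by (rule integral_lborel_uminus[symmetric, OF k_borel])
  then have "(LBINT z. k z) + (LBINT z. k z) = 0" by (simp add: k_minus)
  then have "2 *\<^sub>R (LBINT z. k z) = 0" by (simp only: scaleR_2)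
  then show ?thesis by simp
qed

text \<open>The substitution \<open>z = x - y\<close> turns the two divergences into integrals against \<open>K\<close>
  and \<open>K + k\<close>.\<close>

definition divK :: "(real^'n \<Rightarrow> real^'n) \<Rightarrow> real^'n \<Rightarrow> real" where
  "divK \<psi> x = (LBINT z. (\<psi> x - \<psi> (x - z)) \<bullet> K z)"

lemma nl_div_substitution:
  fixes \<omega> :: "real^'n \<Rightarrow> real" and \<psi> :: "real^'n \<Rightarrow> real^'n"
  assumes [measurable]: "\<omega> \<in> borel_measurable borel" "\<psi> \<in> borel_measurable borel"
  shows "nl_div s \<omega> \<psi> x =
    (LBINT z. (\<psi> x - \<psi> (x - z)) \<bullet> ((cns TYPE('n) s * \<omega> z) *\<^sub>R (z /\<^sub>R norm z powr (real CARD('n) + s + 1))))"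
proof -
  define F where "F z = (((\<psi> x - \<psi> (x - z)) /\<^sub>R norm z) \<bullet> (z /\<^sub>R norm z)) *
       (\<omega> z / norm z powr (real CARD('n) + s - 1))" for z
  have [measurable]: "F \<in> borel_measurable borel" unfolding F_def[abs_def] by measurable
  have "nl_div s \<omega> \<psi> x = cns TYPE('n) s * (\<integral>y. F (x - y) \<partial>lebesgue)"
    by (simp add: nl_div_def F_def)
  also have "(\<integral>y. F (x - y) \<partial>lebesgue) = (LBINT y. F (x - y))"
    by (rule integral_completion) measurable
  also have "\<dots> = (LBINT z. F z)" by (rule integral_lborel_reflect) measurable
  also have "cns TYPE('n) s * \<dots> = (LBINT z. cns TYPE('n) s * F z)" by simp
  also have "\<dots> = (LBINT z. (\<psi> x - \<psi> (x - z)) \<bullet> ((cns TYPE('n) s * \<omega> z) *\<^sub>R (z /\<^sub>R norm z powr (real CARD('n) + s + 1))))"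
  proof (intro Bochner_Integration.integral_cong refl)
    fix z
    show "cns TYPE('n) s * F z = (\<psi> x - \<psi> (x - z)) \<bullet> ((cns TYPE('n) s * \<omega> z) *\<^sub>R (z /\<^sub>R norm z powr (real CARD('n) + s + 1)))"
    proof (cases "z = 0")
      case False
      then have "norm z > 0" by simp
      then have "inverse (norm z) * inverse (norm z) / norm z powr (real CARD('n) + s - 1)
          = inverse (norm z powr (real CARD('n) + s + 1))"
        by (simp add: powr_diff powr_add field_simps)
      then show ?thesis
        by (simp add: F_def divide_inverse mult_ac)
    qed (simp add: F_def)
  qed
  finally show ?thesis .
qed

lemma nl_div_eq_divK: "\<psi> \<in> borel_measurable borel \<Longrightarrow> nl_div s w \<psi> x = divK \<psi> x"
  using nl_div_substitution[OF w_borel, of \<psi> x] by (simp add: divK_def K_def)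

text \<open>The Lipschitz factor \<open>|z|\<close> absorbs the singularity, uniformly in
  \<open>x\<close>. This majorant serves whenever a difference of a test function is integrated
  against \<open>K\<close>.\<close>

lemma test_difference_bound:
  fixes f :: "real^'n \<Rightarrow> 'b::euclidean_space"
  assumes f: "f \<in> test_functions S"
  obtains L where "L \<ge> 0" "\<And>x z. norm (f x - f (x - z)) * norm (K z) \<le> L * zK z"
proof -
  obtain L where L: "L \<ge> 0" "\<And>x y. norm (f x - f y) \<le> L * norm (x - y)"
    using test_functions_lipschitz[OF f] by metis
  have "norm (f x - f (x - z)) * norm (K z) \<le> L * zK z" for x z
    using mult_right_mono[OF L(2)[of x "x - z"], of "norm (K z)"] by (simp add: zK_def mult.assoc)
  with L(1) show thesis by (rule that)
qed

lemma divK_integrable: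
  assumes \<psi>: "\<psi> \<in> test_functions S"
  shows "integrable lborel (\<lambda>z. (\<psi> x - \<psi> (x - z)) \<bullet> K z)"
proof -
  obtain L where L: "L \<ge> 0" "\<And>x z. norm (\<psi> x - \<psi> (x - z)) * norm (K z) \<le> L * zK z"
    using test_difference_bound[OF \<psi>] by metis
  note [measurable] = test_functions_borel[OF \<psi>] K_borel
  show ?thesis
  proof (rule Bochner_Integration.integrable_bound)
    show "integrable lborel (\<lambda>z. L * zK z)" using zK_integrable by simp
    have "norm ((\<psi> x - \<psi> (x - z)) \<bullet> K z) \<le> norm (L * zK z)" for z
      using L(2)[of x z] Cauchy_Schwarz_ineq2[of "\<psi> x - \<psi> (x - z)" "K z"] by simp
    then show "AE z in lborel. norm ((\<psi> x - \<psi> (x - z)) \<bullet> K z) \<le> norm (L * zK z)" by simp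
  qed measurable
qed

lemma divK_bounded:
  assumes \<psi>: "\<psi> \<in> test_functions S"
  obtains B where "\<And>x. \<bar>divK \<psi> x\<bar> \<le> B"
proof -
  obtain L where L: "L \<ge> 0" "\<And>x z. norm (\<psi> x - \<psi> (x - z)) * norm (K z) \<le> L * zK z"
    using test_difference_bound[OF \<psi>] by metis
  have "\<bar>divK \<psi> x\<bar> \<le> (LBINT z. L * zK z)" for x
  proof -
    have "\<bar>divK \<psi> x\<bar> \<le> (LBINT z. norm ((\<psi> x - \<psi> (x - z)) \<bullet> K z))"
      unfolding divK_def using integral_norm_bound[of lborel "\<lambda>z. (\<psi> x - \<psi> (x - z)) \<bullet> K z"] by simp
    also have "\<dots> \<le> (LBINT z. L * zK z)"
    proof (rule integral_mono[OF integrable_norm[OF divK_integrable[OF \<psi>]]])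
      show "integrable lborel (\<lambda>z. L * zK z)" using zK_integrable by simp
      show "norm ((\<psi> x - \<psi> (x - z)) \<bullet> K z) \<le> L * zK z" for z
        using L(2)[of x z] Cauchy_Schwarz_ineq2[of "\<psi> x - \<psi> (x - z)" "K z"] by simp
    qed
    finally show ?thesis .
  qed
  then show thesis by (rule that)
qed

lemma divK_borel:
  assumes [measurable]: "\<psi> \<in> borel_measurable borel" shows "divK \<psi> \<in> borel_measurable borel"
proof -
  note [measurable] = K_borel
  have "(\<lambda>x. LBINT z. (\<psi> x - \<psi> (x - z)) \<bullet> K z) \<in> borel_measurable lborel" by measurable
  then show ?thesis by (simp add: divK_def[abs_def])
qed

lemma divK_eq_0:
  assumes "\<And>z. norm z < \<rho> \<Longrightarrow> \<psi> (x - z) = 0" "0 < \<rho>" "\<And>z. \<rho> \<le> norm z \<Longrightarrow> w z = 0"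
  shows "divK \<psi> x = 0"
proof -
  have "(\<psi> x - \<psi> (x - z)) \<bullet> K z = 0" for z
    using assms(1)[of 0] assms(1)[of z] assms(2) assms(3)[of z] by (cases "norm z < \<rho>") (auto simp: K_def)
  then show ?thesis by (simp add: divK_def)
qed

text \<open>The cut-off keeps the divergence compactly supported; being bounded as well, it can be
  paired with any \<open>L^p\<close> function.\<close>

lemma divK_integrable_lborel:
  assumes \<psi>: "\<psi> \<in> test_functions S"
  shows "integrable lborel (divK \<psi>)"
proof -
  obtain C where C: "compact C" "\<And>x. x \<notin> C \<Longrightarrow> \<psi> x = 0" using \<psi> by (auto simp: test_functions_iff)
  obtain B where B: "\<And>x. \<bar>divK \<psi> x\<bar> \<le> B" using divK_bounded[OF \<psi>] by metis
  obtain \<rho> where \<rho>: "0 < \<rho>" "\<rho> < \<delta>" "\<And>z. \<rho> \<le> norm z \<Longrightarrow> w z = 0" using w_support by metis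
  obtain R where R: "\<And>x. x \<in> C \<Longrightarrow> norm x \<le> R" using C(1) compact_imp_bounded[OF C(1)] by (auto simp: bounded_iff)
  have "divK \<psi> x = 0" if "x \<notin> cball 0 (R + \<rho>)" for x
  proof (rule divK_eq_0[OF _ \<rho>(1,3)])
    fix z :: "real^'n" assume "norm z < \<rho>"
    then have "norm (x - z) > R" using that norm_triangle_ineq2[of x z] by simp
    then show "\<psi> (x - z) = 0" using R C(2) by force
  qed
  then show ?thesis
    using divK_borel[OF test_functions_borel[OF \<psi>]] B
    by (intro integrable_bounded_support[of _ B "cball 0 (R + \<rho>)"]) auto
qed

lemma riesz_div_eq:
  assumes \<psi>: "\<psi> \<in> test_functions S"
  shows "riesz_div s \<psi> x = divK \<psi> x - (LBINT z. \<psi> (x - z) \<bullet> k z)"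
proof -
  note [measurable] = test_functions_borel[OF \<psi>] k_borel
  obtain B where B: "\<And>x. norm (\<psi> x) \<le> B" using test_functions_bounded[OF \<psi>] by metis
  have i: "integrable lborel (\<lambda>z. \<psi> (x - z) \<bullet> k z)"
  proof (rule Bochner_Integration.integrable_bound[of _ "\<lambda>z. B * norm (k z)"])
    have "norm (\<psi> (x - z) \<bullet> k z) \<le> norm (B * norm (k z))" for z
      using Cauchy_Schwarz_ineq2[of "\<psi> (x - z)" "k z"] mult_right_mono[OF B[of "x - z"] norm_ge_zero[of "k z"]] by simp
    then show "AE z in lborel. norm (\<psi> (x - z) \<bullet> k z) \<le> norm (B * norm (k z))" by simp
  qed (use k_integrable in auto)
  have i': "integrable lborel (\<lambda>z. \<psi> x \<bullet> k z)" using k_integrable by simp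
  have "riesz_div s \<psi> x = (LBINT z. (\<psi> x - \<psi> (x - z)) \<bullet> ((cns TYPE('n) s * 1) *\<^sub>R (z /\<^sub>R norm z powr (real CARD('n) + s + 1))))"
    unfolding riesz_div_def using test_functions_borel[OF \<psi>] by (intro nl_div_substitution) auto
  also have "\<dots> = (LBINT z. (\<psi> x - \<psi> (x - z)) \<bullet> K z + (\<psi> x \<bullet> k z - \<psi> (x - z) \<bullet> k z))"
  proof (intro Bochner_Integration.integral_cong refl)
    fix z
    have "(cns TYPE('n) s * 1) *\<^sub>R (z /\<^sub>R norm z powr (real CARD('n) + s + 1)) = K z + k z"
      unfolding K_def grad_R_def scaleR_left_distrib[symmetric] by (simp add: algebra_simps)
    then show "(\<psi> x - \<psi> (x - z)) \<bullet> ((cns TYPE('n) s * 1) *\<^sub>R (z /\<^sub>R norm z powr (real CARD('n) + s + 1)))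
       = (\<psi> x - \<psi> (x - z)) \<bullet> K z + (\<psi> x \<bullet> k z - \<psi> (x - z) \<bullet> k z)"
      by (simp add: inner_add_right inner_diff_left)
  qed
  also have "\<dots> = divK \<psi> x + ((LBINT z. \<psi> x \<bullet> k z) - (LBINT z. \<psi> (x - z) \<bullet> k z))"
    unfolding divK_def using divK_integrable[OF \<psi>, of x] i i' by simp
  \<comment> \<open>Oddness of \<open>k\<close> removes the term with \<open>\<psi> x\<close>, and a
    plain convolution remains.\<close>
  also have "(LBINT z. \<psi> x \<bullet> k z) = 0" using k_integrable k_integral by simp
  finally show ?thesis by simp
qed

text \<open>The common form of both gradients: Borel representatives on the whole space,
  \<open>L^p\<close> membership included, and tests that are not restricted to \<Omega>.\<close>

definition weak_grad :: "(real^'n \<Rightarrow> real) \<Rightarrow> (real^'n \<Rightarrow> real^'n) \<Rightarrow> bool" where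
  "weak_grad u v \<longleftrightarrow> Lp_borel p u \<and> Lp_borel p v \<and>
     (\<forall>\<psi>\<in>test_functions UNIV. (LBINT x. v x \<bullet> \<psi> x) = - (LBINT x. u x * divK \<psi> x))"

lemma weak_grad_LB: "weak_grad u v \<Longrightarrow> Lp_borel p u" "weak_grad u v \<Longrightarrow> Lp_borel p v" by (auto simp: weak_grad_def)

lemma weak_grad_test:
  "weak_grad u v \<Longrightarrow> \<psi> \<in> test_functions S \<Longrightarrow> (LBINT x. v x \<bullet> \<psi> x) = - (LBINT x. u x * divK \<psi> x)"
  using test_functions_mono[of S UNIV] by (auto simp: weak_grad_def)

lemma pairing_integrable:
  assumes "Lp_borel p u" "Lp_borel p v" "\<psi> \<in> test_functions S"
  shows "integrable lborel (\<lambda>x. v x \<bullet> \<psi> x)" "integrable lborel (\<lambda>x. u x * divK \<psi> x)"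
proof -
  obtain B where B: "\<And>x. norm (\<psi> x) \<le> B" using test_functions_bounded[OF assms(3)] by metis
  show "integrable lborel (\<lambda>x. v x \<bullet> \<psi> x)"
    by (rule Lp_borel_integrable_inner[OF assms(2) test_functions_integrable[OF assms(3)] B p])
  obtain B' where B': "\<And>x. \<bar>divK \<psi> x\<bar> \<le> B'" using divK_bounded[OF assms(3)] by metis
  show "integrable lborel (\<lambda>x. u x * divK \<psi> x)"
    using Lp_borel_integrable_inner[OF assms(1) divK_integrable_lborel[OF assms(3)] _ p, of B'] B' by simp
qed

lemma weak_grad_add:
  assumes "weak_grad u v" "weak_grad u' v'"
  shows "weak_grad (\<lambda>x. u x + u' x) (\<lambda>x. v x + v' x)"
  unfolding weak_grad_def
proof (intro conjI ballI)
  note L = weak_grad_LB[OF assms(1)] weak_grad_LB[OF assms(2)]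
  show "Lp_borel p (\<lambda>x. u x + u' x)" "Lp_borel p (\<lambda>x. v x + v' x)" using L p by (auto intro: Lp_borel_add)
  fix \<psi> :: "real^'n \<Rightarrow> real^'n" assume \<psi>: "\<psi> \<in> test_functions UNIV"
  note i = pairing_integrable[OF L(1,2) \<psi>] pairing_integrable[OF L(3,4) \<psi>]
  show "(LBINT x. (v x + v' x) \<bullet> \<psi> x) = - (LBINT x. (u x + u' x) * divK \<psi> x)"
    using weak_grad_test[OF assms(1) \<psi>] weak_grad_test[OF assms(2) \<psi>] i by (simp add: inner_add_left distrib_right)
qed

lemma weak_grad_uminus: "weak_grad u v \<Longrightarrow> weak_grad (\<lambda>x. - u x) (\<lambda>x. - v x)"
  by (auto simp: weak_grad_def Lp_borel_uminus)

lemma weak_grad_diff: "weak_grad u v \<Longrightarrow> weak_grad u' v' \<Longrightarrow> weak_grad (\<lambda>x. u x - u' x) (\<lambda>x. v x - v' x)"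
  using weak_grad_add[OF _ weak_grad_uminus, of u v u' v'] by simp

text \<open>The weak gradient is closed: both sides of the identity are continuous in
  \<open>L^p\<close>, being pairings with bounded integrable functions. Needed for elements of
  \<open>H_nl_0\<close>, which are given as limits.\<close>

lemma weak_grad_limit:
  assumes L: "Lp_borel p u" "Lp_borel p v"
    and lim: "\<And>e. 0 < e \<Longrightarrow> \<exists>u' v'. weak_grad u' v' \<and> Lp_pow p (\<lambda>x. u x - u' x) < e \<and> Lp_pow p (\<lambda>x. v x - v' x) < e"
  shows "weak_grad u v"
  unfolding weak_grad_def
proof (intro conjI L ballI)
  fix \<psi> :: "real^'n \<Rightarrow> real^'n" assume \<psi>: "\<psi> \<in> test_functions UNIV"
  obtain B where B: "\<And>x. norm (\<psi> x) \<le> B" using test_functions_bounded[OF \<psi>] by metis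
  obtain B' where B': "\<And>x. \<bar>divK \<psi> x\<bar> \<le> B'" using divK_bounded[OF \<psi>] by metis
  let ?D = "\<bar>(LBINT x. v x \<bullet> \<psi> x) + (LBINT x. u x * divK \<psi> x)\<bar>"
  have "?D \<le> e" if e: "e > 0" for e
  proof -
    obtain d1 where d1: "d1 > 0" "\<And>f. Lp_borel p f \<Longrightarrow> Lp_pow p f < d1 \<Longrightarrow> \<bar>LBINT x. f x \<bullet> \<psi> x\<bar> < e / 2"
      using Lp_borel_pairing_small[OF test_functions_integrable[OF \<psi>] B p, of "e/2"] e by auto
    obtain d2 where d2: "d2 > 0" "\<And>f. Lp_borel p f \<Longrightarrow> Lp_pow p f < d2 \<Longrightarrow> \<bar>LBINT x. f x * divK \<psi> x\<bar> < e / 2"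
      using Lp_borel_pairing_small[OF divK_integrable_lborel[OF \<psi>] _ p, of B' "e/2"] e B' by auto
    obtain u' v' where u': "weak_grad u' v'" "Lp_pow p (\<lambda>x. u x - u' x) < min d1 d2" "Lp_pow p (\<lambda>x. v x - v' x) < min d1 d2"
      using lim[of "min d1 d2"] d1 d2 by auto
    note L' = weak_grad_LB[OF u'(1)]
    have p0: "0 \<le> p" using p by simp
    note i = pairing_integrable[OF L \<psi>] pairing_integrable[OF L' \<psi>]
    have a: "\<bar>LBINT x. (v x - v' x) \<bullet> \<psi> x\<bar> < e / 2" 
      by (rule d1(2)[OF Lp_borel_diff(1)[OF L(2) L'(2) p0]]) (use u' in simp)
    have b: "\<bar>LBINT x. (u x - u' x) * divK \<psi> x\<bar> < e / 2"
      by (rule d2(2)[OF Lp_borel_diff(1)[OF L(1) L'(1) p0]]) (use u' in simp)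
    have "(LBINT x. (v x - v' x) \<bullet> \<psi> x) = (LBINT x. v x \<bullet> \<psi> x) - (LBINT x. v' x \<bullet> \<psi> x)"
      "(LBINT x. (u x - u' x) * divK \<psi> x) = (LBINT x. u x * divK \<psi> x) - (LBINT x. u' x * divK \<psi> x)"
      using i by (simp_all add: inner_diff_left left_diff_distrib)
    with a b weak_grad_test[OF u'(1) \<psi>] show ?thesis by linarith
  qed
  then have "?D \<le> 0" by (rule field_le_epsilon) simp
  then show "(LBINT x. v x \<bullet> \<psi> x) = - (LBINT x. u x * divK \<psi> x)" by linarith
qed

end

section \<open>Calculus of weak gradients\<close>

context nonlocal_setup
begin

text \<open>The gradient as an absolutely convergent integral, available for test functions because
  the difference compensates the singularity.\<close>

definition gradK :: "(real^'n \<Rightarrow> real) \<Rightarrow> real^'n \<Rightarrow> real^'n" where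
  "gradK \<phi> x = (LBINT z. (\<phi> x - \<phi> (x - z)) *\<^sub>R K z)"

lemma gradK_integrable:
  fixes \<phi> :: "real^'n \<Rightarrow> real"
  assumes \<phi>: "\<phi> \<in> test_functions S"
  shows "integrable lborel (\<lambda>z. (\<phi> x - \<phi> (x - z)) *\<^sub>R K z)"
proof -
  obtain L where L: "L \<ge> 0" "\<And>x z. norm (\<phi> x - \<phi> (x - z)) * norm (K z) \<le> L * zK z"
    using test_difference_bound[OF \<phi>] by metis
  note [measurable] = test_functions_borel[OF \<phi>] K_borel
  show ?thesis
  proof (rule Bochner_Integration.integrable_bound)
    show "integrable lborel (\<lambda>z. L * zK z)" using zK_integrable by simp
    have "norm ((\<phi> x - \<phi> (x - z)) *\<^sub>R K z) \<le> norm (L * zK z)" for z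
      using L(2)[of x z] by simp
    then show "AE z in lborel. norm ((\<phi> x - \<phi> (x - z)) *\<^sub>R K z) \<le> norm (L * zK z)" by simp
  qed measurable
qed

lemma gradK_add:
  assumes "\<phi> \<in> test_functions S" "\<phi>' \<in> test_functions S"
  shows "gradK (\<lambda>x. \<phi> x + \<phi>' x) x = gradK \<phi> x + gradK \<phi>' x"
proof -
  have "gradK (\<lambda>x. \<phi> x + \<phi>' x) x = (LBINT z. (\<phi> x - \<phi> (x - z)) *\<^sub>R K z + (\<phi>' x - \<phi>' (x - z)) *\<^sub>R K z)"
    unfolding gradK_def by (intro Bochner_Integration.integral_cong refl) (simp add: algebra_simps)
  then show ?thesis
    using gradK_integrable[OF assms(1)] gradK_integrable[OF assms(2)] by (simp add: gradK_def)
qed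

lemma gradK_borel:
  assumes [measurable]: "\<phi> \<in> borel_measurable borel" shows "gradK \<phi> \<in> borel_measurable borel"
proof -
  note [measurable] = K_borel
  have "(\<lambda>x. LBINT z. (\<phi> x - \<phi> (x - z)) *\<^sub>R K z) \<in> borel_measurable lborel" by measurable
  then show ?thesis by (simp add: gradK_def[abs_def])
qed

lemma gradK_eq_0:
  assumes "\<And>z. norm z < \<rho> \<Longrightarrow> \<phi> (x - z) = 0" "0 < \<rho>" "\<And>z. \<rho> \<le> norm z \<Longrightarrow> w z = 0"
  shows "gradK \<phi> x = 0"
proof -
  have "(\<phi> x - \<phi> (x - z)) *\<^sub>R K z = 0" for z
    using assms(1)[of 0] assms(1)[of z] assms(2) assms(3)[of z] by (cases "norm z < \<rho>") (auto simp: K_def)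
  then have "(\<lambda>z. (\<phi> x - \<phi> (x - z)) *\<^sub>R K z) = (\<lambda>_. 0)" by (rule ext)
  then show ?thesis by (simp only: gradK_def) simp
qed

lemma gradK_LB:
  fixes \<phi> :: "real^'n \<Rightarrow> real"
  assumes \<phi>: "\<phi> \<in> test_functions S"
  shows "Lp_borel p (gradK \<phi>)"
proof -
  obtain C where C: "compact C" "\<And>x. x \<notin> C \<Longrightarrow> \<phi> x = 0" using \<phi> by (auto simp: test_functions_iff)
  obtain L where L: "L \<ge> 0" "\<And>x z. norm (\<phi> x - \<phi> (x - z)) * norm (K z) \<le> L * zK z"
    using test_difference_bound[OF \<phi>] by metis
  obtain \<rho> where \<rho>: "0 < \<rho>" "\<rho> < \<delta>" "\<And>z. \<rho> \<le> norm z \<Longrightarrow> w z = 0" using w_support by metis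
  obtain R where R: "\<And>x. x \<in> C \<Longrightarrow> norm x \<le> R" using compact_imp_bounded[OF C(1)] by (auto simp: bounded_iff)
  have 0: "gradK \<phi> x = 0" if "x \<notin> cball 0 (R + \<rho>)" for x
  proof (rule gradK_eq_0[OF _ \<rho>(1,3)])
    fix z :: "real^'n" assume "norm z < \<rho>"
    then have "norm (x - z) > R" using that norm_triangle_ineq2[of x z] by simp
    then show "\<phi> (x - z) = 0" using R C(2) by force
  qed
  have B: "norm (gradK \<phi> x) \<le> (LBINT z. L * zK z)" for x
  proof -
    have "norm (gradK \<phi> x) \<le> (LBINT z. norm ((\<phi> x - \<phi> (x - z)) *\<^sub>R K z))"
      unfolding gradK_def by (rule integral_norm_bound)
    also have "\<dots> \<le> (LBINT z. L * zK z)"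
    proof (rule integral_mono[OF integrable_norm[OF gradK_integrable[OF \<phi>]]])
      show "integrable lborel (\<lambda>z. L * zK z)" using zK_integrable by simp
      show "norm ((\<phi> x - \<phi> (x - z)) *\<^sub>R K z) \<le> L * zK z" for z using L(2)[of x z] by simp
    qed
    finally show ?thesis .
  qed
  show ?thesis
    by (rule Lp_borel_bounded_support[OF gradK_borel[OF test_functions_borel[OF \<phi>]] B bounded_cball 0 p])
qed

text \<open>Nonlocal integration by parts: for fixed \<open>z\<close> translate \<open>x\<close>,
  then use that \<open>K\<close> is odd. Under the integral in \<open>z\<close> a difference, first
  of \<psi> and then of \<phi>, is kept throughout, because the separate terms need not be
  integrable near \<open>z = 0\<close>.\<close>

lemma weak_grad_test_function:
  fixes \<phi> :: "real^'n \<Rightarrow> real"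
  assumes \<phi>: "\<phi> \<in> test_functions S"
  shows "weak_grad \<phi> (gradK \<phi>)"
  unfolding weak_grad_def
proof (intro conjI ballI Lp_borel_test_functions[OF p \<phi>] gradK_LB[OF \<phi>])
  fix \<psi> :: "real^'n \<Rightarrow> real^'n" assume \<psi>: "\<psi> \<in> test_functions UNIV"
  note [measurable] = test_functions_borel[OF \<phi>] test_functions_borel[OF \<psi>] K_borel
  have \<phi>i: "integrable lborel \<phi>" by (rule test_functions_integrable[OF \<phi>])
  have \<psi>i: "integrable lborel \<psi>" by (rule test_functions_integrable[OF \<psi>])
  obtain B where B: "\<And>x. norm (\<psi> x) \<le> B" using test_functions_bounded[OF \<psi>] by metis
  obtain L where L: "L \<ge> 0" "\<And>x z. norm (\<phi> x - \<phi> (x - z)) * norm (K z) \<le> L * zK z"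
    using test_difference_bound[OF \<phi>] by metis
  obtain M where M: "M \<ge> 0" "\<And>x z. norm (\<psi> x - \<psi> (x - z)) * norm (K z) \<le> M * zK z"
    using test_difference_bound[OF \<psi>] by metis
  define f where "f z x = \<phi> x * ((\<psi> x - \<psi> (x - z)) \<bullet> K z)" for z x
  define g where "g z x = (\<phi> x - \<phi> (x - z)) * (\<psi> x \<bullet> K z)" for z x
  have fm: "case_prod f \<in> borel_measurable (lborel \<Otimes>\<^sub>M lborel)" unfolding f_def by measurable
  have gm: "case_prod g \<in> borel_measurable (lborel \<Otimes>\<^sub>M lborel)" unfolding g_def by measurable
  have "norm (f z x) \<le> (M * zK z) * norm (\<phi> x)" for z x
  proof -
    have "\<bar>(\<psi> x - \<psi> (x - z)) \<bullet> K z\<bar> \<le> M * zK z"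
      using Cauchy_Schwarz_ineq2[of "\<psi> x - \<psi> (x - z)" "K z"] M(2)[of x z] by simp
    from mult_left_mono[OF this, of "\<bar>\<phi> x\<bar>"] show ?thesis by (simp add: f_def abs_mult mult_ac)
  qed
  then have "(\<integral>\<^sup>+x. ennreal (norm (f z x)) \<partial>lborel) \<le> ennreal (LBINT x. (M * zK z) * norm (\<phi> x))" for z
    using \<phi>i by (intro nn_integral_norm_le_integral integrable_mult_right integrable_norm) auto
  then have fi: "integrable (lborel \<Otimes>\<^sub>M lborel) (case_prod f)"
    using zK_integrable by (intro integrable_pairI[OF fm, where q="\<lambda>z. (LBINT x. (M * zK z) * norm (\<phi> x))"]) auto
  have "norm (g z x) \<le> (L * zK z) * norm (\<psi> x)" for z x
  proof -
    have "\<bar>\<psi> x \<bullet> K z\<bar> \<le> norm (\<psi> x) * norm (K z)" by (rule Cauchy_Schwarz_ineq2)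
    then have "\<bar>\<phi> x - \<phi> (x - z)\<bar> * \<bar>\<psi> x \<bullet> K z\<bar> \<le> \<bar>\<phi> x - \<phi> (x - z)\<bar> * (norm (\<psi> x) * norm (K z))"
      by (rule mult_left_mono) simp
    also have "\<dots> = (norm (\<phi> x - \<phi> (x - z)) * norm (K z)) * norm (\<psi> x)" by simp
    also have "\<dots> \<le> (L * zK z) * norm (\<psi> x)" by (intro mult_right_mono L(2)) simp
    finally show ?thesis by (simp add: g_def abs_mult)
  qed
  then have "(\<integral>\<^sup>+x. ennreal (norm (g z x)) \<partial>lborel) \<le> ennreal (LBINT x. (L * zK z) * norm (\<psi> x))" for z
    using \<psi>i by (intro nn_integral_norm_le_integral integrable_mult_right integrable_norm) auto
  then have gi: "integrable (lborel \<Otimes>\<^sub>M lborel) (case_prod g)"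
    using zK_integrable by (intro integrable_pairI[OF gm, where q="\<lambda>z. (LBINT x. (L * zK z) * norm (\<psi> x))"]) auto
  \<comment> \<open>For fixed \<open>z\<close> the vector \<open>K z\<close> is a constant, so here
    the difference may be split.\<close>
  have shift: "(LBINT x. f z x) = (LBINT x. - g (- z) x)" for z
  proof -
    have b: "norm (\<psi> x \<bullet> K z) \<le> B * norm (K z)" for x
      using Cauchy_Schwarz_ineq2[of "\<psi> x" "K z"] mult_right_mono[OF B[of x] norm_ge_zero[of "K z"]] by simp
    have i1: "integrable lborel (\<lambda>x. \<phi> x * (\<psi> x \<bullet> K z))" 
      using integrable_mult_bounded[OF \<phi>i _ b] by simp
    have i2: "integrable lborel (\<lambda>x. \<phi> x * (\<psi> (x - z) \<bullet> K z))"
      using integrable_mult_bounded[OF \<phi>i, of "\<lambda>x. \<psi> (x - z) \<bullet> K z" "B * norm (K z)"] b by simp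
    have i3: "integrable lborel (\<lambda>x. \<phi> (x + z) * (\<psi> x \<bullet> K z))"
      using integrable_lborel_plus[of "\<lambda>x. \<phi> x * (\<psi> (x - z) \<bullet> K z)" z] i2 by simp
    have "(LBINT x. f z x) = (LBINT x. \<phi> x * (\<psi> x \<bullet> K z)) - (LBINT x. \<phi> x * (\<psi> (x - z) \<bullet> K z))"
      using i1 i2 by (simp add: f_def inner_diff_left right_diff_distrib)
    also have "(LBINT x. \<phi> x * (\<psi> (x - z) \<bullet> K z)) = (LBINT x. \<phi> (x + z) * (\<psi> x \<bullet> K z))"
      using integral_lborel_plus[of "\<lambda>x. \<phi> x * (\<psi> (x - z) \<bullet> K z)" z] by simp
    also have "(LBINT x. \<phi> x * (\<psi> x \<bullet> K z)) - (LBINT x. \<phi> (x + z) * (\<psi> x \<bullet> K z))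
        = (LBINT x. - g (- z) x)"
      using i1 i3 by (simp add: g_def K_minus left_diff_distrib)
    finally show ?thesis .
  qed
  have "(LBINT x. \<phi> x * divK \<psi> x) = (LBINT x. (LBINT z. f z x))"
    by (simp add: f_def divK_def)
  also have "\<dots> = (LBINT z. (LBINT x. f z x))"
    by (rule lborel_pair.Fubini_integral[OF fi])
  also have "\<dots> = (LBINT z. - (LBINT x. g (- z) x))" by (simp add: shift)
  also have "\<dots> = - (LBINT z. (LBINT x. g (- z) x))" by simp
  also have "(LBINT z. (LBINT x. g (- z) x)) = (LBINT z. (LBINT x. g z x))"
    using gm by (intro integral_lborel_uminus) simp
  also have "\<dots> = (LBINT x. (LBINT z. g z x))"
    by (rule lborel_pair.Fubini_integral[OF gi, symmetric])
  also have "\<dots> = (LBINT x. gradK \<phi> x \<bullet> \<psi> x)"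
  proof (intro Bochner_Integration.integral_cong refl)
    fix x
    have "(LBINT z. g z x) = (LBINT z. ((\<phi> x - \<phi> (x - z)) *\<^sub>R K z) \<bullet> \<psi> x)"
      by (simp add: g_def inner_commute)
    also have "\<dots> = gradK \<phi> x \<bullet> \<psi> x"
      unfolding gradK_def by (rule integral_inner_left) (rule gradK_integrable[OF \<phi>])
    finally show "(LBINT z. g z x) = gradK \<phi> x \<bullet> \<psi> x" .
  qed
  finally show "(LBINT x. gradK \<phi> x \<bullet> \<psi> x) = - (LBINT x. \<phi> x * divK \<psi> x)" by simp
qed

section \<open>Convolution with \<open>k\<close>, the Leibniz rule and mollified gradients\<close>

definition convk :: "(real^'n \<Rightarrow> real) \<Rightarrow> real^'n \<Rightarrow> real^'n" where
  "convk u x = (LBINT z. u (x - z) *\<^sub>R k z)"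

text \<open>Young's inequality with a kernel that may depend on \<open>x\<close>. With
  \<open>k\<close> it bounds the difference of the two gradients, with a difference of a bump times
  \<open>K\<close> it bounds the Leibniz error.\<close>

lemma Lp_borel_convolution:
  fixes u :: "real^'n \<Rightarrow> real" and \<kappa> :: "(real^'n) \<times> (real^'n) \<Rightarrow> real^'n"
  assumes u: "Lp_borel p u" and r: "integrable lborel r" 
    and \<kappa>: "\<kappa> \<in> borel_measurable borel" "\<And>x z. norm (\<kappa> (x, z)) \<le> r z"
  shows "Lp_borel p (\<lambda>x. LBINT z. u (x - z) *\<^sub>R \<kappa> (x, z))"
    and "Lp_pow p (\<lambda>x. LBINT z. u (x - z) *\<^sub>R \<kappa> (x, z)) \<le> (LBINT z. r z) powr p * Lp_pow p u"
proof -
  have [measurable]: "\<kappa> \<in> borel_measurable (borel \<Otimes>\<^sub>M borel)" using \<kappa>(1) by (simp add: borel_prod)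
  note [measurable] = Lp_borel_measurable[OF u]
  have r0: "0 \<le> r z" for z using order_trans[OF norm_ge_zero \<kappa>(2)] .
  note y = young[OF u r r0 p]
  have m: "(\<lambda>x. LBINT z. u (x - z) *\<^sub>R \<kappa> (x, z)) \<in> borel_measurable borel"
  proof -
    have "(\<lambda>x. LBINT z. u (x - z) *\<^sub>R \<kappa> (x, z)) \<in> borel_measurable lborel" by measurable
    then show ?thesis by simp
  qed
  have ae: "AE x in lborel. norm (LBINT z. u (x - z) *\<^sub>R \<kappa> (x, z)) \<le> 1 * (LBINT z. r z * norm (u (x - z)))"
    using y(1)
  proof eventually_elim
    case (elim x)
    have le: "norm (u (x - z) *\<^sub>R \<kappa> (x, z)) \<le> r z * norm (u (x - z))" for z
      using mult_left_mono[OF \<kappa>(2)[of x z], of "\<bar>u (x - z)\<bar>"] by (simp add: mult.commute)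
    have "norm (LBINT z. u (x - z) *\<^sub>R \<kappa> (x, z)) \<le> (LBINT z. norm (u (x - z) *\<^sub>R \<kappa> (x, z)))"
      by (rule integral_norm_bound)
    also have "\<dots> \<le> (LBINT z. r z * norm (u (x - z)))"
    proof (rule integral_mono[OF _ elim le])
      show "integrable lborel (\<lambda>z. norm (u (x - z) *\<^sub>R \<kappa> (x, z)))"
        by (rule Bochner_Integration.integrable_bound[OF elim])
          (use le r0 in \<open>auto intro!: AE_I2 simp: abs_mult\<close>)
    qed
    finally show ?case by simp
  qed
  have nn: "0 \<le> (LBINT z. r z * norm (u (x - z)))" for x
    using r0 by (intro integral_nonneg_AE) auto
  note d = Lp_borel_dominated[OF m y(2) ae nn]
  show "Lp_borel p (\<lambda>x. LBINT z. u (x - z) *\<^sub>R \<kappa> (x, z))" by (rule d(1)) (use p in auto)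
  have "Lp_pow p (\<lambda>x. LBINT z. u (x - z) *\<^sub>R \<kappa> (x, z)) \<le> 1 powr p * (LBINT x. (LBINT z. r z * norm (u (x - z))) powr p)"
    by (rule d(2)) (use p in auto)
  then show "Lp_pow p (\<lambda>x. LBINT z. u (x - z) *\<^sub>R \<kappa> (x, z)) \<le> (LBINT z. r z) powr p * Lp_pow p u"
    using y(3) by simp
qed

lemma k_prod_borel: "(\<lambda>(x, z). k z) \<in> borel_measurable (borel :: ((real^'n) \<times> (real^'n)) measure)"
proof -
  note [measurable] = k_borel
  have "(\<lambda>(x, z). k z) \<in> borel_measurable ((borel :: (real^'n) measure) \<Otimes>\<^sub>M (borel :: (real^'n) measure))" by measurable
  then show ?thesis by (simp add: borel_prod)
qed

lemma
  assumes u: "Lp_borel p u"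
  shows convk_LB: "Lp_borel p (convk u)" and convk_pn: "Lp_pow p (convk u) \<le> (LBINT z. norm (k z)) powr p * Lp_pow p u"
  using Lp_borel_convolution[OF u integrable_norm[OF k_integrable] k_prod_borel] by (auto simp: convk_def[abs_def])

text \<open>The divergences differ by the convolution of \<open>\<psi>\<close> with
  \<open>k\<close>. Moving \<open>k\<close> over to \<open>u\<close> costs a sign because
  \<open>k\<close> is odd, and the term joins \<open>v\<close>.\<close>

lemma riesz_iff_weak_grad:
  assumes u: "Lp_borel p u" and v: "Lp_borel p v"
  shows "(\<forall>\<psi>\<in>test_functions UNIV. (LBINT x. v x \<bullet> \<psi> x) = - (LBINT x. u x * riesz_div s \<psi> x))
    \<longleftrightarrow> weak_grad u (\<lambda>x. v x + convk u x)"
proof -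
  have "((LBINT x. v x \<bullet> \<psi> x) = - (LBINT x. u x * riesz_div s \<psi> x)) \<longleftrightarrow>
      ((LBINT x. (v x + convk u x) \<bullet> \<psi> x) = - (LBINT x. u x * divK \<psi> x))"
    if \<psi>: "\<psi> \<in> test_functions UNIV" for \<psi> :: "real^'n \<Rightarrow> real^'n"
  proof -
    have "norm (k (- z)) = norm (k z)" for z by (simp add: k_minus)
    note f = fubini_swap[OF p u \<psi> k_prod_borel integrable_norm[OF k_integrable] this, simplified]
    have "(LBINT x. u x * riesz_div s \<psi> x)
       = (LBINT x. u x * divK \<psi> x - u x * (LBINT z. \<psi> (x - z) \<bullet> k z))"
      by (simp add: riesz_div_eq[OF \<psi>] right_diff_distrib)
    also have "\<dots> = (LBINT x. u x * divK \<psi> x) - (LBINT x. u x * (LBINT z. \<psi> (x - z) \<bullet> k z))"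
      using pairing_integrable(2)[OF u v \<psi>] f(2) by (intro Bochner_Integration.integral_diff)
    also have "(LBINT x. u x * (LBINT z. \<psi> (x - z) \<bullet> k z)) = - (LBINT x. convk u x \<bullet> \<psi> x)"
      using f(1) by (simp add: convk_def k_minus)
    finally show ?thesis
      using pairing_integrable(1)[OF u v \<psi>] pairing_integrable(1)[OF u convk_LB[OF u] \<psi>]
      by (auto simp: inner_add_left)
  qed
  moreover have "Lp_borel p (\<lambda>x. v x + convk u x)" using Lp_borel_add(1)[OF v convk_LB[OF u]] p by simp
  ultimately show ?thesis using u by (auto simp: weak_grad_def)
qed

text \<open>Leibniz rule: the error term is a convolution of \<open>u\<close> with a kernel dominated by a multiple of
  \<open>|z| |K(z)|\<close>.\<close>

lemma weak_grad_multiply: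
  assumes W: "weak_grad u v" and \<eta>: "\<eta> \<in> test_functions S"
  shows "\<exists>v'. weak_grad (\<lambda>x. \<eta> x * u x) v'"
proof -
  note u = weak_grad_LB[OF W]
  obtain L where L: "L \<ge> 0" "\<And>x z. norm (\<eta> x - \<eta> (x - z)) * norm (K z) \<le> L * zK z"
    using test_difference_bound[OF \<eta>] by metis
  obtain B where B: "B \<ge> 0" "\<And>x. norm (\<eta> x) \<le> B" using test_functions_bounded[OF \<eta>] by metis
  note \<eta>b[measurable] = test_functions_borel[OF \<eta>]
  \<comment> \<open>From \<open>\<eta> x \<psi> x - \<eta> (x - z) \<psi> (x - z) = \<eta> x (\<psi>
    x - \<psi> (x - z)) + (\<eta> x - \<eta> (x - z)) \<psi> (x - z)\<close>: the second summand
    gives the error kernel.\<close>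
  define \<kappa> where "\<kappa> = (\<lambda>(x, z). (\<eta> x - \<eta> (x - z)) *\<^sub>R K z)"
  have \<kappa>m: "\<kappa> \<in> borel_measurable borel"
  proof -
    note [measurable] = K_borel
    have "\<kappa> \<in> borel_measurable (borel \<Otimes>\<^sub>M borel)" unfolding \<kappa>_def by measurable
    then show ?thesis by (simp add: borel_prod)
  qed
  have \<kappa>b: "norm (\<kappa> (x, z)) \<le> L * zK z" for x z using L(2)[of x z] by (simp add: \<kappa>_def)
  have qi: "integrable lborel (\<lambda>z. L * zK z)" using zK_integrable by simp
  define E where "E x = (LBINT z. u (x - z) *\<^sub>R \<kappa> (x, z))" for x
  have E: "Lp_borel p E" unfolding E_def[abs_def] by (rule Lp_borel_convolution(1)[OF u(1) qi \<kappa>m \<kappa>b])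
  have bd: "Lp_borel p (\<lambda>x. \<eta> x *\<^sub>R f x)" if f: "Lp_borel p f" for f :: "real^'n \<Rightarrow> 'b::euclidean_space"
  proof (rule Lp_borel_dominated(1)[of _ "\<lambda>x. norm (f x)" p B])
    show "AE x in lborel. norm (\<eta> x *\<^sub>R f x) \<le> B * norm (f x)"
      using B by (intro AE_I2) (auto intro!: mult_right_mono)
  qed (use f B p Lp_borel_measurable[OF f] in \<open>auto simp: Lp_borel_def\<close>)
  have "weak_grad (\<lambda>x. \<eta> x * u x) (\<lambda>x. \<eta> x *\<^sub>R v x + E x)"
    unfolding weak_grad_def
  proof (intro conjI ballI)
    show L1: "Lp_borel p (\<lambda>x. \<eta> x * u x)" using bd[OF u(1)] by simp
    show "Lp_borel p (\<lambda>x. \<eta> x *\<^sub>R v x + E x)" using Lp_borel_add(1)[OF bd[OF u(2)] E] p by simp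
    fix \<psi> :: "real^'n \<Rightarrow> real^'n" assume \<psi>: "\<psi> \<in> test_functions UNIV"
    note [measurable] = test_functions_borel[OF \<psi>]
    obtain C where C: "\<And>x. norm (\<psi> x) \<le> C" using test_functions_bounded[OF \<psi>] by metis
    have \<eta>\<psi>: "(\<lambda>x. \<eta> x *\<^sub>R \<psi> x) \<in> test_functions UNIV"
      by (rule test_functions_bilinear_right[OF bounded_bilinear_scaleR test_functions_smooth[OF \<eta>] \<psi>])
    note f = fubini_swap[OF p u(1) \<psi> \<kappa>m qi _ \<kappa>b, simplified zK_minus, simplified]
    \<comment> \<open>Both the difference of \<open>\<eta>\<close> and \<open>K\<close> change sign
      under the substitution, so the kernel returns to itself.\<close>
    have E': "\<kappa> (x - z, - z) = \<kappa> (x, z)" for x z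
      by (simp add: \<kappa>_def K_minus scaleR_left_diff_distrib)
    have dv: "divK (\<lambda>x. \<eta> x *\<^sub>R \<psi> x) x = \<eta> x * divK \<psi> x + (LBINT z. \<psi> (x - z) \<bullet> \<kappa> (x, z))" for x
    proof -
      have i2: "integrable lborel (\<lambda>z. \<psi> (x - z) \<bullet> \<kappa> (x, z))"
      proof (rule Bochner_Integration.integrable_bound)
        show "integrable lborel (\<lambda>z. C * (L * zK z))" using zK_integrable by simp
        have "norm (\<psi> (x - z) \<bullet> \<kappa> (x, z)) \<le> norm (C * (L * zK z))" for z
        proof -
          have "norm (\<psi> (x - z) \<bullet> \<kappa> (x, z)) \<le> norm (\<psi> (x - z)) * norm (\<kappa> (x, z))"
            by (simp add: Cauchy_Schwarz_ineq2)
          also have "\<dots> \<le> C * (L * zK z)"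
            by (intro mult_mono C \<kappa>b order_trans[OF norm_ge_zero C]) auto
          finally show ?thesis by simp
        qed
        then show "AE z in lborel. norm (\<psi> (x - z) \<bullet> \<kappa> (x, z)) \<le> norm (C * (L * zK z))" by simp
        show "(\<lambda>z. \<psi> (x - z) \<bullet> \<kappa> (x, z)) \<in> borel_measurable lborel"
          using K_borel unfolding \<kappa>_def by simp
      qed
      have "divK (\<lambda>x. \<eta> x *\<^sub>R \<psi> x) x =
          (LBINT z. \<eta> x * ((\<psi> x - \<psi> (x - z)) \<bullet> K z) + \<psi> (x - z) \<bullet> \<kappa> (x, z))"
        unfolding divK_def \<kappa>_def
        by (intro Bochner_Integration.integral_cong refl) (simp add: inner_diff_left algebra_simps)
      also have "\<dots> = \<eta> x * divK \<psi> x + (LBINT z. \<psi> (x - z) \<bullet> \<kappa> (x, z))"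
        using divK_integrable[OF \<psi>, of x] i2 by (simp add: divK_def)
      finally show ?thesis .
    qed
    have "(LBINT x. (\<eta> x *\<^sub>R v x) \<bullet> \<psi> x) = (LBINT x. v x \<bullet> (\<eta> x *\<^sub>R \<psi> x))" by simp
    also have "\<dots> = - (LBINT x. u x * divK (\<lambda>x. \<eta> x *\<^sub>R \<psi> x) x)" by (rule weak_grad_test[OF W \<eta>\<psi>])
    also have "(LBINT x. u x * divK (\<lambda>x. \<eta> x *\<^sub>R \<psi> x) x) =
       (LBINT x. (\<eta> x * u x) * divK \<psi> x + u x * (LBINT z. \<psi> (x - z) \<bullet> \<kappa> (x, z)))"
      by (simp add: dv algebra_simps)
    also have "\<dots> = (LBINT x. (\<eta> x * u x) * divK \<psi> x) + (LBINT x. u x * (LBINT z. \<psi> (x - z) \<bullet> \<kappa> (x, z)))"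
      using pairing_integrable(2)[OF L1 E \<psi>] f(2) by (intro Bochner_Integration.integral_add)
    also have "(LBINT x. u x * (LBINT z. \<psi> (x - z) \<bullet> \<kappa> (x, z))) = (LBINT x. E x \<bullet> \<psi> x)"
      using f(1) by (simp add: E' E_def)
    finally have "(LBINT x. (\<eta> x *\<^sub>R v x) \<bullet> \<psi> x) + (LBINT x. E x \<bullet> \<psi> x) = - (LBINT x. \<eta> x * u x * divK \<psi> x)"
      by simp
    moreover have "(LBINT x. (\<eta> x *\<^sub>R v x + E x) \<bullet> \<psi> x) = (LBINT x. (\<eta> x *\<^sub>R v x) \<bullet> \<psi> x) + (LBINT x. E x \<bullet> \<psi> x)"
      using pairing_integrable(1)[OF L1 bd[OF u(2)] \<psi>] pairing_integrable(1)[OF L1 E \<psi>]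
      unfolding inner_add_left by (rule Bochner_Integration.integral_add)
    ultimately show "(LBINT x. (\<eta> x *\<^sub>R v x + E x) \<bullet> \<psi> x) = - (LBINT x. \<eta> x * u x * divK \<psi> x)" by simp
  qed
  then show ?thesis by blast
qed

text \<open>Test the weak gradient against \<open>\<mu> (x - y) b\<close>, as a function of \<open>y\<close>, for each basis vector \<open>b\<close>.\<close>

lemma gradK_convolution:
  assumes W: "weak_grad u v" and u: "integrable lborel u" and \<mu>: "\<mu> \<in> test_functions S"
  shows "gradK (\<lambda>x. LBINT y. u y *\<^sub>R \<mu> (x - y)) x = (LBINT y. \<mu> y *\<^sub>R v (x - y))"
proof -
  note v = weak_grad_LB(2)[OF W]
  note [measurable] = test_functions_borel[OF \<mu>] borel_measurable_integrable[OF u] K_borel Lp_borel_measurable[OF v]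
  obtain L where L: "L \<ge> 0" "\<And>x z. norm (\<mu> x - \<mu> (x - z)) * norm (K z) \<le> L * zK z"
    using test_difference_bound[OF \<mu>] by metis
  obtain B where B: "\<And>x. norm (\<mu> x) \<le> B" using test_functions_bounded[OF \<mu>] by metis
  \<comment> \<open>The difference in \<open>z\<close> is put on \<open>\<mu>\<close>, which is
    Lipschitz, so Fubini applies although \<open>u\<close> is merely integrable.\<close>
  define f where "f z y = u y *\<^sub>R (\<mu> (x - y) - \<mu> (x - y - z)) *\<^sub>R K z" for z y
  have fm: "case_prod f \<in> borel_measurable (lborel \<Otimes>\<^sub>M lborel)" unfolding f_def by measurable
  have "norm (f z y) \<le> (L * zK z) * norm (u y)" for z y
    using mult_left_mono[OF L(2)[of "x - y" z], of "\<bar>u y\<bar>"] by (simp add: f_def abs_mult mult_ac)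
  then have "(\<integral>\<^sup>+y. ennreal (norm (f z y)) \<partial>lborel) \<le> ennreal (LBINT y. (L * zK z) * norm (u y))" for z
    using u by (intro nn_integral_norm_le_integral integrable_mult_right integrable_norm) auto
  then have fi: "integrable (lborel \<Otimes>\<^sub>M lborel) (case_prod f)"
    using zK_integrable by (intro integrable_pairI[OF fm, where q="\<lambda>z. (LBINT y. (L * zK z) * norm (u y))"]) auto
  have i: "integrable lborel (\<lambda>y. u y *\<^sub>R \<mu> (x' - y))" for x'
    using integrable_mult_bounded[OF u, of "\<lambda>y. \<mu> (x' - y)" B] B by simp
  have "gradK (\<lambda>x. LBINT y. u y *\<^sub>R \<mu> (x - y)) x = (LBINT z. (LBINT y. f z y))"
    unfolding gradK_def
  proof (intro Bochner_Integration.integral_cong refl)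
    fix z
    have d: "(LBINT y. u y *\<^sub>R \<mu> (x - y)) - (LBINT y. u y *\<^sub>R \<mu> (x - z - y))
        = (LBINT y. u y *\<^sub>R (\<mu> (x - y) - \<mu> (x - y - z)))"
    proof -
      have e: "x - y - z = x - z - y" for y by simp
      show ?thesis unfolding e using Bochner_Integration.integral_diff[OF i i, of x "x - z"] by (simp add: right_diff_distrib)
    qed
    have i': "integrable lborel (\<lambda>y. u y *\<^sub>R (\<mu> (x - y) - \<mu> (x - y - z)))"
    proof -
      have e: "x - y - z = x - z - y" for y by simp
      show ?thesis unfolding e using Bochner_Integration.integrable_diff[OF i i, of x "x - z"] by (simp add: right_diff_distrib)
    qed
    have "(LBINT y. f z y) = (LBINT y. (u y *\<^sub>R (\<mu> (x - y) - \<mu> (x - y - z))) *\<^sub>R K z)"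
      by (simp add: f_def)
    also have "\<dots> = (LBINT y. u y *\<^sub>R (\<mu> (x - y) - \<mu> (x - y - z))) *\<^sub>R K z"
      by (rule integral_scaleR_left) (rule i')
    finally show "((LBINT y. u y *\<^sub>R \<mu> (x - y)) - (LBINT y. u y *\<^sub>R \<mu> (x - z - y))) *\<^sub>R K z = (LBINT y. f z y)"
      by (simp only: d)
  qed
  also have "\<dots> = (LBINT y. (LBINT z. f z y))"
    by (rule lborel_pair.Fubini_integral[OF fi, symmetric])
  also have "\<dots> = (LBINT y. u y *\<^sub>R gradK \<mu> (x - y))"
    by (simp only: f_def gradK_def integral_scaleR_right)
  also have "\<dots> = (LBINT y. \<mu> y *\<^sub>R v (x - y))"
  proof (rule euclidean_eqI)
    fix b :: "real^'n" assume "b \<in> Basis"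
    have "(\<lambda>y. \<mu> ((-1) *\<^sub>R y + x)) \<in> test_functions ((\<lambda>y. (-1) *\<^sub>R y + x) -` S)"
      by (intro test_functions_affine \<mu>) auto
    then have \<mu>x: "(\<lambda>y. \<mu> (x - y)) \<in> test_functions ((\<lambda>y. (-1) *\<^sub>R y + x) -` S)" by (simp add: algebra_simps)
    have \<mu>b: "(\<lambda>y. \<mu> (x - y) *\<^sub>R b) \<in> test_functions ((\<lambda>y. (-1) *\<^sub>R y + x) -` S)"
      by (rule test_functions_linear[OF bounded_linear_scaleR_left \<mu>x])
    obtain C where C: "\<And>y. norm (gradK \<mu> y) \<le> C"
    proof -
      have "norm (gradK \<mu> y) \<le> (LBINT z. L * zK z)" for y
      proof -
        have "norm (gradK \<mu> y) \<le> (LBINT z. norm ((\<mu> y - \<mu> (y - z)) *\<^sub>R K z))"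
          unfolding gradK_def by (rule integral_norm_bound)
        also have "\<dots> \<le> (LBINT z. L * zK z)"
          using zK_integrable L(2)[of y] by (intro integral_mono[OF integrable_norm[OF gradK_integrable[OF \<mu>]]]) auto
        finally show ?thesis .
      qed
      then show thesis by (rule that)
    qed
    have iG: "integrable lborel (\<lambda>y. u y *\<^sub>R gradK \<mu> (x - y))"
      using integrable_mult_bounded[OF u, of "\<lambda>y. gradK \<mu> (x - y)" C] C gradK_borel[OF test_functions_borel[OF \<mu>]] by simp
    have iv: "integrable lborel (\<lambda>y. \<mu> (x - y) *\<^sub>R v y)"
    proof (rule Bochner_Integration.integrable_bound)
      show "integrable lborel (\<lambda>y. norm (v y) * norm (\<mu> (x - y)))"
        by (rule Lp_borel_integrable_mult(1)[OF v test_functions_integrable[OF \<mu>x] _ p]) (rule B)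
    qed auto
    \<comment> \<open>Reflecting \<open>\<mu>\<close> turns \<open>z\<close> into
      \<open>- z\<close>; since \<open>K\<close> is odd, the divergence of the reflected test field
      is minus the gradient.\<close>
    have dv: "divK (\<lambda>y. \<mu> (x - y) *\<^sub>R b) y = - (gradK \<mu> (x - y) \<bullet> b)" for y
    proof -
      define h where "h z = (\<mu> (x - y) - \<mu> (x - y - z)) * (b \<bullet> K z)" for z
      have [measurable]: "h \<in> borel_measurable borel" unfolding h_def[abs_def] by measurable
      have "divK (\<lambda>y. \<mu> (x - y) *\<^sub>R b) y = (LBINT z. - h (- z))"
        unfolding divK_def h_def
        by (intro Bochner_Integration.integral_cong refl) (simp add: K_minus inner_diff_left algebra_simps)
      also have "\<dots> = - (LBINT z. h z)"
        using integral_lborel_uminus[of h] by simp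
      also have "(LBINT z. h z) = gradK \<mu> (x - y) \<bullet> b"
        unfolding gradK_def h_def
        by (subst integral_inner_left[symmetric]) (use gradK_integrable[OF \<mu>, of "x - y"] in \<open>auto simp: inner_commute\<close>)
      finally show ?thesis .
    qed
    have "(LBINT y. \<mu> y *\<^sub>R v (x - y)) = (LBINT y. \<mu> (x - y) *\<^sub>R v y)"
      using integral_lborel_reflect[of "\<lambda>y. \<mu> y *\<^sub>R v (x - y)" x] by simp
    also have "\<dots> \<bullet> b = (LBINT y. v y \<bullet> (\<mu> (x - y) *\<^sub>R b))"
      using iv by (subst integral_inner_left[symmetric]) auto
    also have "\<dots> = - (LBINT y. u y * divK (\<lambda>y. \<mu> (x - y) *\<^sub>R b) y)" by (rule weak_grad_test[OF W \<mu>b])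
    also have "\<dots> = (LBINT y. (u y *\<^sub>R gradK \<mu> (x - y)) \<bullet> b)" by (simp add: dv)
    also have "\<dots> = (LBINT y. u y *\<^sub>R gradK \<mu> (x - y)) \<bullet> b"
      by (rule integral_inner_left) (rule iG)
    finally show "(LBINT y. u y *\<^sub>R gradK \<mu> (x - y)) \<bullet> b = (LBINT y. \<mu> y *\<^sub>R v (x - y)) \<bullet> b" by simp
  qed
  finally show ?thesis .
qed

end

section \<open>Density of test functions\<close>

lemma Lp_pow_cong_AE:
  assumes "f \<in> borel_measurable borel" "g \<in> borel_measurable borel" "AE x in lborel. f x = g x"
  shows "Lp_pow p f = Lp_pow p g"
  unfolding Lp_pow_def using assms by (intro integral_cong_AE) auto

lemma Lp_borel_cong_AE:
  assumes "Lp_borel p f" "g \<in> borel_measurable borel" "AE x in lborel. f x = g x"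
  shows "Lp_borel p g"
proof -
  have "integrable lborel (\<lambda>x. norm (g x) powr p)"
    by (rule integrable_cong_AE_imp[of _ "\<lambda>x. norm (f x) powr p"]) (use assms in \<open>auto simp: Lp_borel_def\<close>)
  then show ?thesis using assms by (simp add: Lp_borel_def)
qed

lemma Lp_pow_swap: "Lp_pow p (\<lambda>x. f x - g x) = Lp_pow p (\<lambda>x. g x - f x)"
  by (simp add: Lp_pow_def norm_minus_commute)

lemma
  fixes f g :: "'a::euclidean_space \<Rightarrow> 'b::euclidean_space"
  assumes S: "S \<in> sets lebesgue" and g: "g \<in> borel_measurable borel"
    and ae: "AE x in lebesgue. indicat_real S x *\<^sub>R f x = g x"
  shows integral_lebesgue_on_borel: "integral\<^sup>L (lebesgue_on S) f = integral\<^sup>L lborel g"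
    and integrable_lebesgue_on_borel: "integrable (lebesgue_on S) f \<longleftrightarrow> integrable lborel g"
proof -
  show "integral\<^sup>L (lebesgue_on S) f = integral\<^sup>L lborel g"
    using S lebesgue_integral_borel_version[OF g ae] by (subst integral_restrict_space) auto
  show "integrable (lebesgue_on S) f \<longleftrightarrow> integrable lborel g"
    using S lebesgue_integrable_borel_version[OF g ae] by (subst integrable_restrict_space) auto
qed

lemma Lp_borel_integrable_indicator:
  fixes v :: "'a::euclidean_space \<Rightarrow> 'b::euclidean_space"
  assumes v: "Lp_borel p v" and S: "S \<in> sets borel" "bounded S" and p: "1 \<le> p"
  shows "integrable lborel (\<lambda>x. indicat_real S x *\<^sub>R v x)"
proof -
  note [measurable] = Lp_borel_measurable[OF v] S(1)
  have "integrable lborel (indicat_real S)"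
    using emeasure_bounded_finite[OF S(2)] S(1) by (intro integrable_real_indicator) auto
  from Lp_borel_integrable_mult(1)[OF v this _ p, of 1]
  have "integrable lborel (\<lambda>x. norm (v x) * norm (indicat_real S x))" by (simp add: indicator_def)
  then show ?thesis
    by (rule Bochner_Integration.integrable_bound) (auto simp: abs_mult)
qed

lemma Lp_borel_L1_loc:
  fixes v :: "'a::euclidean_space \<Rightarrow> 'b::euclidean_space"
  assumes v: "Lp_borel p v" and p: "1 \<le> p"
  shows "v \<in> L1_loc S"
  unfolding L1_loc_def
proof (intro CollectI allI impI)
  fix C assume "compact C \<and> C \<subseteq> S"
  then have C: "C \<in> sets borel" "bounded C" by (auto simp: borel_compact compact_imp_bounded)
  note [measurable] = C(1) Lp_borel_measurable[OF v]
  have "integrable (lebesgue_on C) v = integrable lborel (\<lambda>x. indicat_real C x *\<^sub>R v x)"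
    using C by (intro integrable_lebesgue_on_borel) auto
  then show "integrable (lebesgue_on C) v" using Lp_borel_integrable_indicator[OF v C p] by simp
qed

context nonlocal_setup
begin

lemma weak_grad_cong_AE:
  assumes W: "weak_grad u v" and u': "u' \<in> borel_measurable borel" "AE x in lborel. u x = u' x"
    and v': "v' \<in> borel_measurable borel" "AE x in lborel. v x = v' x"
  shows "weak_grad u' v'"
  unfolding weak_grad_def
proof (intro conjI ballI)
  note L = weak_grad_LB[OF W]
  show "Lp_borel p u'" "Lp_borel p v'" using L u' v' by (auto intro: Lp_borel_cong_AE)
  fix \<psi> :: "real^'n \<Rightarrow> real^'n" assume \<psi>: "\<psi> \<in> test_functions UNIV"
  note [measurable] = test_functions_borel[OF \<psi>] divK_borel[OF test_functions_borel[OF \<psi>]] Lp_borel_measurable[OF L(1)] Lp_borel_measurable[OF L(2)] u'(1) v'(1)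
  have "(LBINT x. v x \<bullet> \<psi> x) = (LBINT x. v' x \<bullet> \<psi> x)"
    using v'(2) by (intro integral_cong_AE) auto
  moreover have "(LBINT x. u x * divK \<psi> x) = (LBINT x. u' x * divK \<psi> x)"
    using u'(2) by (intro integral_cong_AE) auto
  ultimately show "(LBINT x. v' x \<bullet> \<psi> x) = - (LBINT x. u' x * divK \<psi> x)"
    using weak_grad_test[OF W \<psi>] by simp
qed

text \<open>Locality of the gradient: the divergence of a field supported in \<open>S\<close>
  reaches less than \<open>\<rho>\<close> beyond \<open>S\<close>, so it never meets the set where
  \<open>u\<close> is nonzero. The fundamental lemma does the rest.\<close>

lemma weak_grad_vanishes:
  assumes W: "weak_grad u v" and S: "open S" and \<rho>: "0 < \<rho>" "\<And>z. \<rho> \<le> norm z \<Longrightarrow> w z = 0"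
    and far: "\<And>x y. u x \<noteq> 0 \<Longrightarrow> dist x y < \<rho> \<Longrightarrow> y \<notin> S"
  shows "AE x in lborel. x \<in> S \<longrightarrow> v x = 0"
proof -
  note L = weak_grad_LB[OF W]
  have [measurable]: "S \<in> sets borel" using S by simp
  have "AE x in lebesgue. x \<in> S \<longrightarrow> v x = 0"
  proof (rule fundamental_lemma[OF S Lp_borel_L1_loc[OF L(2) p]])
    fix \<psi> :: "real^'n \<Rightarrow> real^'n" assume \<psi>: "\<psi> \<in> test_functions S"
    have \<psi>0: "\<psi> x = 0" if "x \<notin> S" for x using \<psi> that by (auto simp: test_functions_iff)
    have "(\<integral>x. v x \<bullet> \<psi> x \<partial>lebesgue_on S) = (LBINT x. v x \<bullet> \<psi> x)"
      using S \<psi>0 Lp_borel_measurable[OF L(2)] test_functions_borel[OF \<psi>]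
      by (intro integral_lebesgue_on_borel) (auto simp: indicator_def)
    also have "\<dots> = - (LBINT x. u x * divK \<psi> x)" by (rule weak_grad_test[OF W \<psi>])
    also have "(\<lambda>x. u x * divK \<psi> x) = (\<lambda>_. 0)"
    proof (rule ext)
      fix x
      show "u x * divK \<psi> x = 0"
      proof (cases "u x = 0")
        case False
        have "divK \<psi> x = 0"
          by (rule divK_eq_0[OF _ \<rho>]) (auto intro!: \<psi>0 far[OF False] simp: dist_norm)
        then show ?thesis by simp
      qed simp
    qed
    finally show "(\<integral>x. v x \<bullet> \<psi> x \<partial>lebesgue_on S) = 0" by simp
  qed
  moreover have "Measurable.pred lborel (\<lambda>x. x \<in> S \<longrightarrow> v x = 0)"
    using Lp_borel_measurable[OF L(2)] by measurable
  ultimately show ?thesis by (simp add: AE_completion_iff)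
qed

text \<open>The difference is a weak gradient of zero, for which the support condition above holds
  vacuously with \<open>S = UNIV\<close>.\<close>

lemma weak_grad_unique:
  assumes "weak_grad u v" "weak_grad u v'"
  shows "AE x in lborel. v x = v' x"
proof -
  obtain \<rho> where \<rho>: "0 < \<rho>" "\<rho> < \<delta>" "\<And>z. \<rho> \<le> norm z \<Longrightarrow> w z = 0" using w_support by metis
  have "AE x in lborel. x \<in> UNIV \<longrightarrow> v x - v' x = 0"
    by (rule weak_grad_vanishes[OF weak_grad_diff[OF assms] _ \<rho>(1,3)]) auto
  then show ?thesis by simp
qed

text \<open>Density measured over the whole space, which is legitimate because for functions
  vanishing off the shrunken domain the local norm is the same. The gradient \<open>v\<close> is an
  argument of its own since it is determined up to null sets only.\<close>

definition approx :: "(real^'n) set \<Rightarrow> (real^'n \<Rightarrow> real) \<Rightarrow> (real^'n \<Rightarrow> real^'n) \<Rightarrow> bool" where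
  "approx U u v \<longleftrightarrow> (\<forall>e>0. \<exists>\<phi>\<in>test_functions U. Lp_pow p (\<lambda>x. u x - \<phi> x) < e \<and> Lp_pow p (\<lambda>x. v x - gradK \<phi> x) < e)"

lemma approx_add:
  assumes W: "weak_grad u v" "weak_grad u' v'" and a: "approx U u v" "approx U u' v'"
  shows "approx U (\<lambda>x. u x + u' x) (\<lambda>x. v x + v' x)"
  unfolding approx_def
proof (intro allI impI)
  fix e :: real assume e: "0 < e"
  \<comment> \<open>Half for each summand, and \<open>2 powr p\<close> for the triangle inequality
    of \<open>Lp_pow\<close>.\<close>
  define e' where "e' = e / (2 * 2 powr p)"
  have e': "e' > 0" using e by (simp add: e'_def)
  obtain \<phi> where \<phi>: "\<phi> \<in> test_functions U" "Lp_pow p (\<lambda>x. u x - \<phi> x) < e'" "Lp_pow p (\<lambda>x. v x - gradK \<phi> x) < e'"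
    using a(1) e' unfolding approx_def by blast
  obtain \<phi>' where \<phi>': "\<phi>' \<in> test_functions U" "Lp_pow p (\<lambda>x. u' x - \<phi>' x) < e'" "Lp_pow p (\<lambda>x. v' x - gradK \<phi>' x) < e'"
    using a(2) e' unfolding approx_def by blast
  note W1 = weak_grad_diff[OF W(1) weak_grad_test_function[OF \<phi>(1)]]
  note W2 = weak_grad_diff[OF W(2) weak_grad_test_function[OF \<phi>'(1)]]
  have p0: "0 \<le> p" using p by simp
  have lt: "2 powr p * (a + b) < e" if "a < e'" "b < e'" for a b
  proof -
    have "2 powr p * (a + b) < 2 powr p * (e' + e')"
      using that by (intro mult_strict_left_mono add_strict_mono) auto
    also have "\<dots> = e" by (simp add: e'_def)
    finally show ?thesis .
  qed
  have "Lp_pow p (\<lambda>x. (u x + u' x) - (\<phi> x + \<phi>' x)) = Lp_pow p (\<lambda>x. (u x - \<phi> x) + (u' x - \<phi>' x))"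
    by (simp add: algebra_simps)
  also have "\<dots> < e"
    using Lp_borel_add(2)[OF weak_grad_LB(1)[OF W1] weak_grad_LB(1)[OF W2] p0] lt[OF \<phi>(2) \<phi>'(2)] by simp
  finally have 1: "Lp_pow p (\<lambda>x. (u x + u' x) - (\<phi> x + \<phi>' x)) < e" .
  have eq: "(v x + v' x) - gradK (\<lambda>x. \<phi> x + \<phi>' x) x = (v x - gradK \<phi> x) + (v' x - gradK \<phi>' x)" for x
    by (simp add: gradK_add[OF \<phi>(1) \<phi>'(1)])
  have "Lp_pow p (\<lambda>x. (v x + v' x) - gradK (\<lambda>x. \<phi> x + \<phi>' x) x) = Lp_pow p (\<lambda>x. (v x - gradK \<phi> x) + (v' x - gradK \<phi>' x))"
    by (simp only: eq)
  also have "\<dots> < e"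
    using Lp_borel_add(2)[OF weak_grad_LB(2)[OF W1] weak_grad_LB(2)[OF W2] p0] lt[OF \<phi>(3) \<phi>'(3)] by simp
  finally have 2: "Lp_pow p (\<lambda>x. (v x + v' x) - gradK (\<lambda>x. \<phi> x + \<phi>' x) x) < e" .
  show "\<exists>\<phi>\<in>test_functions U. Lp_pow p (\<lambda>x. (u x + u' x) - \<phi> x) < e \<and> Lp_pow p (\<lambda>x. (v x + v' x) - gradK \<phi> x) < e"
    by (rule bexI[OF _ test_functions_add[OF \<phi>(1) \<phi>'(1)]]) (rule conjI[OF 1 2])
qed

text \<open>\<open>push\<close> provides arbitrarily short translations of \<open>S\<close> into
  \<open>U\<close>. Convolution with a mollifier supported near such a \<open>t\<close> moves the
  support to a neighbourhood of \<open>S + t\<close>; the mollifier averages over short translations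
  only, so both \<open>u\<close> and \<open>v\<close> are approximated.\<close>

lemma approx_compact_support:
  assumes W: "weak_grad u v" and S: "compact S" "\<And>x. x \<notin> S \<Longrightarrow> u x = 0" and U: "open U"
    and push: "\<And>d. 0 < d \<Longrightarrow> \<exists>t. norm t < d \<and> (\<lambda>x. x + t) ` S \<subseteq> U"
  shows "approx U u v"
  unfolding approx_def
proof (intro allI impI)
  fix e :: real assume e: "0 < e"
  note L = weak_grad_LB[OF W]
  have ui: "integrable lborel u"
  proof -
    have "(\<lambda>x. indicat_real S x *\<^sub>R u x) = u"
    proof (rule ext)
      show "indicat_real S x *\<^sub>R u x = u x" for x using S(2)[of x] by (cases "x \<in> S") auto
    qed
    then show ?thesis
      using Lp_borel_integrable_indicator[OF L(1) _ compact_imp_bounded[OF S(1)] p] S(1) by (simp add: borel_compact)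
  qed
  have e2: "e / 2 > 0" using e by simp
  obtain d1 where d1: "d1 > 0" "\<And>y. norm y < d1 \<Longrightarrow> Lp_pow p (\<lambda>x. u (x - y) - u x) < e / 2"
    using translation_Lp[OF L(1) p e2] by metis
  obtain d2 where d2: "d2 > 0" "\<And>y. norm y < d2 \<Longrightarrow> Lp_pow p (\<lambda>x. v (x - y) - v x) < e / 2"
    using translation_Lp[OF L(2) p e2] by metis
  define d where "d = min d1 d2"
  have d: "d > 0" using d1 d2 by (simp add: d_def)
  then obtain t where t: "norm t < d / 2" "(\<lambda>x. x + t) ` S \<subseteq> U" using push[of "d / 2"] by auto
  have S': "compact ((\<lambda>x. x + t) ` S)" by (intro compact_continuous_image continuous_intros S(1))
  obtain r0 where r0: "r0 > 0" "(\<Union>x\<in>(\<lambda>x. x + t) ` S. ball x r0) \<subseteq> U"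
    using compact_subset_open_imp_ball_epsilon_subset[OF S' U t(2)] by metis
  \<comment> \<open>One half of \<open>d\<close> goes to \<open>t\<close> and one half to the
    radius, so the mollifier lives in \<open>ball 0 d\<close>; \<open>r0 / 2\<close> keeps the
    closed \<open>r\<close>-neighbourhood of the translate inside \<open>U\<close>.\<close>
  define r where "r = min (d / 2) (r0 / 2)"
  have r: "r > 0" using d r0 by (simp add: r_def)
  obtain \<mu> :: "real^'n \<Rightarrow> real" where \<mu>: "\<mu> \<in> test_functions (ball t r)" "\<And>x. 0 \<le> \<mu> x" "(LBINT x. \<mu> x) = 1"
    using ex_mollifier[OF r, of t] by metis
  have \<mu>0: "y \<in> ball t r" if "\<mu> y \<noteq> 0" for y using \<mu>(1) that by (auto simp: test_functions_iff)
  have \<mu>d: "norm y < d" if "\<mu> y \<noteq> 0" for y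
  proof -
    have "norm (y - t) < d / 2" using \<mu>0[OF that] by (simp add: r_def dist_norm norm_minus_commute)
    then show ?thesis using t(1) norm_triangle_ineq[of "y - t" t] by simp
  qed
  define F where "F x = (LBINT y. u y *\<^sub>R \<mu> (x - y))" for x
  have F: "F x = (LBINT y. \<mu> y *\<^sub>R u (x - y))" for x
    using integral_lborel_reflect[of "\<lambda>y. \<mu> y *\<^sub>R u (x - y)" x] test_functions_borel[OF \<mu>(1)] Lp_borel_measurable[OF L(1)]
    by (simp add: F_def mult.commute)
  have FU: "F \<in> test_functions U"
    unfolding test_functions_iff
  proof (intro conjI exI allI impI)
    show "smooth F" unfolding F_def[abs_def] by (rule smooth_convolution[OF ui \<mu>(1)])
    let ?C = "{x + y |x y. x \<in> (\<lambda>x. x + t) ` S \<and> y \<in> cball 0 r}"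
    show "compact ?C" by (intro compact_sums S' compact_cball)
    show "?C \<subseteq> U"
    proof
      fix a assume "a \<in> ?C"
      then obtain x y where "a = x + y" "x \<in> (\<lambda>x. x + t) ` S" "norm y \<le> r" by auto
      moreover have "r < r0" using r0 by (simp add: r_def)
      ultimately have "x \<in> (\<lambda>x. x + t) ` S" "a \<in> ball x r0" by (auto simp: dist_norm)
      then show "a \<in> U" using r0(2) by blast
    qed
    fix x assume x: "x \<notin> ?C"
    have "u y *\<^sub>R \<mu> (x - y) = 0" for y
    proof (rule ccontr)
      assume "u y *\<^sub>R \<mu> (x - y) \<noteq> 0"
      then have "y \<in> S" "x - y \<in> ball t r" using S(2)[of y] \<mu>0[of "x - y"] by auto
      moreover have "norm (x - y - t) = dist t (x - y)" by (simp add: dist_norm norm_minus_commute)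
      ultimately have "y + t \<in> (\<lambda>x. x + t) ` S" "x - y - t \<in> cball 0 r" by auto
      then have "(y + t) + (x - y - t) \<in> ?C" by blast
      then show False using x by simp
    qed
    then have "(\<lambda>y. u y *\<^sub>R \<mu> (x - y)) = (\<lambda>_. 0)" by (rule ext)
    then show "F x = 0" by (simp only: F_def) simp
  qed
  have "Lp_pow p (\<lambda>x. u x - F x) < e"
  proof -
    have "Lp_pow p (\<lambda>x. F x - u x) \<le> e / 2"
      unfolding F by (rule mollify_Lp(2)[OF L(1) p _ test_functions_integrable[OF \<mu>(1)] \<mu>(2,3)])
        (use d1 \<mu>d e in \<open>auto simp: d_def intro: less_imp_le\<close>)
    then show ?thesis using e by (simp add: Lp_pow_swap[of p u])
  qed
  moreover have "Lp_pow p (\<lambda>x. v x - gradK F x) < e"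
  proof -
    have "gradK F x = (LBINT y. \<mu> y *\<^sub>R v (x - y))" for x
      unfolding F_def[abs_def] by (rule gradK_convolution[OF W ui \<mu>(1)])
    moreover have "Lp_pow p (\<lambda>x. (LBINT y. \<mu> y *\<^sub>R v (x - y)) - v x) \<le> e / 2"
      by (rule mollify_Lp(2)[OF L(2) p _ test_functions_integrable[OF \<mu>(1)] \<mu>(2,3)])
        (use d2 \<mu>d e in \<open>auto simp: d_def intro: less_imp_le\<close>)
    ultimately show ?thesis using e by (simp add: Lp_pow_swap[of p v])
  qed
  ultimately show "\<exists>\<phi>\<in>test_functions U. Lp_pow p (\<lambda>x. u x - \<phi> x) < e \<and> Lp_pow p (\<lambda>x. v x - gradK \<phi> x) < e"
    using FU by blast
qed

text \<open>Moving along \<open>e\<close> keeps the coordinates orthogonal to \<open>e\<close> and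
  so raises the height \<open>h\<close> above the graph by exactly the step length. The height is
  nonnegative on the closure, by continuity, and becomes positive. The radius is chosen before
  \<open>d\<close>, as one chart must admit arbitrarily short steps.\<close>

lemma lipschitz_domain_push:
  assumes U: "lipschitz_domain U" and z: "z \<in> closure U"
  shows "\<exists>r>0. \<forall>d>0. \<exists>t. norm t < d \<and> (\<lambda>x. x + t) ` (closure U \<inter> cball z r) \<subseteq> (U :: (real^'n) set)"
proof (cases "z \<in> U")
  case True
  have "open U" using U by (simp add: lipschitz_domain_def)
  then obtain r where "r > 0" "cball z r \<subseteq> U" using True open_contains_cball by blast
  then show ?thesis by (intro exI[of _ r] conjI allI impI exI[of _ 0]) auto
next
  case False
  have oU: "open U" using U by (simp add: lipschitz_domain_def)
  then have "z \<in> frontier U" using z False by (simp add: frontier_def interior_open)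
  then obtain r e \<gamma> L where r: "r > 0" "norm e = 1" "L-lipschitz_on {y. y \<bullet> e = 0} \<gamma>"
    and eq: "U \<inter> ball z r = {x \<in> ball z r. x \<bullet> e > \<gamma> (x - (x \<bullet> e) *\<^sub>R e)}"
    using U unfolding lipschitz_domain_def by blast
  define P where "P x = x - (x \<bullet> e) *\<^sub>R e" for x
  have ee: "e \<bullet> e = 1" using r(2) by (simp add: norm_eq_1)
  have P: "P x \<bullet> e = 0" for x by (simp add: P_def inner_diff_left ee)
  define h where "h x = x \<bullet> e - \<gamma> (P x)" for x
  have ch: "continuous_on UNIV h"
    unfolding h_def
  proof (intro continuous_intros)
    show "continuous_on UNIV (\<lambda>x. \<gamma> (P x))"
    proof (rule continuous_on_compose2[OF lipschitz_on_continuous_on[OF r(3)], of UNIV P])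
      show "continuous_on UNIV P" unfolding P_def[abs_def] by (intro continuous_intros)
    qed (auto simp: P)
  qed
  have eq': "x \<in> U \<longleftrightarrow> h x > 0" if "x \<in> ball z r" for x
  proof -
    have "x \<in> U \<longleftrightarrow> x \<in> U \<inter> ball z r" using that by simp
    also have "\<dots> \<longleftrightarrow> h x > 0" unfolding eq using that by (simp add: h_def P_def)
    finally show ?thesis .
  qed
  have h0: "h x \<ge> 0" if x: "x \<in> closure U" "x \<in> ball z r" for x
  proof -
    have "x \<in> closure (ball z r \<inter> U)" using x open_Int_closure_subset[of "ball z r" U] by auto
    moreover have "closure (ball z r \<inter> U) \<subseteq> {x. h x \<ge> 0}"
      using eq' less_imp_le by (intro closure_minimal closed_Collect_le[OF continuous_on_const ch]) auto
    ultimately show ?thesis by auto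
  qed
  show ?thesis
  proof (intro exI[of _ "r / 2"] conjI allI impI)
    show "r / 2 > 0" using r by simp
    fix d :: real assume d: "d > 0"
    \<comment> \<open>At most \<open>r / 4\<close>, so that the half ball, once translated, stays in
      the chart \<open>ball z r\<close>.\<close>
    define \<tau> where "\<tau> = min (d / 2) (r / 4)"
    have \<tau>: "\<tau> > 0" "\<tau> < d" "\<tau> < r / 2" using d r by (auto simp: \<tau>_def)
    show "\<exists>t. norm t < d \<and> (\<lambda>x. x + t) ` (closure U \<inter> cball z (r / 2)) \<subseteq> U"
    proof (intro exI[of _ "\<tau> *\<^sub>R e"] conjI image_subsetI)
      show "norm (\<tau> *\<^sub>R e) < d" using \<tau> r by simp
      fix x assume x: "x \<in> closure U \<inter> cball z (r / 2)"
      have "norm (x + \<tau> *\<^sub>R e - z) \<le> norm (x - z) + norm (\<tau> *\<^sub>R e)"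
        using norm_triangle_ineq[of "x - z" "\<tau> *\<^sub>R e"] by (simp add: algebra_simps)
      also have "\<dots> < r" using x \<tau> r by (simp add: dist_norm norm_minus_commute)
      finally have xb: "x + \<tau> *\<^sub>R e \<in> ball z r" by (simp add: dist_norm norm_minus_commute)
      have "P (x + \<tau> *\<^sub>R e) = P x" by (simp add: P_def inner_add_left ee algebra_simps)
      then have "h (x + \<tau> *\<^sub>R e) = h x + \<tau>" by (simp add: h_def inner_add_left ee)
      moreover have "h x \<ge> 0" using x r by (intro h0) auto
      ultimately show "x + \<tau> *\<^sub>R e \<in> U" using eq'[OF xb] \<tau> by simp
    qed
  qed
qed

text \<open>Base case of the induction over charts. Here \<open>v\<close> is known to vanish almost
  everywhere only, by uniqueness.\<close>

lemma approx_zero: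
  assumes W: "weak_grad u v" and u: "\<And>x. u x = 0"
  shows "approx U u v"
proof -
  have G0: "gradK (\<lambda>x. 0) x = 0" for x by (simp add: gradK_def)
  have t: "(\<lambda>x::real^'n. 0::real) \<in> test_functions U"
    by (auto simp: test_functions_iff smooth_const intro!: exI[of _ "{}"])
  have "u = (\<lambda>x. 0)" using u by (rule ext)
  then have "weak_grad u (gradK (\<lambda>x. 0))" using weak_grad_test_function[OF t] by simp
  from weak_grad_unique[OF W this] have "AE x in lborel. v x = 0" by (simp add: G0)
  then have "Lp_pow p v = Lp_pow p (\<lambda>x::real^'n. 0 :: real^'n)" by (intro Lp_pow_cong_AE Lp_borel_measurable[OF weak_grad_LB(2)[OF W]]) auto
  then have "Lp_pow p v = 0" by (simp add: Lp_pow_def)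
  moreover have "Lp_pow p u = 0" using u by (simp add: Lp_pow_def)
  ultimately show ?thesis
    unfolding approx_def using t by (intro allI impI bexI[of _ "\<lambda>x. 0"]) (auto simp: G0)
qed

text \<open>Induction over a finite cover of the closure by charts, splitting off one bump function at a time.\<close>

theorem approx_lipschitz:
  assumes U: "lipschitz_domain U" "bounded U" and W: "weak_grad u v" and u: "\<And>x. x \<notin> U \<Longrightarrow> u x = 0"
  shows "approx U u v"
proof -
  have oU: "open U" using U by (simp add: lipschitz_domain_def)
  obtain b where b: "0 < b" "b < 1" "\<And>(c::real^'n) r. 0 < r \<Longrightarrow> \<exists>\<eta>\<in>test_functions (ball c r).
    (\<forall>x. 0 \<le> \<eta> x \<and> \<eta> x \<le> 1) \<and> (\<forall>x\<in>ball c (b * r). \<eta> x = (1::real))" using ex_bump by blast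
  have "\<forall>z\<in>closure U. \<exists>r>0. \<forall>d>0. \<exists>t. norm t < d \<and> (\<lambda>x. x + t) ` (closure U \<inter> cball z r) \<subseteq> U"
    using lipschitz_domain_push[OF U(1)] by blast
  then obtain r where r: "\<And>z. z \<in> closure U \<Longrightarrow> r z > 0"
    "\<And>z d. z \<in> closure U \<Longrightarrow> 0 < d \<Longrightarrow> \<exists>t. norm t < d \<and> (\<lambda>x. x + t) ` (closure U \<inter> cball z (r z)) \<subseteq> U"
    by metis
  have c: "compact (closure U)" using U(2) by simp
  \<comment> \<open>The balls on which the bumps equal 1 have to cover, hence the factor
    \<open>b\<close>.\<close>
  have cov: "closure U \<subseteq> (\<Union>z\<in>closure U. ball z (b * r z))" using r(1) b(1) by force
  obtain Z where Z: "Z \<subseteq> closure U" "finite Z" "closure U \<subseteq> (\<Union>z\<in>Z. ball z (b * r z))"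
    using compactE_image[OF c _ cov] by (metis open_ball)
  \<comment> \<open>The invariant: \<open>u\<close> is nonzero only in \<open>U\<close> and in the
    balls of the remaining charts.\<close>
  have "approx U u v" if "finite Z" "Z \<subseteq> closure U" "weak_grad u v" "\<And>x. u x \<noteq> 0 \<Longrightarrow> x \<in> U \<and> x \<in> (\<Union>z\<in>Z. ball z (b * r z))" for Z u v
    using that
  proof (induction Z arbitrary: u v rule: finite_induct)
    case empty
    then show ?case by (intro approx_zero) auto
  next
    case (insert z Z)
    have z: "z \<in> closure U" using insert by simp
    obtain \<eta> where \<eta>: "\<eta> \<in> test_functions (ball z (r z))" "\<And>x. x \<in> ball z (b * r z) \<Longrightarrow> \<eta> x = (1::real)"
      using b(3)[OF r(1)[OF z], of z] by blast
    obtain v1 where W1: "weak_grad (\<lambda>x. \<eta> x * u x) v1" using weak_grad_multiply[OF insert.prems(2) \<eta>(1)] by blast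
    have W2: "weak_grad (\<lambda>x. u x - \<eta> x * u x) (\<lambda>x. v x - v1 x)" by (rule weak_grad_diff[OF insert.prems(2) W1])
    have a1: "approx U (\<lambda>x. \<eta> x * u x) v1"
    proof (rule approx_compact_support[OF W1 _ _ oU])
      show "compact (closure U \<inter> cball z (r z))" using U(2) by (intro compact_Int) auto
      show "\<eta> x * u x = 0" if "x \<notin> closure U \<inter> cball z (r z)" for x
      proof (rule ccontr)
        assume "\<eta> x * u x \<noteq> 0"
        then have "x \<in> ball z (r z)" "x \<in> U" using \<eta>(1) insert.prems(3)[of x] by (auto simp: test_functions_iff)
        then show False using that closure_subset[of U] by auto
      qed
      show "\<exists>t. norm t < d \<and> (\<lambda>x. x + t) ` (closure U \<inter> cball z (r z)) \<subseteq> U" if "0 < d" for d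
        using r(2)[OF z that] .
    qed
    \<comment> \<open>The remainder vanishes where \<open>\<eta> = 1\<close>, so the ball at
      \<open>z\<close> drops out of the cover.\<close>
    have a2: "approx U (\<lambda>x. u x - \<eta> x * u x) (\<lambda>x. v x - v1 x)"
    proof (rule insert.IH[OF _ W2])
      show "Z \<subseteq> closure U" using insert by simp
      fix x assume x: "u x - \<eta> x * u x \<noteq> 0"
      then have "u x \<noteq> 0" "\<eta> x \<noteq> 1" by auto
      then show "x \<in> U \<and> x \<in> (\<Union>z\<in>Z. ball z (b * r z))"
        using insert.prems(3)[of x] \<eta>(2)[of x] by auto
    qed
    show ?case using approx_add[OF W1 W2 a1 a2] by simp
  qed
  from this[OF Z(2,1) W] show ?thesis
    using u Z(3) closure_subset[of U] by blast
qed

end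

section \<open>Transfer to the function spaces\<close>

text \<open>A Borel representative of \<open>f\<close> on \<open>S\<close>, extended by zero: the
  indicator forces \<open>g\<close> to vanish almost everywhere off \<open>S\<close>, so integrals
  over \<open>lebesgue_on S\<close> become integrals over \<open>lborel\<close>.\<close>

definition borel_rep :: "'a::euclidean_space set \<Rightarrow> ('a \<Rightarrow> 'b::euclidean_space) \<Rightarrow> ('a \<Rightarrow> 'b) \<Rightarrow> bool" where
  "borel_rep S f g \<longleftrightarrow> (AE x in lebesgue. indicat_real S x *\<^sub>R f x = g x)"

lemma borel_rep_powr:
  assumes "borel_rep S f g" shows "AE x in lebesgue. indicat_real S x *\<^sub>R (norm (f x) powr p) = norm (g x) powr p"
  using assms unfolding borel_rep_def by eventually_elim (auto simp: indicator_def split: if_splits)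

lemma Lp_ex_borel_rep:
  assumes S: "S \<in> sets lebesgue" and f: "f \<in> Lp p S"
  obtains g where "Lp_borel p g" "borel_rep S f g"
proof -
  have "(\<lambda>x. indicat_real S x *\<^sub>R f x) \<in> borel_measurable lebesgue"
    using f S borel_measurable_restrict_space_iff[of S lebesgue f] by (simp add: Lp_def)
  then obtain g where g: "g \<in> borel_measurable borel" "AE x in lebesgue. indicat_real S x *\<^sub>R f x = g x"
    by (rule ex_borel_version)
  then have r: "borel_rep S f g" by (simp add: borel_rep_def)
  have "integrable (lebesgue_on S) (\<lambda>x. norm (f x) powr p) = integrable lborel (\<lambda>x. norm (g x) powr p)"
    using g(1) borel_rep_powr[OF r] by (intro integrable_lebesgue_on_borel S) auto
  then have "Lp_borel p g" using f g(1) by (simp add: Lp_def Lp_borel_def)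
  then show thesis using r by (rule that)
qed

lemma borel_rep_Lp:
  assumes S: "S \<in> sets lebesgue" and g: "Lp_borel p g" and r: "borel_rep S f g"
  shows "f \<in> Lp p S" "Lp_norm p S f = Lp_pow p g powr (1 / p)"
proof -
  have ae: "AE x in lebesgue. indicat_real S x *\<^sub>R f x = g x" using r by (simp add: borel_rep_def)
  have "(\<lambda>x. indicat_real S x *\<^sub>R f x) \<in> borel_measurable lebesgue"
    by (rule lebesgue_measurable_borel_version[OF Lp_borel_measurable[OF g] ae])
  then have m: "f \<in> borel_measurable (lebesgue_on S)"
    using S borel_measurable_restrict_space_iff[of S lebesgue f] by simp
  have gm: "(\<lambda>x. norm (g x) powr p) \<in> borel_measurable borel" using Lp_borel_measurable[OF g] by simp
  show "f \<in> Lp p S"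
    using m integrable_lebesgue_on_borel[OF S gm borel_rep_powr[OF r]] g by (simp add: Lp_def Lp_borel_def)
  show "Lp_norm p S f = Lp_pow p g powr (1 / p)"
    unfolding Lp_norm_def Lp_pow_def using integral_lebesgue_on_borel[OF S gm borel_rep_powr[OF r]] by simp
qed

lemma L1_loc_test_integrable:
  fixes v \<psi> :: "'a::euclidean_space \<Rightarrow> 'b::euclidean_space"
  assumes S: "open S" and v: "v \<in> L1_loc S" and \<psi>: "\<psi> \<in> test_functions S"
  shows "integrable (lebesgue_on S) (\<lambda>x. v x \<bullet> \<psi> x)"
proof -
  obtain C where C: "compact C" "C \<subseteq> S" "\<And>x. x \<notin> C \<Longrightarrow> \<psi> x = 0" using \<psi> by (auto simp: test_functions_iff)
  obtain B where B: "\<And>x. norm (\<psi> x) \<le> B" using test_functions_bounded[OF \<psi>] by metis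
  have CL: "C \<in> sets lebesgue" "S \<in> sets lebesgue" using C(1) S by (auto simp: compact_imp_closed)
  have iv: "integrable lebesgue (\<lambda>x. indicat_real C x *\<^sub>R v x)"
    using v C CL integrable_restrict_space[of C lebesgue v] by (auto simp: L1_loc_def)
  have \<psi>m: "\<psi> \<in> borel_measurable lebesgue"
    using measurable_completion[of \<psi> lborel borel] test_functions_borel[OF \<psi>] by simp
  have "integrable lebesgue (\<lambda>x. (indicat_real C x *\<^sub>R v x) \<bullet> \<psi> x)"
  proof (rule Bochner_Integration.integrable_bound)
    show "integrable lebesgue (\<lambda>x. B * norm (indicat_real C x *\<^sub>R v x))" using iv by (intro integrable_mult_right integrable_norm)
    show "(\<lambda>x. (indicat_real C x *\<^sub>R v x) \<bullet> \<psi> x) \<in> borel_measurable lebesgue"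
      using borel_measurable_integrable[OF iv] \<psi>m by (rule borel_measurable_inner)
    have "norm ((indicat_real C x *\<^sub>R v x) \<bullet> \<psi> x) \<le> norm (B * norm (indicat_real C x *\<^sub>R v x))" for x
      using Cauchy_Schwarz_ineq2[of "indicat_real C x *\<^sub>R v x" "\<psi> x"]
        mult_right_mono[OF B[of x], of "norm (indicat_real C x *\<^sub>R v x)"]
      by (simp add: mult.commute)
    then show "AE x in lebesgue. norm ((indicat_real C x *\<^sub>R v x) \<bullet> \<psi> x) \<le> norm (B * norm (indicat_real C x *\<^sub>R v x))"
      by simp
  qed
  moreover have "(\<lambda>x. (indicat_real C x *\<^sub>R v x) \<bullet> \<psi> x) = (\<lambda>x. indicat_real S x *\<^sub>R (v x \<bullet> \<psi> x))"
    by (rule ext) (use C(2,3) in \<open>auto simp: indicator_def\<close>)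
  ultimately have "integrable lebesgue (\<lambda>x. indicat_real S x *\<^sub>R (v x \<bullet> \<psi> x))" by (simp only:)
  then show ?thesis
    using CL(2) integrable_restrict_space[of S lebesgue "\<lambda>x. v x \<bullet> \<psi> x"] by simp
qed

lemma outer_nbhd_open: "open (outer_nbhd \<delta> \<Omega>)"
proof (cases "\<Omega> = {}")
  case False
  then have "outer_nbhd \<delta> \<Omega> = {x. infdist x \<Omega> < \<delta>}" by (simp add: outer_nbhd_def)
  then show ?thesis by (simp add: open_Collect_less continuous_on_infdist)
qed (simp add: outer_nbhd_def)

lemma outer_nbhd_UNIV: "0 < \<delta> \<Longrightarrow> outer_nbhd \<delta> UNIV = (UNIV :: 'a::euclidean_space set)"
  by (auto simp: outer_nbhd_def)

lemma mem_outer_nbhd: "y \<in> \<Omega> \<Longrightarrow> dist x y < \<delta> \<Longrightarrow> x \<in> outer_nbhd \<delta> \<Omega>"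
  using infdist_le[of y \<Omega> x] by (auto simp: outer_nbhd_def)

context nonlocal_setup
begin

section \<open>Regularity of the kernel \<open>k\<close>\<close>

lemma grad_R_smooth: "smooth k"
  unfolding smooth_def
proof (rule allI)
  fix j
  obtain b where b: "0 < b" "b < 1" "\<And>x. norm x < b * \<delta> \<Longrightarrow> w x = 1" using w_one by blast
  let ?m = "real CARD('n) + s + 1"
  have o: "open (- {0::real^'n})" by auto
  have w': "Ck_on j (- {0}) (\<lambda>x. cns TYPE('n) s * (1 + (- w x)))"
  proof -
    have "smooth w" by (rule test_functions_smooth[OF w_test])
    then have "smooth (\<lambda>x. cns TYPE('n) s * (1 + (- w x)))"
      by (intro smooth_linear[OF bounded_linear_mult_right] smooth_add smooth_const
          smooth_linear[OF bounded_linear_minus[OF bounded_linear_ident]])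
    then show ?thesis unfolding smooth_def Ck_on_UNIV[symmetric] using Ck_on_subset by blast
  qed
  have i: "Ck_on j (- {0}) (\<lambda>x::real^'n. x)" by (rule Ck_on_ident[OF o])
  have "Ck_on j (- {0}) (\<lambda>x. (cns TYPE('n) s * (1 + (- w x))) *\<^sub>R (norm x powr (- ?m) *\<^sub>R x))"
    by (intro Ck_on_bilinear[OF o bounded_bilinear_scaleR] w' Ck_on_norm_powr i)
  then have 1: "Ck_on j (- {0}) k"
    by (rule Ck_on_cong[OF o, THEN iffD1, rotated]) (simp only: grad_R_def powr_minus diff_conv_add_uminus)
  \<comment> \<open>Near the origin \<open>1 - w\<close> is zero, and so is \<open>k\<close>; this
    ball and the complement of the origin cover the space.\<close>
  have "Ck_on j (ball 0 (b * \<delta>)) (\<lambda>x::real^'n. 0 :: real^'n)" by (rule Ck_on_const) simp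
  then have 2: "Ck_on j (ball 0 (b * \<delta>)) k"
    by (rule Ck_on_cong[THEN iffD1, rotated -1]) (auto simp: grad_R_def b(3))
  have "0 < b * \<delta>" using b \<delta> by simp
  then have "- {0} \<union> ball 0 (b * \<delta>) = (UNIV :: (real^'n) set)" by auto
  then show "Ck j k"
    using Ck_on_Un[OF o open_ball 1 2] by (simp add: Ck_on_UNIV)
qed

text \<open>Makes \<open>k\<close> a gradient indeed, as its name claims. It is a radial multiple of
  \<open>x\<close>, so a primitive of the radial profile, evaluated at \<open>norm x\<close>, is a
  potential; this one is normalised to vanish near the origin.\<close>

lemma grad_R_potential: "\<exists>R. \<forall>x. GDERIV R x :> k x"
proof -
  obtain b where b: "0 < b" "b < 1" "\<And>x. norm x < b * \<delta> \<Longrightarrow> w x = 1" using w_one by blast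
  define r where "r = b * \<delta>"
  have r: "r > 0" using b \<delta> by (simp add: r_def)
  obtain e :: "real^'n" where e: "norm e = 1" using vector_choose_size[of 1] by auto
  \<comment> \<open>The profile of \<open>k\<close> along a unit vector. With \<open>|t|\<close> it
    is defined on the whole line, and it is continuous since it vanishes near 0.\<close>
  define g where "g t = cns TYPE('n) s * (1 - w (t *\<^sub>R e)) * \<bar>t\<bar> powr (- (real CARD('n) + s))" for t
  have g0: "g t = 0" if "\<bar>t\<bar> < r" for t using b(3)[of "t *\<^sub>R e"] that e by (simp add: g_def r_def)
  have cg: "continuous_on UNIV g"
  proof -
    have "continuous_on (- {0}) g" unfolding g_def
      by (intro continuous_intros continuous_on_compose2[OF smooth_continuous[OF test_functions_smooth[OF w_test], of UNIV]]) auto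
    moreover have "continuous_on (ball 0 r) g"
      by (rule continuous_on_cong[THEN iffD1, OF refl _ continuous_on_const[of _ 0]]) (simp add: g0)
    ultimately have "continuous_on (- {0} \<union> ball 0 r) g" by (intro continuous_on_open_Un) auto
    moreover have "- {0} \<union> ball 0 r = (UNIV :: real set)" using r by auto
    ultimately show ?thesis by simp
  qed
  define R where "R x = integral {0..norm x} g" for x :: "real^'n"
  have "GDERIV R x :> k x" for x
  proof (cases "norm x < r")
    case True
    have R0: "R y = 0" if "y \<in> ball 0 r" for y
      unfolding R_def using that g0 by (intro integral_unique has_integral_is_0) auto
    have "(R has_derivative (\<lambda>h. 0)) (at x)"
      by (rule has_derivative_transform_within_open[of "\<lambda>_. 0" _ _ _ "ball 0 r"]) (use True R0 in auto)
    moreover have "k x = 0" using b(3)[of x] True by (simp add: grad_R_def r_def)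
    ultimately show ?thesis by (simp add: gderiv_def)
  next
    case False
    then have x: "x \<noteq> 0" "norm x > 0" using r by auto
    \<comment> \<open>The interval extends beyond \<open>norm x\<close> so that the one-dimensional
      derivative is two-sided.\<close>
    have "((\<lambda>t. integral {0..t} g) has_real_derivative g (norm x)) (at (norm x) within {0..norm x + 1})"
      by (rule integral_has_real_derivative) (use x continuous_on_subset[OF cg] in auto)
    moreover have "at (norm x) within {0..norm x + 1} = at (norm x)"
      using x by (intro at_within_interior) auto
    ultimately have d: "((\<lambda>t. integral {0..t} g) has_real_derivative g (norm x)) (at (norm x))" by simp
    have "GDERIV R x :> g (norm x) *\<^sub>R sgn x"
      unfolding R_def by (rule GDERIV_DERIV_compose[OF GDERIV_norm[OF x(1)] d])
    moreover have "g (norm x) *\<^sub>R sgn x = k x"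
    proof -
      have "w (norm x *\<^sub>R e) = w x" by (rule w_radial) (simp add: e)
      moreover have "norm x powr (- (real CARD('n) + s)) / norm x = inverse (norm x powr (real CARD('n) + s + 1))"
        using x by (simp add: powr_add powr_minus powr_diff field_simps)
      ultimately show ?thesis
        by (simp add: g_def grad_R_def sgn_div_norm divide_inverse mult.assoc)
    qed
    ultimately show ?thesis by simp
  qed
  then show ?thesis by blast
qed

lemma k_integrable_lebesgue: "integrable lebesgue k"
  using k_integrable integrable_completion[of k lborel] k_borel by simp

lemma convol_eq:
  assumes "borel_rep UNIV u u'" "u' \<in> borel_measurable borel"
  shows "convol k u x = convk u' x"
proof -
  note [measurable] = assms(2) k_borel
  have "convol k u x = (LBINT y. u' y *\<^sub>R k (x - y))"
    unfolding convol_def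
  proof (rule lebesgue_integral_borel_version)
    show "AE y in lebesgue. u y *\<^sub>R k (x - y) = u' y *\<^sub>R k (x - y)"
      using assms(1) unfolding borel_rep_def by eventually_elim simp
  qed measurable
  also have "\<dots> = convk u' x"
    using integral_lborel_reflect[of "\<lambda>z. u' (x - z) *\<^sub>R k z" x] by (simp add: convk_def)
  finally show ?thesis .
qed

lemma weak_gradient_unique:
  fixes v v' :: "real^'n \<Rightarrow> real^'n"
  assumes S: "open S" and v: "v \<in> L1_loc S" "v' \<in> L1_loc S"
    and eq: "\<And>\<psi>. \<psi> \<in> test_functions S \<Longrightarrow>
      (\<integral>x. v x \<bullet> \<psi> x \<partial>lebesgue_on S) = (\<integral>x. v' x \<bullet> \<psi> x \<partial>lebesgue_on S)"
  shows "AE x in lebesgue. x \<in> S \<longrightarrow> v x = v' x"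
proof -
  have "AE x in lebesgue. x \<in> S \<longrightarrow> v x - v' x = 0"
  proof (rule fundamental_lemma[OF S])
    show "(\<lambda>x. v x - v' x) \<in> L1_loc S" using v by (auto simp: L1_loc_def)
    fix \<psi> :: "real^'n \<Rightarrow> real^'n" assume \<psi>: "\<psi> \<in> test_functions S"
    show "(\<integral>x. (v x - v' x) \<bullet> \<psi> x \<partial>lebesgue_on S) = 0"
      using eq[OF \<psi>] L1_loc_test_integrable[OF S v(1) \<psi>] L1_loc_test_integrable[OF S v(2) \<psi>]
      by (simp add: inner_diff_left)
  qed
  then show ?thesis by simp
qed

lemma riesz_div_borel:
  fixes \<psi> :: "real^'n \<Rightarrow> real^'n"
  assumes \<psi>: "\<psi> \<in> test_functions S"
  shows "riesz_div s \<psi> \<in> borel_measurable borel"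
proof -
  note [measurable] = divK_borel[OF test_functions_borel[OF \<psi>]] test_functions_borel[OF \<psi>] k_borel
  have "(\<lambda>x. divK \<psi> x - (LBINT z. \<psi> (x - z) \<bullet> k z)) \<in> borel_measurable lborel" by measurable
  then show ?thesis by (simp add: riesz_div_eq[OF \<psi>, abs_def])
qed

lemma borel_rep_L1_loc:
  fixes f :: "'a::euclidean_space \<Rightarrow> 'b::euclidean_space"
  assumes r: "borel_rep S f g" and g: "Lp_borel p g"
  shows "f \<in> L1_loc S"
  unfolding L1_loc_def
proof (intro CollectI allI impI)
  fix C assume C: "compact C \<and> C \<subseteq> S"
  then have C': "C \<in> sets borel" "bounded C" by (auto simp: borel_compact compact_imp_bounded)
  note [measurable] = C'(1) Lp_borel_measurable[OF g]
  have "integrable (lebesgue_on C) f = integrable lborel (\<lambda>x. indicat_real C x *\<^sub>R g x)"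
  proof (rule integrable_lebesgue_on_borel)
    show "AE x in lebesgue. indicat_real C x *\<^sub>R f x = indicat_real C x *\<^sub>R g x"
      using r C unfolding borel_rep_def by (auto simp: indicator_def elim!: eventually_mono)
  qed (use C' in auto)
  then show "integrable (lebesgue_on C) f" using Lp_borel_integrable_indicator[OF g C' p] by simp
qed

lemma is_nl_grad_iff:
  assumes \<Omega>: "open \<Omega>" and u: "Lp_borel p u'" "borel_rep (outer_nbhd \<delta> \<Omega>) u u'" and v: "Lp_borel p v'" "borel_rep \<Omega> v v'"
  shows "is_nl_grad s \<delta> w \<Omega> u v \<longleftrightarrow>
    (\<forall>\<psi>\<in>test_functions \<Omega>. (LBINT x. v' x \<bullet> \<psi> x) = - (LBINT x. u' x * divK \<psi> x))"
proof -
  have O: "open (outer_nbhd \<delta> \<Omega>)" by (rule outer_nbhd_open)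
  have 1: "(\<integral>x. v x \<bullet> \<psi> x \<partial>lebesgue_on \<Omega>) = (LBINT x. v' x \<bullet> \<psi> x)"
    and 2: "(\<integral>x. u x * nl_div s w \<psi> x \<partial>lebesgue_on (outer_nbhd \<delta> \<Omega>)) = (LBINT x. u' x * divK \<psi> x)"
    if \<psi>: "\<psi> \<in> test_functions \<Omega>" for \<psi> :: "real^'n \<Rightarrow> real^'n"
  proof -
    note [measurable] = test_functions_borel[OF \<psi>] divK_borel[OF test_functions_borel[OF \<psi>]] Lp_borel_measurable[OF u(1)] Lp_borel_measurable[OF v(1)]
    show "(\<integral>x. v x \<bullet> \<psi> x \<partial>lebesgue_on \<Omega>) = (LBINT x. v' x \<bullet> \<psi> x)"
    proof (rule integral_lebesgue_on_borel)
      show "AE x in lebesgue. indicat_real \<Omega> x *\<^sub>R (v x \<bullet> \<psi> x) = v' x \<bullet> \<psi> x"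
        using v(2) unfolding borel_rep_def
      proof eventually_elim
        case (elim x)
        from elim[symmetric] show ?case by simp
      qed
    qed (use \<Omega> in auto)
    show "(\<integral>x. u x * nl_div s w \<psi> x \<partial>lebesgue_on (outer_nbhd \<delta> \<Omega>)) = (LBINT x. u' x * divK \<psi> x)"
    proof (rule integral_lebesgue_on_borel)
      show "AE x in lebesgue. indicat_real (outer_nbhd \<delta> \<Omega>) x *\<^sub>R (u x * nl_div s w \<psi> x) = u' x * divK \<psi> x"
        using u(2) unfolding borel_rep_def
      proof eventually_elim
        case (elim x)
        from elim[symmetric] show ?case by (simp add: nl_div_eq_divK[OF test_functions_borel[OF \<psi>]])
      qed
    qed (use O in auto)
  qed
  show ?thesis
    unfolding is_nl_grad_def using borel_rep_L1_loc[OF u(2,1)] borel_rep_L1_loc[OF v(2,1)] 1 2 by auto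
qed

text \<open>\<open>nl_grad\<close> is a choice among functions equal almost everywhere on \<Omega>;
  uniqueness identifies it with \<open>v'\<close>, so that the norm is computed from
  representatives. As \<open>v'\<close> vanishes off \<Omega>, its norm over the whole space is the
  one over \<Omega>.\<close>

lemma nl_grad_rep:
  assumes \<Omega>: "open \<Omega>" and u: "Lp_borel p u'" "borel_rep (outer_nbhd \<delta> \<Omega>) u u'" 
    and v: "Lp_borel p v'" "\<And>x. x \<notin> \<Omega> \<Longrightarrow> v' x = 0"
    and eq: "\<And>\<psi>. \<psi> \<in> test_functions \<Omega> \<Longrightarrow> (LBINT x. v' x \<bullet> \<psi> x) = - (LBINT x. u' x * divK \<psi> x)"
  shows "u \<in> H_nl s p \<delta> w \<Omega>" "borel_rep \<Omega> (nl_grad s \<delta> w \<Omega> u) v'"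
    "H_nl_norm s p \<delta> w \<Omega> u = (Lp_pow p u' + Lp_pow p v') powr (1 / p)"
proof -
  have rv: "borel_rep \<Omega> v' v'" unfolding borel_rep_def using v(2) by (intro AE_I2) (auto simp: indicator_def)
  have isg: "is_nl_grad s \<delta> w \<Omega> u v'"
    using is_nl_grad_iff[OF \<Omega> u v(1) rv] eq by blast
  have S: "\<Omega> \<in> sets lebesgue" "outer_nbhd \<delta> \<Omega> \<in> sets lebesgue"
    using \<Omega> outer_nbhd_open[of \<delta> \<Omega>] by auto
  show "u \<in> H_nl s p \<delta> w \<Omega>"
    unfolding H_nl_def using isg borel_rep_Lp(1)[OF S(2) u] borel_rep_Lp(1)[OF S(1) v(1) rv] by blast
  have "is_nl_grad s \<delta> w \<Omega> u (nl_grad s \<delta> w \<Omega> u)"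
    unfolding nl_grad_def by (rule someI[of "is_nl_grad s \<delta> w \<Omega> u", OF isg])
  then have "AE x in lebesgue. x \<in> \<Omega> \<longrightarrow> nl_grad s \<delta> w \<Omega> u x = v' x"
    using isg by (intro weak_gradient_unique[OF \<Omega>]) (auto simp: is_nl_grad_def)
  then show r: "borel_rep \<Omega> (nl_grad s \<delta> w \<Omega> u) v'"
    unfolding borel_rep_def using v(2) by (auto simp: indicator_def elim!: eventually_mono)
  show "H_nl_norm s p \<delta> w \<Omega> u = (Lp_pow p u' + Lp_pow p v') powr (1 / p)"
    unfolding H_nl_norm_def borel_rep_Lp(2)[OF S(2) u] borel_rep_Lp(2)[OF S(1) v(1) r]
    using p by (simp add: powr_powr Lp_pow_nonneg)
qed

lemma H_nl_ex_borel_rep: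
  assumes \<Omega>: "open \<Omega>" and u: "u \<in> H_nl s p \<delta> w \<Omega>"
  shows "\<exists>u' v'. Lp_borel p u' \<and> borel_rep (outer_nbhd \<delta> \<Omega>) u u' \<and> Lp_borel p v' \<and> (\<forall>x. x \<notin> \<Omega> \<longrightarrow> v' x = 0) \<and>
    (\<forall>\<psi>\<in>test_functions \<Omega>. (LBINT x. v' x \<bullet> \<psi> x) = - (LBINT x. u' x * divK \<psi> x))"
proof -
  have S: "\<Omega> \<in> sets lebesgue" "outer_nbhd \<delta> \<Omega> \<in> sets lebesgue"
    using \<Omega> outer_nbhd_open[of \<delta> \<Omega>] by auto
  obtain v where v: "u \<in> Lp p (outer_nbhd \<delta> \<Omega>)" "v \<in> Lp p \<Omega>" "is_nl_grad s \<delta> w \<Omega> u v"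
    using u by (auto simp: H_nl_def)
  obtain u' where u': "Lp_borel p u'" "borel_rep (outer_nbhd \<delta> \<Omega>) u u'" using Lp_ex_borel_rep[OF S(2) v(1)] by metis
  obtain g where g: "Lp_borel p g" "borel_rep \<Omega> v g" using Lp_ex_borel_rep[OF S(1) v(2)] by metis
  \<comment> \<open>\<open>g\<close> vanishes off \<Omega> almost everywhere only; the indicator
    makes this hold at every point.\<close>
  define v' where "v' x = indicat_real \<Omega> x *\<^sub>R g x" for x
  have v'b: "v' \<in> borel_measurable borel" using Lp_borel_measurable[OF g(1)] \<Omega> unfolding v'_def[abs_def] by simp
  have ae: "AE x in lebesgue. g x = v' x"
    using g(2) unfolding borel_rep_def by eventually_elim (auto simp: v'_def indicator_def split: if_splits)
  have "Measurable.pred lborel (\<lambda>x. g x = v' x)" using Lp_borel_measurable[OF g(1)] v'b by measurable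
  with ae have "AE x in lborel. g x = v' x" by (simp add: AE_completion_iff)
  then have L: "Lp_borel p v'" by (rule Lp_borel_cong_AE[OF g(1) v'b])
  have r: "borel_rep \<Omega> v v'" using g(2) ae unfolding borel_rep_def by eventually_elim simp
  show ?thesis
    using is_nl_grad_iff[OF \<Omega> u' L r] v(3) u' L
    by (intro exI[of _ u'] exI[of _ v'] conjI) (auto simp: v'_def)
qed

end

section \<open>The equivalence\<close>

text \<open>Comparing \<open>p\<close>-th powers is enough: taking roots turns \<open>C\<close> into
  \<open>C powr (1 / p)\<close>.\<close>

lemma equivalent_norms_powrI:
  assumes C: "0 < C" and p: "0 < p"
    and N: "\<And>u. u \<in> V \<Longrightarrow> \<exists>A B. 0 \<le> A \<and> 0 \<le> B \<and> N1 u = A powr (1 / p) \<and> N2 u = B powr (1 / p) \<and>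
      A \<le> C * B \<and> B \<le> C * A"
  shows "equivalent_norms_on V N1 N2"
proof -
  have "C powr (- (1 / p)) * N1 u \<le> N2 u \<and> N2 u \<le> C powr (1 / p) * N1 u" if u: "u \<in> V" for u
  proof
  obtain A B where A: "0 \<le> A" "0 \<le> B" "N1 u = A powr (1 / p)" "N2 u = B powr (1 / p)" "A \<le> C * B" "B \<le> C * A"
    using N[OF u] by blast
  have "A powr (1 / p) \<le> (C * B) powr (1 / p)" using A p by (intro powr_mono2) auto
  then have "A powr (1 / p) \<le> C powr (1 / p) * B powr (1 / p)" using A C by (simp add: powr_mult)
  then have "C powr (- (1 / p)) * A powr (1 / p) \<le> C powr (- (1 / p)) * (C powr (1 / p) * B powr (1 / p))"
    by (rule mult_left_mono) simp
  also have "\<dots> = B powr (1 / p)" using C by (simp add: mult.assoc[symmetric] powr_add[symmetric])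
  finally show "C powr (- (1 / p)) * N1 u \<le> N2 u" using A by simp
  have "B powr (1 / p) \<le> (C * A) powr (1 / p)" using A p by (intro powr_mono2) auto
  then show "N2 u \<le> C powr (1 / p) * N1 u" using A C by (simp add: powr_mult)
  qed
  moreover have "C powr (- (1 / p)) > 0" "C powr (1 / p) > 0" using C by auto
  ultimately show ?thesis unfolding equivalent_norms_on_def by blast
qed

text \<open>Otherwise the ball around \<open>x\<close>, being connected, would meet both \<Omega>
  and its complement and hence the frontier, at distance below \<delta> from
  \<open>x\<close>.\<close>

lemma inner_part_ball:
  assumes "frontier \<Omega> \<noteq> {}" "x \<in> inner_part \<delta> \<Omega>" "dist x y < \<delta>"
  shows "y \<in> \<Omega>"
proof (rule ccontr)
  assume y: "y \<notin> \<Omega>"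
  have x: "x \<in> \<Omega>" "infdist x (frontier \<Omega>) > \<delta>" using assms by (auto simp: inner_part_def)
  have "0 < \<delta>" using assms(3) zero_le_dist[of x y] by linarith
  then have "x \<in> ball x \<delta> \<inter> \<Omega>" "y \<in> ball x \<delta> - \<Omega>" using x y assms(3) by auto
  then have "ball x \<delta> \<inter> frontier \<Omega> \<noteq> {}"
    by (intro connected_Int_frontier connected_ball) blast+
  then obtain z where z: "z \<in> frontier \<Omega>" "dist x z < \<delta>" by auto
  then show False using x(2) infdist_le[OF z(1), of x] by linarith
qed

context nonlocal_setup
begin

lemma nl_of_weak_grad:
  assumes r: "borel_rep UNIV u u'" and W: "weak_grad u' v'"
  shows "u \<in> H_nl s p \<delta> w UNIV" "borel_rep UNIV (nl_grad s \<delta> w UNIV u) v'"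
    "H_nl_norm s p \<delta> w UNIV u = (Lp_pow p u' + Lp_pow p v') powr (1 / p)"
proof -
  note L = weak_grad_LB[OF W]
  have r': "borel_rep (outer_nbhd \<delta> UNIV) u u'" using r \<delta> by (simp add: outer_nbhd_UNIV)
  note n = nl_grad_rep[OF open_UNIV L(1) r' L(2) _ weak_grad_test[OF W]]
  show "u \<in> H_nl s p \<delta> w UNIV" "borel_rep UNIV (nl_grad s \<delta> w UNIV u) v'"
    "H_nl_norm s p \<delta> w UNIV u = (Lp_pow p u' + Lp_pow p v') powr (1 / p)"
    using n by auto
qed

lemma H_nl_UNIV_ex_borel_rep:
  assumes u: "u \<in> H_nl s p \<delta> w UNIV"
  shows "\<exists>u' v'. borel_rep UNIV u u' \<and> weak_grad u' v'"
proof -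
  obtain u' v' where "Lp_borel p u'" "borel_rep (outer_nbhd \<delta> UNIV) u u'" "Lp_borel p v'"
    "\<And>\<psi>. \<psi> \<in> test_functions UNIV \<Longrightarrow> (LBINT x. v' x \<bullet> \<psi> x) = - (LBINT x. u' x * divK \<psi> x)"
    using H_nl_ex_borel_rep[OF open_UNIV u] by blast
  then show ?thesis using \<delta> by (auto simp: weak_grad_def outer_nbhd_UNIV)
qed

lemma borel_rep_UNIV_AE: "borel_rep UNIV f g \<longleftrightarrow> (AE x in lebesgue. f x = g x)"
  by (simp add: borel_rep_def)

lemma is_riesz_grad_iff:
  assumes u: "Lp_borel p u'" "borel_rep UNIV u u'" and v: "Lp_borel p v'" "borel_rep UNIV v v'"
  shows "is_riesz_grad s u v \<longleftrightarrow> weak_grad u' (\<lambda>x. v' x + convk u' x)"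
proof -
  have "(\<integral>x. v x \<bullet> \<psi> x \<partial>lebesgue) = (LBINT x. v' x \<bullet> \<psi> x)"
    "(\<integral>x. u x * riesz_div s \<psi> x \<partial>lebesgue) = (LBINT x. u' x * riesz_div s \<psi> x)"
    if \<psi>: "\<psi> \<in> test_functions UNIV" for \<psi> :: "real^'n \<Rightarrow> real^'n"
  proof -
    note [measurable] = test_functions_borel[OF \<psi>] riesz_div_borel[OF \<psi>] Lp_borel_measurable[OF u(1)] Lp_borel_measurable[OF v(1)]
    show "(\<integral>x. v x \<bullet> \<psi> x \<partial>lebesgue) = (LBINT x. v' x \<bullet> \<psi> x)"
    proof (rule lebesgue_integral_borel_version)
      show "AE x in lebesgue. v x \<bullet> \<psi> x = v' x \<bullet> \<psi> x"
        using v(2) unfolding borel_rep_UNIV_AE by eventually_elim simp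
    qed measurable
    show "(\<integral>x. u x * riesz_div s \<psi> x \<partial>lebesgue) = (LBINT x. u' x * riesz_div s \<psi> x)"
    proof (rule lebesgue_integral_borel_version)
      show "AE x in lebesgue. u x * riesz_div s \<psi> x = u' x * riesz_div s \<psi> x"
        using u(2) unfolding borel_rep_UNIV_AE by eventually_elim simp
    qed measurable
  qed
  then show ?thesis
    unfolding is_riesz_grad_def riesz_iff_weak_grad[OF u(1) v(1), symmetric] using borel_rep_L1_loc[OF v(2,1)] by auto
qed

lemma riesz_of_weak_grad:
  assumes r: "borel_rep UNIV u u'" and W: "weak_grad u' v'"
  shows "u \<in> H_riesz s p" "borel_rep UNIV (riesz_grad s u) (\<lambda>x. v' x - convk u' x)"
    "H_riesz_norm s p u = (Lp_pow p u' + Lp_pow p (\<lambda>x. v' x - convk u' x)) powr (1 / p)"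
proof -
  note L = weak_grad_LB[OF W]
  define g where "g x = v' x - convk u' x" for x
  have g: "Lp_borel p g" unfolding g_def[abs_def] using Lp_borel_diff(1)[OF L(2) convk_LB[OF L(1)]] p by simp
  have rg: "borel_rep UNIV g g" by (simp add: borel_rep_UNIV_AE)
  have isg: "is_riesz_grad s u g"
    using is_riesz_grad_iff[OF L(1) r g rg] W by (simp add: g_def)
  have S: "UNIV \<in> sets lebesgue" by simp
  show "u \<in> H_riesz s p"
    unfolding H_riesz_def using isg borel_rep_Lp(1)[OF S L(1) r] borel_rep_Lp(1)[OF S g rg] by blast
  have "is_riesz_grad s u (riesz_grad s u)"
    unfolding riesz_grad_def by (rule someI[of "is_riesz_grad s u", OF isg])
  then have "AE x in lebesgue. x \<in> UNIV \<longrightarrow> riesz_grad s u x = g x"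
    using isg by (intro weak_gradient_unique[OF open_UNIV]) (auto simp: is_riesz_grad_def lebesgue_on_UNIV_eq)
  then have rr: "borel_rep UNIV (riesz_grad s u) g" by (simp add: borel_rep_UNIV_AE)
  then show "borel_rep UNIV (riesz_grad s u) (\<lambda>x. v' x - convk u' x)" by (simp add: g_def[abs_def])
  have "H_riesz_norm s p u = (Lp_pow p u' + Lp_pow p g) powr (1 / p)"
    unfolding H_riesz_norm_def borel_rep_Lp(2)[OF S L(1) r] borel_rep_Lp(2)[OF S g rr]
    using p by (simp add: powr_powr Lp_pow_nonneg)
  then show "H_riesz_norm s p u = (Lp_pow p u' + Lp_pow p (\<lambda>x. v' x - convk u' x)) powr (1 / p)"
    by (simp add: g_def[abs_def])
qed

lemma H_riesz_ex_borel_rep: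
  assumes u: "u \<in> H_riesz s p"
  shows "\<exists>u' v'. borel_rep UNIV u u' \<and> weak_grad u' v'"
proof -
  have S: "UNIV \<in> sets lebesgue" by simp
  obtain v where v: "u \<in> Lp p UNIV" "v \<in> Lp p UNIV" "is_riesz_grad s u v"
    using u by (auto simp: H_riesz_def)
  obtain u' where u': "Lp_borel p u'" "borel_rep UNIV u u'" using Lp_ex_borel_rep[OF S v(1)] by metis
  obtain v' where v': "Lp_borel p v'" "borel_rep UNIV v v'" using Lp_ex_borel_rep[OF S v(2)] by metis
  show ?thesis using is_riesz_grad_iff[OF u' v'] u'(2) v(3) by blast
qed

lemma H_riesz_eq_H_nl: "H_riesz s p = H_nl s p \<delta> w UNIV"
  using H_riesz_ex_borel_rep H_nl_UNIV_ex_borel_rep nl_of_weak_grad(1) riesz_of_weak_grad(1) by blast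

text \<open>The gradients differ by the convolution with \<open>k\<close>, which Young's inequality
  bounds by \<open>u'\<close>. The direction affects only its sign, so one constant serves both. In
  \<open>C\<close>, 1 and the last term multiply the part from \<open>u'\<close>, and
  \<open>2 powr p\<close> the part from the gradient.\<close>

lemma norm_comparison:
  defines "C \<equiv> 1 + 2 powr p + 2 powr p * (LBINT z. norm (k z)) powr p"
  assumes W: "weak_grad u' v'"
  shows "Lp_pow p u' + Lp_pow p (\<lambda>x. v' x - convk u' x) \<le> C * (Lp_pow p u' + Lp_pow p v')"
    "Lp_pow p u' + Lp_pow p v' \<le> C * (Lp_pow p u' + Lp_pow p (\<lambda>x. v' x - convk u' x))"
proof -
  note L = weak_grad_LB[OF W]
  define M where "M = (LBINT z. norm (k z)) powr p"
  have M: "M \<ge> 0" by (simp add: M_def)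
  have p0: "0 \<le> p" using p by simp
  note c = convk_LB[OF L(1)]
  have ck: "Lp_pow p (convk u') \<le> M * Lp_pow p u'" using convk_pn[OF L(1)] by (simp add: M_def)
  have main: "a + b \<le> C * (a + b')" if "b \<le> 2 powr p * (b' + M * a)" "0 \<le> a" "0 \<le> b'" for a b b'
  proof -
    have "a + b \<le> a + 2 powr p * b' + 2 powr p * M * a" using that(1) by (simp add: algebra_simps)
    also have "\<dots> \<le> C * (a + b')"
      using that M by (simp add: C_def M_def[symmetric] algebra_simps)
    finally show ?thesis .
  qed
  have "Lp_pow p (\<lambda>x. v' x - convk u' x) \<le> 2 powr p * (Lp_pow p v' + Lp_pow p (convk u'))"
    by (rule Lp_borel_diff(2)[OF L(2) c p0])
  also have "\<dots> \<le> 2 powr p * (Lp_pow p v' + M * Lp_pow p u')" using ck by (intro mult_left_mono add_left_mono) auto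
  finally show "Lp_pow p u' + Lp_pow p (\<lambda>x. v' x - convk u' x) \<le> C * (Lp_pow p u' + Lp_pow p v')"
    by (intro main Lp_pow_nonneg)
  have "Lp_pow p v' \<le> 2 powr p * (Lp_pow p (\<lambda>x. v' x - convk u' x) + Lp_pow p (convk u'))"
    using Lp_borel_add(2)[OF Lp_borel_diff(1)[OF L(2) c p0] c p0] by simp
  also have "\<dots> \<le> 2 powr p * (Lp_pow p (\<lambda>x. v' x - convk u' x) + M * Lp_pow p u')"
    using ck by (intro mult_left_mono add_left_mono) auto
  finally show "Lp_pow p u' + Lp_pow p v' \<le> C * (Lp_pow p u' + Lp_pow p (\<lambda>x. v' x - convk u' x))"
    by (intro main Lp_pow_nonneg)
qed

text \<open>\<open>N\<close> is left abstract so that the whole-space norm and the norm on \<Omega>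
  are treated alike.\<close>

lemma H_norms_equivalent:
  assumes "\<And>u. u \<in> V \<Longrightarrow> \<exists>u' v'. borel_rep UNIV u u' \<and> weak_grad u' v' \<and> N u = (Lp_pow p u' + Lp_pow p v') powr (1 / p)"
  shows "equivalent_norms_on V (H_riesz_norm s p) N"
proof (rule equivalent_norms_powrI)
  show "0 < 1 + 2 powr p + 2 powr p * (LBINT z. norm (k z)) powr p"
    by (intro add_pos_nonneg) auto
  show "0 < p" using p by simp
  fix u assume "u \<in> V"
  then obtain u' v' where *: "borel_rep UNIV u u'" "weak_grad u' v'" "N u = (Lp_pow p u' + Lp_pow p v') powr (1 / p)"
    using assms by blast
  show "\<exists>A B. 0 \<le> A \<and> 0 \<le> B \<and> H_riesz_norm s p u = A powr (1 / p) \<and> N u = B powr (1 / p) \<and>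
      A \<le> (1 + 2 powr p + 2 powr p * (LBINT z. norm (k z)) powr p) * B \<and>
      B \<le> (1 + 2 powr p + 2 powr p * (LBINT z. norm (k z)) powr p) * A"
    using riesz_of_weak_grad(3)[OF *(1,2)] *(3) norm_comparison[OF *(2)]
    by (intro exI[of _ "Lp_pow p u' + Lp_pow p (\<lambda>x. v' x - convk u' x)"] exI[of _ "Lp_pow p u' + Lp_pow p v'"] conjI
        add_nonneg_nonneg Lp_pow_nonneg)
qed

lemma nl_grad_formula:
  assumes r: "borel_rep UNIV u u'" and W: "weak_grad u' v'"
  shows "AE x in lebesgue. v' x = riesz_grad s u x + convol k u x"
  using riesz_of_weak_grad(2)[OF assms] unfolding borel_rep_UNIV_AE
  by eventually_elim (simp add: convol_eq[OF r Lp_borel_measurable[OF weak_grad_LB(1)[OF W]]])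

lemma H_riesz_0_ex_borel_rep:
  assumes U: "open U" and u: "u \<in> H_riesz_0 s p U"
  shows "\<exists>u' v'. borel_rep UNIV u u' \<and> weak_grad u' v' \<and> (\<forall>x. x \<notin> U \<longrightarrow> u' x = 0)"
proof -
  have "u \<in> H_riesz s p" and u0: "AE x in lebesgue. x \<notin> U \<longrightarrow> u x = 0" using u by (auto simp: H_riesz_0_def)
  then obtain u' v' where r: "borel_rep UNIV u u'" and W: "weak_grad u' v'" using H_riesz_ex_borel_rep by blast
  note L = weak_grad_LB[OF W]
  \<comment> \<open>A representative that is zero at every point off \<open>U\<close>, as the
    support arguments below require.\<close>
  define u1 where "u1 x = indicat_real U x *\<^sub>R u' x" for x
  have u1: "u1 \<in> borel_measurable borel" using Lp_borel_measurable[OF L(1)] U unfolding u1_def[abs_def] by simp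
  have ae: "AE x in lebesgue. u' x = u1 x"
    using r u0 unfolding borel_rep_UNIV_AE by eventually_elim (auto simp: u1_def indicator_def)
  moreover have "Measurable.pred lborel (\<lambda>x. u' x = u1 x)" using Lp_borel_measurable[OF L(1)] u1 by measurable
  ultimately have "AE x in lborel. u' x = u1 x" by (simp add: AE_completion_iff)
  then have "weak_grad u1 v'" by (intro weak_grad_cong_AE[OF W u1] Lp_borel_measurable[OF L(2)]) auto
  moreover have "borel_rep UNIV u u1" using r ae unfolding borel_rep_UNIV_AE by eventually_elim simp
  ultimately show ?thesis by (intro exI conjI) (auto simp: u1_def)
qed

text \<open>Points off \<Omega> have distance at least \<delta> from the shrunken set, while the
  gradient reaches only up to \<open>\<rho> < \<delta>\<close>. So \<open>v'\<close> vanishes almost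
  everywhere off \<Omega>, and restricting it to \<Omega> loses nothing.\<close>

lemma local_of_weak_grad:
  assumes \<Omega>: "open \<Omega>" "frontier \<Omega> \<noteq> {}" and ne: "inner_part \<delta> \<Omega> \<noteq> {}"
    and r: "borel_rep UNIV u u'" and W: "weak_grad u' v'" and u0: "\<And>x. x \<notin> inner_part \<delta> \<Omega> \<Longrightarrow> u' x = 0"
  shows "u \<in> H_nl s p \<delta> w \<Omega>" "AE x in lebesgue. x \<in> \<Omega> \<longrightarrow> nl_grad s \<delta> w \<Omega> u x = v' x"
    "H_nl_norm s p \<delta> w \<Omega> u = (Lp_pow p u' + Lp_pow p v') powr (1 / p)"
proof -
  let ?U = "inner_part \<delta> \<Omega>"
  note L = weak_grad_LB[OF W]
  obtain \<rho> where \<rho>: "0 < \<rho>" "\<rho> < \<delta>" "\<And>z. \<rho> \<le> norm z \<Longrightarrow> w z = 0" using w_support by metis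
  \<comment> \<open>The fundamental lemma works on open sets; this one contains the complement of
    \<Omega>.\<close>
  have "AE x in lborel. x \<in> {y. \<rho> < infdist y ?U} \<longrightarrow> v' x = 0"
  proof (rule weak_grad_vanishes[OF W _ \<rho>(1,3)])
    show "open {y. \<rho> < infdist y ?U}"
      by (intro open_Collect_less continuous_on_const continuous_on_infdist continuous_on_id)
    fix x y assume "u' x \<noteq> 0" "dist x y < \<rho>"
    then have "x \<in> ?U" "dist y x < \<rho>" using u0 by (auto simp: dist_commute)
    then show "y \<notin> {y. \<rho> < infdist y ?U}" using infdist_le[of x ?U y] by auto
  qed auto
  moreover have far: "\<rho> < infdist y ?U" if "y \<notin> \<Omega>" for y
  proof -
    have "\<delta> \<le> infdist y ?U"
      unfolding infdist_notempty[OF ne]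
    proof (rule cINF_greatest[OF ne])
      fix x assume "x \<in> ?U"
      then show "\<delta> \<le> dist y x" using inner_part_ball[OF \<Omega>(2), of x \<delta> y] that by (force simp: dist_commute)
    qed
    then show ?thesis using \<rho> by simp
  qed
  ultimately have v0: "AE x in lborel. x \<notin> \<Omega> \<longrightarrow> v' x = 0"
    by (auto elim!: eventually_mono)
  define g where "g x = indicat_real \<Omega> x *\<^sub>R v' x" for x
  have g: "g \<in> borel_measurable borel" using Lp_borel_measurable[OF L(2)] \<Omega>(1) unfolding g_def[abs_def] by simp
  have vg: "AE x in lborel. v' x = g x" using v0 by eventually_elim (auto simp: g_def indicator_def)
  have Wg: "weak_grad u' g" by (rule weak_grad_cong_AE[OF W Lp_borel_measurable[OF L(1)] _ g vg]) simp
  have sub: "?U \<subseteq> outer_nbhd \<delta> \<Omega>"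
    using \<delta> by (auto simp: inner_part_def intro!: mem_outer_nbhd[of _ \<Omega>])
  have r': "borel_rep (outer_nbhd \<delta> \<Omega>) u u'"
    using r unfolding borel_rep_def
  proof eventually_elim
    case (elim x)
    then show ?case using sub u0[of x] by (auto simp: indicator_def)
  qed
  note n = nl_grad_rep[OF \<Omega>(1) L(1) r' weak_grad_LB(2)[OF Wg] _ weak_grad_test[OF Wg]]
  have g0: "g x = 0" if "x \<notin> \<Omega>" for x using that by (simp add: g_def)
  show "u \<in> H_nl s p \<delta> w \<Omega>" by (rule n(1)) (rule g0)
  have "borel_rep \<Omega> (nl_grad s \<delta> w \<Omega> u) g" by (rule n(2)) (rule g0)
  then show "AE x in lebesgue. x \<in> \<Omega> \<longrightarrow> nl_grad s \<delta> w \<Omega> u x = v' x"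
    unfolding borel_rep_def by eventually_elim (auto simp: g_def indicator_def)
  have "H_nl_norm s p \<delta> w \<Omega> u = (Lp_pow p u' + Lp_pow p g) powr (1 / p)" by (rule n(3)) (rule g0)
  then show "H_nl_norm s p \<delta> w \<Omega> u = (Lp_pow p u' + Lp_pow p v') powr (1 / p)"
    using Lp_pow_cong_AE[OF Lp_borel_measurable[OF L(2)] g vg] by simp
qed

text \<open>The Lipschitz assumption enters here, through density: approximation over the whole
  space becomes approximation in the norm on \<Omega>, because the two norms agree for
  \<open>u - \<phi>\<close>.\<close>

lemma H_riesz_0_subset:
  assumes \<Omega>: "open \<Omega>" "frontier \<Omega> \<noteq> {}" "bounded \<Omega>" and ne: "inner_part \<delta> \<Omega> \<noteq> {}"
    and lip: "lipschitz_domain (inner_part \<delta> \<Omega>)" and u: "u \<in> H_riesz_0 s p (inner_part \<delta> \<Omega>)"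
  shows "u \<in> H_nl_0_ext s p \<delta> w \<Omega>"
proof -
  let ?U = "inner_part \<delta> \<Omega>"
  have U: "open ?U" using lip by (simp add: lipschitz_domain_def)
  have bU: "bounded ?U" using \<Omega>(3) by (rule bounded_subset) (auto simp: inner_part_def)
  obtain u' v' where r: "borel_rep UNIV u u'" and W: "weak_grad u' v'" and u0: "\<And>x. x \<notin> ?U \<Longrightarrow> u' x = 0"
    using H_riesz_0_ex_borel_rep[OF U u] by blast
  have "\<exists>\<phi>\<in>test_functions ?U. H_nl_norm s p \<delta> w \<Omega> (\<lambda>x. u x - \<phi> x) < \<epsilon>" if \<epsilon>: "\<epsilon> > 0" for \<epsilon>
  proof -
    \<comment> \<open>Half of the \<open>p\<close>-th power of \<open>\<epsilon>\<close> for the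
      function, half for its gradient.\<close>
    have "\<epsilon> powr p / 2 > 0" using \<epsilon> by simp
    then obtain \<phi> where \<phi>: "\<phi> \<in> test_functions ?U" "Lp_pow p (\<lambda>x. u' x - \<phi> x) < \<epsilon> powr p / 2"
      "Lp_pow p (\<lambda>x. v' x - gradK \<phi> x) < \<epsilon> powr p / 2"
      using approx_lipschitz[OF lip bU W u0] unfolding approx_def by blast
    have \<phi>0: "\<phi> x = 0" if "x \<notin> ?U" for x using \<phi>(1) that by (auto simp: test_functions_iff)
    have r': "borel_rep UNIV (\<lambda>x. u x - \<phi> x) (\<lambda>x. u' x - \<phi> x)"
      using r unfolding borel_rep_UNIV_AE by eventually_elim simp
    have "H_nl_norm s p \<delta> w \<Omega> (\<lambda>x. u x - \<phi> x) =
        (Lp_pow p (\<lambda>x. u' x - \<phi> x) + Lp_pow p (\<lambda>x. v' x - gradK \<phi> x)) powr (1 / p)"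
      by (rule local_of_weak_grad(3)[OF \<Omega>(1,2) ne r' weak_grad_diff[OF W weak_grad_test_function[OF \<phi>(1)]]]) (simp add: u0 \<phi>0)
    also have "\<dots> < (\<epsilon> powr p) powr (1 / p)"
      using \<phi>(2,3) p by (intro powr_less_mono2 add_nonneg_nonneg Lp_pow_nonneg) auto
    also have "\<dots> = \<epsilon>" using \<epsilon> p by (simp add: powr_powr)
    finally show ?thesis using \<phi>(1) by blast
  qed
  then have "u \<in> H_nl_0 s p \<delta> w \<Omega>"
    using local_of_weak_grad(1)[OF \<Omega>(1,2) ne r W u0] by (simp add: H_nl_0_def)
  moreover have "AE x in lebesgue. u x = (if x \<in> outer_nbhd \<delta> \<Omega> then u x else 0)"
    using r unfolding borel_rep_UNIV_AE
  proof eventually_elim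
    case (elim x)
    have "?U \<subseteq> outer_nbhd \<delta> \<Omega>"
      using \<delta> by (auto simp: inner_part_def intro!: mem_outer_nbhd[of _ \<Omega>])
    then show ?case using elim u0[of x] by auto
  qed
  ultimately show ?thesis unfolding H_nl_0_ext_def by blast
qed

text \<open>Elements of the closure satisfy the gradient identity against tests in \<Omega> only.
  Gradients of the approximating test functions vanish off \<Omega>, as does \<open>D\<close>, so
  convergence on \<Omega> is convergence on the whole space, where closedness of the weak gradient
  applies. Vanishing off the shrunken set also passes to the limit.\<close>

lemma H_nl_0_ext_subset:
  assumes \<Omega>: "open \<Omega>" "frontier \<Omega> \<noteq> {}" and U: "open (inner_part \<delta> \<Omega>)"
    and u: "u \<in> H_nl_0_ext s p \<delta> w \<Omega>"
  shows "u \<in> H_riesz_0 s p (inner_part \<delta> \<Omega>)"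
proof -
  let ?U = "inner_part \<delta> \<Omega>" and ?O = "outer_nbhd \<delta> \<Omega>"
  have p0: "0 \<le> p" "0 < p" using p by auto
  have sub: "?U \<subseteq> ?O" "?U \<subseteq> \<Omega>"
    using \<delta> by (auto simp: inner_part_def intro!: mem_outer_nbhd[of _ \<Omega>])
  obtain v where v: "v \<in> H_nl_0 s p \<delta> w \<Omega>" "AE x in lebesgue. u x = (if x \<in> ?O then v x else 0)"
    using u by (auto simp: H_nl_0_ext_def)
  then have vH: "v \<in> H_nl s p \<delta> w \<Omega>"
    and ap: "\<And>\<epsilon>. \<epsilon> > 0 \<Longrightarrow> \<exists>\<phi>\<in>test_functions ?U. H_nl_norm s p \<delta> w \<Omega> (\<lambda>x. v x - \<phi> x) < \<epsilon>"
    by (auto simp: H_nl_0_def)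
  obtain v' D where v': "Lp_borel p v'" "borel_rep ?O v v'" and D: "Lp_borel p D" "\<And>x. x \<notin> \<Omega> \<Longrightarrow> D x = 0"
    and eq: "\<And>\<psi>. \<psi> \<in> test_functions \<Omega> \<Longrightarrow> (LBINT x. D x \<bullet> \<psi> x) = - (LBINT x. v' x * divK \<psi> x)"
    using H_nl_ex_borel_rep[OF \<Omega>(1) vH] by blast
  obtain \<rho> where \<rho>: "0 < \<rho>" "\<rho> < \<delta>" "\<And>z. \<rho> \<le> norm z \<Longrightarrow> w z = 0" using w_support by metis
  have close: "\<exists>\<phi>\<in>test_functions ?U. Lp_pow p (\<lambda>x. v' x - \<phi> x) < e \<and> Lp_pow p (\<lambda>x. D x - gradK \<phi> x) < e" if e: "e > 0" for e
  proof -
    \<comment> \<open>The norm is a \<open>p\<close>-th root, so accuracy \<open>e\<close> for the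
      powers requires \<open>e powr (1 / p)\<close>.\<close>
    have "e powr (1 / p) > 0" using e by simp
    then obtain \<phi> where \<phi>: "\<phi> \<in> test_functions ?U"
      and n: "H_nl_norm s p \<delta> w \<Omega> (\<lambda>x. v x - \<phi> x) < e powr (1 / p)" using ap by blast
    have \<phi>0: "\<phi> x = 0" if "x \<notin> ?U" for x using \<phi> that by (auto simp: test_functions_iff)
    have G0: "gradK \<phi> x = 0" if "x \<notin> \<Omega>" for x
    proof (rule gradK_eq_0[OF _ \<rho>(1,3)])
      fix z :: "real^'n" assume "norm z < \<rho>"
      then have "dist (x - z) x < \<delta>" using \<rho>(2) by (simp add: dist_norm)
      then have "x - z \<notin> ?U" using inner_part_ball[OF \<Omega>(2), of "x - z" \<delta> x] that by blast
      then show "\<phi> (x - z) = 0" by (rule \<phi>0)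
    qed
    note W\<phi> = weak_grad_test_function[OF \<phi>]
    note L\<phi> = weak_grad_LB[OF W\<phi>]
    have "H_nl_norm s p \<delta> w \<Omega> (\<lambda>x. v x - \<phi> x) =
        (Lp_pow p (\<lambda>x. v' x - \<phi> x) + Lp_pow p (\<lambda>x. D x - gradK \<phi> x)) powr (1 / p)"
    proof (rule nl_grad_rep(3)[OF \<Omega>(1)])
      show L1: "Lp_borel p (\<lambda>x. v' x - \<phi> x)" by (rule Lp_borel_diff(1)[OF v'(1) L\<phi>(1) p0(1)])
      show "borel_rep ?O (\<lambda>x. v x - \<phi> x) (\<lambda>x. v' x - \<phi> x)"
        using v'(2) unfolding borel_rep_def
      proof eventually_elim
        case (elim x)
        have "\<phi> x = 0" if "x \<notin> ?O" using \<phi>0 sub(1) that by blast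
        with elim show ?case by (auto simp: indicator_def)
      qed
      show "Lp_borel p (\<lambda>x. D x - gradK \<phi> x)" by (rule Lp_borel_diff(1)[OF D(1) L\<phi>(2) p0(1)])
      show "D x - gradK \<phi> x = 0" if "x \<notin> \<Omega>" for x using D(2) G0 that by simp
      fix \<psi> :: "real^'n \<Rightarrow> real^'n" assume \<psi>: "\<psi> \<in> test_functions \<Omega>"
      note i = pairing_integrable[OF v'(1) D(1) \<psi>] pairing_integrable[OF L\<phi> \<psi>]
      show "(LBINT x. (D x - gradK \<phi> x) \<bullet> \<psi> x) = - (LBINT x. (v' x - \<phi> x) * divK \<psi> x)"
        using eq[OF \<psi>] weak_grad_test[OF W\<phi> \<psi>] i by (simp add: inner_diff_left left_diff_distrib)
    qed
    with n have "(Lp_pow p (\<lambda>x. v' x - \<phi> x) + Lp_pow p (\<lambda>x. D x - gradK \<phi> x)) powr (1 / p) < e powr (1 / p)" by simp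
    then have "Lp_pow p (\<lambda>x. v' x - \<phi> x) + Lp_pow p (\<lambda>x. D x - gradK \<phi> x) < e"
      using e p0 powr_mono2[of "1 / p" e "Lp_pow p (\<lambda>x. v' x - \<phi> x) + Lp_pow p (\<lambda>x. D x - gradK \<phi> x)"] by force
    then show ?thesis
      using \<phi> Lp_pow_nonneg[of p "\<lambda>x. v' x - \<phi> x"] Lp_pow_nonneg[of p "\<lambda>x. D x - gradK \<phi> x"]
      by (intro bexI[of _ \<phi>] conjI) auto
  qed
  have W: "weak_grad v' D"
  proof (rule weak_grad_limit[OF v'(1) D(1)])
    fix e :: real assume "0 < e"
    from close[OF this] show "\<exists>u' w'. weak_grad u' w' \<and> Lp_pow p (\<lambda>x. v' x - u' x) < e \<and> Lp_pow p (\<lambda>x. D x - w' x) < e"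
      using weak_grad_test_function by blast
  qed
  have r: "borel_rep UNIV u v'"
    using v(2) v'(2) unfolding borel_rep_def by eventually_elim (auto simp: indicator_def split: if_splits)
  \<comment> \<open>The part of \<open>v'\<close> off the shrunken set, where every
    \<open>\<phi>\<close> is zero: there \<open>|h| = |v' - \<phi>|\<close>, so the norm of
    \<open>h\<close> is below every positive bound.\<close>
  define h where "h x = indicat_real (- ?U) x *\<^sub>R v' x" for x
  note [measurable] = Lp_borel_measurable[OF v'(1)]
  have [measurable]: "- ?U \<in> sets borel" using U by simp
  have h: "h \<in> borel_measurable borel" unfolding h_def[abs_def] by measurable
  have hi: "Lp_borel p h"
    by (rule Lp_borel_dominated(1)[OF h, of "\<lambda>x. norm (v' x)" p 1])
      (use v'(1) p0 in \<open>auto simp: Lp_borel_def h_def indicator_def\<close>)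
  have "Lp_pow p h \<le> 0 + e" if e: "e > 0" for e
  proof -
    obtain \<phi> where \<phi>: "\<phi> \<in> test_functions ?U" "Lp_pow p (\<lambda>x. v' x - \<phi> x) < e" using close[OF e] by blast
    have "Lp_pow p h \<le> Lp_pow p (\<lambda>x. v' x - \<phi> x)"
      unfolding Lp_pow_def
    proof (rule integral_mono)
      show "integrable lborel (\<lambda>x. norm (h x) powr p)" using hi by (simp add: Lp_borel_def)
      show "integrable lborel (\<lambda>x. norm (v' x - \<phi> x) powr p)"
        using Lp_borel_diff(1)[OF v'(1) Lp_borel_test_functions[OF p \<phi>(1)] p0(1)] by (simp add: Lp_borel_def)
      fix x
      have "\<phi> x = 0" if "x \<notin> ?U" using \<phi>(1) that by (auto simp: test_functions_iff)
      then show "norm (h x) powr p \<le> norm (v' x - \<phi> x) powr p" by (auto simp: h_def indicator_def)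
    qed
    then show ?thesis using \<phi>(2) by simp
  qed
  then have "Lp_pow p h \<le> 0" by (rule field_le_epsilon)
  then have "Lp_pow p h = 0" using Lp_pow_nonneg[of p h] by simp
  then have "AE x in lborel. norm (h x) powr p = 0"
    using hi integral_nonneg_eq_0_iff_AE[of lborel "\<lambda>x. norm (h x) powr p"] by (simp add: Lp_pow_def Lp_borel_def)
  then have "AE x in lebesgue. norm (h x) powr p = 0" by (rule AE_completion)
  with r have "AE x in lebesgue. x \<notin> ?U \<longrightarrow> u x = 0"
    unfolding borel_rep_UNIV_AE by eventually_elim (auto simp: h_def indicator_def)
  then show ?thesis using riesz_of_weak_grad(1)[OF r W] by (simp add: H_riesz_0_def)
qed

end

theorem lemma2p16:
  fixes w :: "real^'n \<Rightarrow> real" and \<delta> s p :: real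
  assumes "\<delta> > 0" and "cutoff \<delta> w" and "0 < s" and "s < 1" and "1 \<le> p"
  shows
    "H_riesz s p = H_nl s p \<delta> w UNIV \<and>
     equivalent_norms_on (H_riesz s p) (H_riesz_norm s p) (H_nl_norm s p \<delta> w UNIV) \<and>
     smooth (grad_R s w) \<and> integrable lebesgue (grad_R s w) \<and>
     (\<exists>R. \<forall>x. GDERIV R x :> grad_R s w x) \<and>
     (\<forall>u \<in> H_riesz s p.
        AE x in lebesgue. nl_grad s \<delta> w UNIV u x = riesz_grad s u x + convol (grad_R s w) u x) \<and>
     (\<forall>\<Omega>. open \<Omega> \<and> bounded \<Omega> \<and> inner_part \<delta> \<Omega> \<noteq> {} \<and> lipschitz_domain (inner_part \<delta> \<Omega>) \<longrightarrow>
        H_riesz_0 s p (inner_part \<delta> \<Omega>) = H_nl_0_ext s p \<delta> w \<Omega> \<and>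
        equivalent_norms_on (H_riesz_0 s p (inner_part \<delta> \<Omega>)) (H_riesz_norm s p) (H_nl_norm s p \<delta> w \<Omega>) \<and>
        (\<forall>u \<in> H_riesz_0 s p (inner_part \<delta> \<Omega>).
           AE x in lebesgue_on \<Omega>. nl_grad s \<delta> w \<Omega> u x = riesz_grad s u x + convol (grad_R s w) u x))"
proof -
  interpret nonlocal_setup s p \<delta> w by unfold_locales (use assms in auto)
  show ?thesis
  proof (intro conjI allI impI ballI)
    show "H_riesz s p = H_nl s p \<delta> w UNIV" by (rule H_riesz_eq_H_nl)
    show "equivalent_norms_on (H_riesz s p) (H_riesz_norm s p) (H_nl_norm s p \<delta> w UNIV)"
      using H_riesz_ex_borel_rep nl_of_weak_grad(3) by (intro H_norms_equivalent) blast
    show "smooth (grad_R s w)" by (rule grad_R_smooth)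
    show "integrable lebesgue (grad_R s w)" by (rule k_integrable_lebesgue)
    show "\<exists>R. \<forall>x. GDERIV R x :> grad_R s w x" by (rule grad_R_potential)
    show "AE x in lebesgue. nl_grad s \<delta> w UNIV u x = riesz_grad s u x + convol (grad_R s w) u x"
      if u: "u \<in> H_riesz s p" for u
    proof -
      obtain u' v' where r: "borel_rep UNIV u u'" "weak_grad u' v'" using H_riesz_ex_borel_rep[OF u] by blast
      from nl_of_weak_grad(2)[OF r] nl_grad_formula[OF r] show ?thesis
        unfolding borel_rep_UNIV_AE by eventually_elim simp
    qed
    fix \<Omega> :: "(real^'n) set"
    assume \<Omega>: "open \<Omega> \<and> bounded \<Omega> \<and> inner_part \<delta> \<Omega> \<noteq> {} \<and> lipschitz_domain (inner_part \<delta> \<Omega>)"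
    let ?U = "inner_part \<delta> \<Omega>"
    \<comment> \<open>A bounded nonempty set is not the whole space, so its frontier is nonempty;
      this excludes the convention in \<open>inner_part\<close> for an empty frontier.\<close>
    have ne: "\<Omega> \<noteq> {}" "\<Omega> \<noteq> UNIV" using \<Omega> not_bounded_UNIV by (auto simp: inner_part_def)
    then have fr: "frontier \<Omega> \<noteq> {}" by (simp add: frontier_eq_empty)
    have U: "open ?U" using \<Omega> by (simp add: lipschitz_domain_def)
    show "H_riesz_0 s p ?U = H_nl_0_ext s p \<delta> w \<Omega>"
      using H_riesz_0_subset[of \<Omega>] H_nl_0_ext_subset[of \<Omega>] \<Omega> fr U by blast
    have loc: "\<exists>u' v'. borel_rep UNIV u u' \<and> weak_grad u' v' \<and> H_nl_norm s p \<delta> w \<Omega> u = (Lp_pow p u' + Lp_pow p v') powr (1 / p) \<and>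
        (AE x in lebesgue. x \<in> \<Omega> \<longrightarrow> nl_grad s \<delta> w \<Omega> u x = v' x)" if "u \<in> H_riesz_0 s p ?U" for u
    proof -
      obtain u' v' where r: "borel_rep UNIV u u'" "weak_grad u' v'" "\<And>x. x \<notin> ?U \<Longrightarrow> u' x = 0"
        using H_riesz_0_ex_borel_rep[OF U \<open>u \<in> H_riesz_0 s p ?U\<close>] by blast
      have "open \<Omega>" "?U \<noteq> {}" using \<Omega> by auto
      from local_of_weak_grad(2,3)[OF this(1) fr this(2) r] r(1,2) show ?thesis by blast
    qed
    show "equivalent_norms_on (H_riesz_0 s p ?U) (H_riesz_norm s p) (H_nl_norm s p \<delta> w \<Omega>)"
      using loc by (intro H_norms_equivalent) blast
    show "AE x in lebesgue_on \<Omega>. nl_grad s \<delta> w \<Omega> u x = riesz_grad s u x + convol (grad_R s w) u x"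
      if u: "u \<in> H_riesz_0 s p ?U" for u
    proof -
      obtain u' v' where r: "borel_rep UNIV u u'" "weak_grad u' v'"
        and ae: "AE x in lebesgue. x \<in> \<Omega> \<longrightarrow> nl_grad s \<delta> w \<Omega> u x = v' x" using loc[OF u] by blast
      have "AE x in lebesgue. x \<in> \<Omega> \<longrightarrow> nl_grad s \<delta> w \<Omega> u x = riesz_grad s u x + convol (grad_R s w) u x"
        using ae nl_grad_formula[OF r] by eventually_elim simp
      then show ?thesis using \<Omega> by (subst AE_restrict_space_iff) auto
    qed
  qed
qed

end
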